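(* For every NSP-map $M$, $\mathrm{T}(\operatorname{dual}(M))=h_{\mathcal T}(\mathrm{T}(M))$; equivalently $\operatorname{dual}=\mathrm{T}^{-1}\circ h_{\mathcal T}\circ\mathrm{T}$.
   Context: NSP-maps: a planar map is a connected graph (loops and multiple edges allowed) embedded in the plane, up to orientation-preserving homeomorphism, with a distinguished oriented edge (root) on the boundary of the outer (unbounded) face, the outer face lying on its left; the face on its right is the core face, the origin of the root is the root vertex. A map is separable if its edges can be partitioned into two nonempty sets with exactly one vertex incident to edges of both; an NSP-map is a non-separable planar map with at least two edges. Duality: $\operatorname{dual}(M)$ has a vertex $v_f$ in each face $f$ of $M$ and, for each edge $e$ of $M$ separating faces $f_1,f_2$, an edge $e^*$ joining $v_{f_1},v_{f_2}$ crossing only $e$, once. The root vertex of $\operatorname{dual}(M)$ is the vertex dual to the outer face of $M$, its root is the dual of the root of $M$ (starting at that vertex), and its outer face is the face dual to the root vertex of $M$. The dual of an NSP-map is an NSP-map. Decorated trees: depth of the root is $0$, traversal order is preorder (left-to-right). A decorated tree is a rooted plane tree with at least one edge, each leaf labeled by an integer $\ge-1$, such that (1) each leaf label is strictly less than the depth of its parent; (2) every internal node of depth $p>0$ has a descendant leaf labeled $\le p-2$; (3) for every internal node $t$ of depth $p$, every subtree $T''$ rooted at a child of $t$ and every leaf $\ell$ of $T''$ labeled $p$, the leaves of $T''$ preceding $\ell$ have labels $\ge p$. Free leaves are labeled $-1$; $\operatorname{fl}(T)$ counts them. $\Pi_{\mathcal T}(T)$ (root with one child) deletes the root and subtracts $1$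 from every non-free leaf label. For $T$ whose root has $\ge2$ children, $T_{hd}$ is the root with its leftmost child and that child's subtree, $T_{tl}$ the root with its other children and their subtrees. The rightmost path of a plane tree goes from the root to the last leaf, $\operatorname{rpath}$ is its number of edges, its nodes are numbered $1,2,\dots$ from the root. $h_{\mathcal T}$ on decorated trees, recursively: root with a single leaf child: $h_{\mathcal T}(T)=T$. Root with a single internal child: with $T'=\Pi_{\mathcal T}(T)$, $i=\operatorname{fl}(T)$, $h_{\mathcal T}(T)$ is $h_{\mathcal T}(T')$ with a new free leaf attached as rightmost child of the $i$-th node of its rightmost path. Root with $\ge2$ children, leftmost a leaf: with $T'$ = $T$ without that leaf, $h_{\mathcal T}(T)$ is $h_{\mathcal T}(T')$ with a new free leaf attached as child of its rightmost leaf. Root with $\ge2$ children, leftmost internal: let $T_1'=h_{\mathcal T}(T_{hd})$, $T_2'=h_{\mathcal T}(T_{tl})$, $r=\operatorname{rpath}(T_2')$, $\ell$ the rightmost leaf of $T_2'$; add $r$ to the label of every leaf of $T_1'$ except its rightmost one and replace $\ell$ in $T_2'$ by the resulting tree. The map $\mathrm{T}$ (a bijection from NSP-maps with $n+1$ edges to decorated trees with $n$ edges): for $M$ with root $e=(v\to u)$, delete $e$, mark $u,v$ visited, give $v$ depth $-1$ and $u$ depth $0$; $u$ is the root. Depth-first search from $u$: when a vertex $x$ is reached via an edge $f$ (for $x=u$, $f=e$), the edges around $x$ are examined in clockwise order starting just after $f$; an edge not examined before leading to an unvisited vertex $y$ makes $y$ a child of $x$ (depth one more) and the search continues from $y$ before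 resuming; an edge not examined before leading to an already visited vertex $z$ creates a leaf child of $x$ labeled by the depth of $z$. The plane structure is inherited from $M$ (children of each node, from left to right, in reverse order of creation).
   Formalization: The root of dual(M) is the dual of the edge preceding M's root clockwise around the root vertex (starting at the outer face's vertex, root vertex's face on its left), not the dual of M's root, which clashes with the outer-face clause and makes the claim false for 4 edges. *)

theory Defs
  imports "HOL-Combinatorics.Orbits"
begin

section \<open>Rooted planar maps\<close>

text \<open>
  A connected graph embedded in the (oriented) plane with at least one edge, up to
  orientation-preserving homeomorphism, is encoded by its darts (oriented edges):
  \<open>opp\<close> reverses a dart, and \<open>cw\<close> sends a dart to the next one in clockwise order
  around its origin.  Vertices are the orbits of \<open>cw\<close> (a dart belongs to its origin).  The
  face on the left of a dart \<open>d\<close> is the orbit of \<open>d\<close> under \<open>cw \<circ> opp\<close>: on arriving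
  at the head of \<open>d\<close>, the next dart having the same face on its left is the one that
  follows \<open>opp d\<close> clockwise.  The outer face need not be recorded separately, since it is the
  face on the left of the root.
\<close>

record 'd rooted_map =
  darts :: "'d set"
  opp :: "'d \<Rightarrow> 'd"
  cw :: "'d \<Rightarrow> 'd"
  root_dart :: 'd

definition vertex_of :: "'d rooted_map \<Rightarrow> 'd \<Rightarrow> 'd set" where
  "vertex_of M d = orbit (cw M) d"

definition left_face_of :: "'d rooted_map \<Rightarrow> 'd \<Rightarrow> 'd set" where
  "left_face_of M d = orbit (cw M \<circ> opp M) d"

definition vertices :: "'d rooted_map \<Rightarrow> 'd set set" where
  "vertices M = vertex_of M ` darts M"

definition edges :: "'d rooted_map \<Rightarrow> 'd set set" where
  "edges M = (\<lambda>d. {d, opp M d}) ` darts M"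

definition faces :: "'d rooted_map \<Rightarrow> 'd set set" where
  "faces M = left_face_of M ` darts M"

definition connected_map :: "'d rooted_map \<Rightarrow> bool" where
  "connected_map M \<longleftrightarrow>
     (\<forall>x \<in> darts M. \<forall>y \<in> darts M. (x, y) \<in> {(a, b). a \<in> darts M \<and> (b = opp M a \<or> b = cw M a)}\<^sup>*)"

text \<open>Planarity is expressed by Euler's formula.\<close>

definition planar_map :: "'d rooted_map \<Rightarrow> bool" where
  "planar_map M \<longleftrightarrow>
     finite (darts M) \<and>
     opp M permutes darts M \<and>
     (\<forall>d \<in> darts M. opp M d \<noteq> d \<and> opp M (opp M d) = d) \<and>
     cw M permutes darts M \<and>
     root_dart M \<in> darts M \<and>
     connected_map M \<and>
     card (vertices M) + card (faces M) = card (edges M) + 2"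

definition incident :: "'d set \<Rightarrow> 'd set \<Rightarrow> bool" where
  "incident v e \<longleftrightarrow> v \<inter> e \<noteq> {}"

definition separable :: "'d rooted_map \<Rightarrow> bool" where
  "separable M \<longleftrightarrow>
     (\<exists>A B. A \<union> B = edges M \<and> A \<inter> B = {} \<and> A \<noteq> {} \<and> B \<noteq> {} \<and>
        (\<exists>!v. v \<in> vertices M \<and> (\<exists>e \<in> A. incident v e) \<and> (\<exists>e \<in> B. incident v e)))"

definition nsp_map :: "'d rooted_map \<Rightarrow> bool" where
  "nsp_map M \<longleftrightarrow> planar_map M \<and> \<not> separable M \<and> card (edges M) \<ge> 2"

text \<open>
  Equality of maps, i.e. existence of an orientation-preserving homeomorphism respecting the
  roots, is isomorphism of the encodings.
\<close>

definition map_iso :: "'d rooted_map \<Rightarrow> 'e rooted_map \<Rightarrow> bool" where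
  "map_iso M N \<longleftrightarrow>
     (\<exists>f. bij_betw f (darts M) (darts N) \<and>
          (\<forall>d \<in> darts M. f (opp M d) = opp N (f d) \<and> f (cw M d) = cw N (f d)) \<and>
          f (root_dart M) = root_dart N)"


section \<open>Duality\<close>

text \<open>
  The dual edge of \<open>{d, opp d}\<close> is encoded by the same two darts: as a dart of the dual,
  \<open>d\<close> is the dual edge oriented from the face on the left of \<open>d\<close> to the face on its right.
  Walking along the boundary of a face that lies on the left enumerates the dual darts around its
  dual vertex counterclockwise, hence the inverse in the clockwise rotation of the dual.

  Root of the dual: it starts at the vertex dual to the outer face of \<open>M\<close>, and has on its left
  (where the outer face of the dual has to lie) the face dual to the root vertex of \<open>M\<close>; see
  the two lemmas below.  It thus sits at the corner of \<open>M\<close> formed by the root vertex and the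
  outer face.  That corner lies between the root and the dart preceding it clockwise around the
  root vertex, and the root of the dual crosses the latter.  Pitfall: the dual edge crossing the
  root of \<open>M\<close> itself, oriented away from the outer face, has the face dual to the root vertex
  on its right; rooting the dual there would violate the convention on the outer face.
\<close>

definition dual :: "'d rooted_map \<Rightarrow> 'd rooted_map" where
  "dual M = \<lparr>darts = darts M, opp = opp M, cw = inv (cw M \<circ> opp M),
             root_dart = opp M (inv (cw M) (root_dart M))\<rparr>"

lemma planar_map_permutation:
  assumes "planar_map M"
  shows "permutation (opp M)" "permutation (cw M)" "permutation (cw M \<circ> opp M)"
proof -
  show a: "permutation (opp M)" and b: "permutation (cw M)"
    using assms by (auto simp: planar_map_def permutation_permutes)
  show "permutation (cw M \<circ> opp M)"
    by (rule permutation_compose[OF b a])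
qed

lemma planar_map_opp_opp:
  assumes "planar_map M"
  shows "opp M (opp M d) = d"
proof (cases "d \<in> darts M")
  case False
  then have "opp M d = d"
    using assms by (auto simp: planar_map_def permutes_def)
  then show ?thesis by simp
qed (use assms in \<open>auto simp: planar_map_def\<close>)

lemma root_vertex_dual:
  assumes "planar_map M"
  shows "vertex_of (dual M) (root_dart (dual M)) = left_face_of M (root_dart M)"
proof -
  note p = planar_map_permutation[OF assms]
  let ?r = "root_dart M" and ?\<phi> = "cw M \<circ> opp M"
  let ?d = "opp M (inv (cw M) ?r)"
  have "?\<phi> ?d = ?r"
    using planar_map_opp_opp[OF assms] permutation_bijective[OF p(2)]
    by (simp add: bij_is_surj surj_f_inv_f)
  then have "orbit ?\<phi> ?r = orbit ?\<phi> ?d"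
    using permutation_orbit_step[OF p(3), of ?d] by simp
  then show ?thesis
    by (simp add: vertex_of_def left_face_of_def dual_def orbit_inv_eq[OF p(3)])
qed

lemma outer_face_dual:
  assumes "planar_map M"
  shows "left_face_of (dual M) (root_dart (dual M)) = opp M ` vertex_of M (root_dart M)"
proof -
  note p = planar_map_permutation[OF assms]
  note oo = planar_map_opp_opp[OF assms]
  let ?r = "root_dart M" and ?g = "inv (cw M)"
  let ?h = "opp M \<circ> ?g \<circ> opp M"
  have "inv (opp M) = opp M"
    using oo by (intro inv_unique_comp) auto
  then have i: "inv (cw M \<circ> opp M) = opp M \<circ> ?g"
    using p(1,2) by (simp add: o_inv_distrib permutation_bijective)
  have conj: "orbit ?h (opp M x) = opp M ` orbit ?g x" for x
  proof
    show "orbit ?h (opp M x) \<subseteq> opp M ` orbit ?g x"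
    proof
      fix y assume "y \<in> orbit ?h (opp M x)"
      then show "y \<in> opp M ` orbit ?g x"
        by induct (auto simp: oo intro: orbit.intros)
    qed
    have "opp M y \<in> orbit ?h (opp M x)" if "y \<in> orbit ?g x" for y
      using that
    proof induct
      case base
      show ?case using orbit.base[of ?h "opp M x"] by (simp add: oo comp_def)
    next
      case (step y)
      show ?case using orbit.step[OF step(2)] by (simp add: oo comp_def)
    qed
    then show "opp M ` orbit ?g x \<subseteq> orbit ?h (opp M x)" by blast
  qed
  have "orbit ?g (?g ?r) = orbit ?g ?r"
    by (rule permutation_orbit_step[OF permutation_inverse[OF p(2)]])
  then show ?thesis
    using conj[of "?g ?r"] by (simp add: vertex_of_def left_face_of_def dual_def i orbit_inv_eq[OF p(2)])
qed


section \<open>Decorated trees\<close>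

text \<open>Labels sit on the leaves only.  Children are listed from left to right.\<close>

datatype 'a ltree = Leaf 'a | Node "'a ltree list"

fun leaf_labels :: "'a ltree \<Rightarrow> 'a list" where
  "leaf_labels (Leaf a) = [a]"
| "leaf_labels (Node ts) = concat (map leaf_labels ts)"

text \<open>The nodes of a tree whose root has depth \<open>p\<close>: pairs of a depth and the subtree there.\<close>

fun nodes_from :: "int \<Rightarrow> 'a ltree \<Rightarrow> (int \<times> 'a ltree) set" where
  "nodes_from p (Leaf a) = {(p, Leaf a)}"
| "nodes_from p (Node ts) = insert (p, Node ts) (\<Union>t \<in> set ts. nodes_from (p + 1) t)"

text \<open>
  The condition \<open>ts \<noteq> []\<close> says that every leaf carries a label, i.e. is a \<open>Leaf\<close>; at the
  root it says that the tree has an edge.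
\<close>

definition decorated_tree :: "int ltree \<Rightarrow> bool" where
  "decorated_tree T \<longleftrightarrow>
     (\<exists>ts. T = Node ts) \<and>
     (\<forall>a \<in> set_ltree T. a \<ge> -1) \<and>
     (\<forall>p ts. (p, Node ts) \<in> nodes_from 0 T \<longrightarrow>
        ts \<noteq> [] \<and>
        (\<forall>a. Leaf a \<in> set ts \<longrightarrow> a < p) \<and>
        (p > 0 \<longrightarrow> (\<exists>a \<in> set_ltree (Node ts). a \<le> p - 2)) \<and>
        (\<forall>t \<in> set ts. \<forall>i < length (leaf_labels t). leaf_labels t ! i = p \<longrightarrow>
           (\<forall>j < i. leaf_labels t ! j \<ge> p)))"

definition fl :: "int ltree \<Rightarrow> nat" where
  "fl T = count_list (leaf_labels T) (-1)"


section \<open>The involution on decorated trees\<close>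

text \<open>
  The functions below are defined on all trees; unspecified cases return some irrelevant value.
\<close>

lemma size_last_less [termination_simp]:
  "ts \<noteq> [] \<Longrightarrow> size (last ts) < Suc (size_list size ts)"
  by (induction ts) auto

fun rpath :: "'a ltree \<Rightarrow> nat" where
  "rpath (Leaf a) = 0"
| "rpath (Node ts) = (if ts = [] then 0 else Suc (rpath (last ts)))"

text \<open>\<open>subst_last s t\<close> replaces the rightmost leaf of \<open>t\<close> by \<open>s\<close>.\<close>

fun subst_last :: "'a ltree \<Rightarrow> 'a ltree \<Rightarrow> 'a ltree" where
  "subst_last s (Leaf a) = s"
| "subst_last s (Node ts) = (if ts = [] then Node [] else Node (butlast ts @ [subst_last s (last ts)]))"

text \<open>
  \<open>attach i t\<close> attaches a new free leaf as rightmost child of the \<open>i\<close>-th node of the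
  rightmost path of \<open>t\<close>; the root has number 1.
\<close>

fun attach :: "nat \<Rightarrow> int ltree \<Rightarrow> int ltree" where
  "attach 0 t = t"
| "attach i (Leaf a) = Node [Leaf (-1)]"
| "attach (Suc 0) (Node ts) = Node (ts @ [Leaf (-1)])"
| "attach (Suc (Suc i)) (Node ts) =
     (if ts = [] then Node [] else Node (butlast ts @ [attach (Suc i) (last ts)]))"

text \<open>\<open>raise_labels r t\<close> adds \<open>r\<close> to the label of every leaf of \<open>t\<close> except the rightmost one.\<close>

fun raise_labels :: "int \<Rightarrow> int ltree \<Rightarrow> int ltree" where
  "raise_labels r (Leaf a) = Leaf a"
| "raise_labels r (Node ts) =
     (if ts = [] then Node []
      else Node (map (map_ltree (\<lambda>a. a + r)) (butlast ts) @ [raise_labels r (last ts)]))"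

text \<open>Label change in the operation deleting a root with one child.\<close>

definition lower_labels :: "int ltree \<Rightarrow> int ltree" where
  "lower_labels = map_ltree (\<lambda>a. if a = -1 then -1 else a - 1)"

lemma size_map_ltree [simp]: "size (map_ltree f t) = size t"
  by (induction t) (auto simp: size_list_conv_sum_list comp_def intro!: arg_cong[of _ _ sum_list])

lemma size_lower_labels [termination_simp]: "size (lower_labels t) = size t"
  by (simp add: lower_labels_def)

fun h_tree :: "int ltree \<Rightarrow> int ltree" where
  "h_tree (Leaf a) = Leaf a"
| "h_tree (Node []) = Node []"
| "h_tree (Node [Leaf a]) = Node [Leaf a]"
| "h_tree (Node [Node ts]) = attach (fl (Node [Node ts])) (h_tree (lower_labels (Node ts)))"
| "h_tree (Node (Leaf a # t # ts)) = subst_last (Node [Leaf (-1)]) (h_tree (Node (t # ts)))"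
| "h_tree (Node (Node us # t # ts)) =
     (let T1 = h_tree (Node [Node us]); T2 = h_tree (Node (t # ts))
      in subst_last (raise_labels (int (rpath T2)) T1) T2)"


section \<open>From maps to decorated trees\<close>

text \<open>The other darts around the origin of \<open>d\<close>, in clockwise order starting just after \<open>d\<close>.\<close>

definition darts_after :: "'d rooted_map \<Rightarrow> 'd \<Rightarrow> 'd list" where
  "darts_after M d = map (\<lambda>i. (cw M ^^ i) d) [1..<card (vertex_of M d)]"

text \<open>
  \<open>explore M p ds depth U\<close> examines, in this order, the edges of the darts \<open>ds\<close> leaving a
  vertex of depth \<open>p\<close>.  The state of the search consists of the depths of the visited vertices,
  \<open>depth\<close>, and of the set \<open>U\<close> of the darts of the edges not examined before.  The result
  consists of the children created at the vertex, in order of creation, and the new state.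
  Finiteness of \<open>U\<close>, which holds for the finite maps under consideration, only serves
  termination.
\<close>

function explore ::
  "'d rooted_map \<Rightarrow> int \<Rightarrow> 'd list \<Rightarrow> ('d set \<rightharpoonup> int) \<Rightarrow> 'd set \<Rightarrow>
    int ltree list \<times> ('d set \<rightharpoonup> int) \<times> 'd set" where
  "explore M p [] depth U = ([], depth, U)"
| "explore M p (d # ds) depth U =
     (if d \<notin> U \<or> infinite U then explore M p ds depth U
      else case depth (vertex_of M (opp M d)) of
        Some q \<Rightarrow>
          (let (cs, depth', U') = explore M p ds depth (U - {d, opp M d})
           in (Leaf q # cs, depth', U'))
      | None \<Rightarrow>
          (let (cs, depth', U') =
                 explore M (p + 1) (darts_after M (opp M d))
                   (depth(vertex_of M (opp M d) \<mapsto> p + 1)) (U - {d, opp M d});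
               (cs', depth'', U'') = explore M p ds depth' U'
           in (Node (rev cs) # cs', depth'', U'')))"
  by pat_completeness auto

lemma explore_unexamined_subset:
  assumes "explore_dom (M, p, ds, depth, U)"
  shows "snd (snd (explore M p ds depth U)) \<subseteq> U"
  using assms
proof (induction rule: explore.pinduct)
  case (1 M p depth U)
  then show ?case by (simp add: explore.psimps)
next
  case (2 M p d ds depth U)
  show ?case
  proof (cases "d \<notin> U \<or> infinite U")
    case True
    then show ?thesis using 2 by (simp add: explore.psimps)
  next
    case False
    show ?thesis
    proof (cases "depth (vertex_of M (opp M d))")
      case None
      obtain cs depth' U' where 1: "explore M (p + 1) (darts_after M (opp M d))
          (depth(vertex_of M (opp M d) \<mapsto> p + 1)) (U - {d, opp M d}) = (cs, depth', U')"
        by (metis prod_cases3)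
      obtain cs' depth'' U'' where 2: "explore M p ds depth' U' = (cs', depth'', U'')"
        by (metis prod_cases3)
      have "U' \<subseteq> U - {d, opp M d}"
        using "2.IH"(2)[OF False None] unfolding 1 by simp
      moreover have "U'' \<subseteq> U'"
        using "2.IH"(3)[OF False None 1[symmetric] refl refl] 2 by simp
      moreover have "snd (snd (explore M p (d # ds) depth U)) = U''"
        using "2.hyps" False None 1 2 by (simp add: explore.psimps)
      ultimately show ?thesis by blast
    next
      case (Some q)
      obtain cs depth' U' where 1: "explore M p ds depth (U - {d, opp M d}) = (cs, depth', U')"
        by (metis prod_cases3)
      have "U' \<subseteq> U - {d, opp M d}"
        using "2.IH"(4)[OF False Some] 1 by simp
      moreover have "snd (snd (explore M p (d # ds) depth U)) = U'"
        using "2.hyps" False Some 1 by (simp add: explore.psimps)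
      ultimately show ?thesis by blast
    qed
  qed
qed

termination
proof (relation "measures [\<lambda>(M, p, ds, depth, U). card U, \<lambda>(M, p, ds, depth, U). length ds]",
       goal_cases)
  case 1
  then show ?case by simp
next
  case (2 M p d ds depth U)
  then show ?case by auto
next
  case (3 M p d ds depth U)
  then have "card (U - {d, opp M d}) < card U" by (intro psubset_card_mono) auto
  then show ?case by simp
next
  case (4 M p d ds depth U x cs y depth' U')
  then have "U' \<subseteq> U - {d, opp M d}"
    using explore_unexamined_subset by (metis snd_conv)
  then have "card U' < card U" using 4 by (intro psubset_card_mono) auto
  then show ?case by simp
next
  case (5 M p d ds depth U q)
  then have "card (U - {d, opp M d}) < card U" by (intro psubset_card_mono) auto
  then show ?case by simp
qed

definition tree_of_map :: "'d rooted_map \<Rightarrow> int ltree" where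
  "tree_of_map M =
     (let e = root_dart M; e' = opp M e;
          (cs, _, _) = explore M 0 (darts_after M e')
                         [vertex_of M e \<mapsto> -1, vertex_of M e' \<mapsto> 0] (darts M - {e, e'})
      in Node (rev cs))"

text \<open>
  \<open>S\<close> is a two-sided inverse, up to equality of maps, of \<open>tree_of_map\<close> as a function
  from NSP-maps to decorated trees.
\<close>

definition inverse_of_tree_of_map :: "(int ltree \<Rightarrow> 'd rooted_map) \<Rightarrow> bool" where
  "inverse_of_tree_of_map S \<longleftrightarrow>
     (\<forall>N :: 'd rooted_map. nsp_map N \<longrightarrow> map_iso (S (tree_of_map N)) N) \<and>
     (\<forall>T. decorated_tree T \<longrightarrow> nsp_map (S T) \<and> tree_of_map (S T) = T)"

end

(*
  The depth-first search is a walk around a spanning tree.  Recording in order the darts that it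
  passes gives a word with two interleaved bracket systems: the two sides of a tree edge (Down, Up)
  and the two ends of a non-tree edge (Open, Close).  By Euler's formula the non-tree edges do not
  cross, so both systems are properly nested; non-separability forces every edge to be closed as
  soon as possible, so that the word is a function of the decorated tree.  The walk around the
  complementary spanning tree of the dual map is the same walk read backwards, with tree edges and
  non-tree edges exchanged, and the recursion defining h_tree performs exactly this reversal on the
  words of decorated trees.  Conversely, whenever a walk in a map spells the word of a decorated tree,
  the search in this map yields that tree and the map is non-separable.  Applied to the reversed
  walk, this gives the tree of the dual and shows that the dual is an NSP-map again.
*)
theory Submission
  imports Defs
begin

section \<open>Codes of decorated trees\<close>

text \<open>A leaf label names the ancestor at which an edge ends, but not the corner of that
  ancestor. Condition (2) supplies the corner: every child of a vertex of depth \<open>p\<close>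
  leaves open a chord (a non-tree edge) with label below \<open>p\<close>, and on the stack this
  chord covers all older ones. A chord labeled \<open>p\<close> that were still open when a later
  child begins could therefore never be closed. So the closings at depth \<open>p\<close> come right
  after the subtree that opened the chords, and a count of labels is enough to write them down. In
  the reversed walk the second end of a chord is met first; hence \<open>Close\<close> turns into
  \<open>Down\<close> and \<open>Open\<close> into \<open>Up\<close>, and likewise \<open>Up\<close>
  into \<open>Open\<close> and \<open>Down\<close> into \<open>Close\<close>. The inverse of the
  tree map is never constructed. A map carries its word together with its darts; the two bracket
  conditions recover the nested structure of the walk, and running the search along this structure
  recovers the tree. Non-separability of the given map serves only to obtain the first word: the
  dual gets its word by reversal and its non-separability from the word.\<close>

datatype step = Down | Up | Open | Close

text \<open>
  The code of a tree records the depth-first walk around it: \<open>Down\<close> and \<open>Up\<close> traverse the edge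
  above an internal node, \<open>Open\<close> and \<open>Close\<close> are the two ends of the edge that produces a leaf.
  A leaf labeled \<open>p - 1\<close> in the subtree of a node of depth \<open>p\<close> is closed as soon as the walk
  comes back to the parent of that node.
\<close>

fun tcode :: "int \<Rightarrow> int ltree \<Rightarrow> step list" where
  "tcode p (Leaf a) = [Open]"
| "tcode p (Node ts) = Down # concat (map (tcode (p + 1)) (rev ts)) @
     Up # replicate (count_list (leaf_labels (Node ts)) (p - 1)) Close"

text \<open>Condition (3) for the leaves below one child of a node of depth \<open>p\<close>. The
  relation need not be transitive, but \<open>sorted_wrt\<close> compares all pairs, so the
  condition splits along \<open>append\<close> and restricts along \<open>filter\<close>.\<close>

definition ordered_at :: "int \<Rightarrow> int list \<Rightarrow> bool" where
  "ordered_at p L \<longleftrightarrow> sorted_wrt (\<lambda>x y. y = p \<longrightarrow> p \<le> x) L"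

text \<open>Conditions (1) to (3) by recursion, with \<open>p\<close> the depth of the root of the
  subtree; inductions on trees and on walks can use this form. The parent of a leaf has depth
  \<open>p - 1\<close>, whence the bound \<open>a < p - 1\<close>.\<close>

fun decor :: "int \<Rightarrow> int ltree \<Rightarrow> bool" where
  "decor p (Leaf a) \<longleftrightarrow> -1 \<le> a \<and> a < p - 1"
| "decor p (Node ts) \<longleftrightarrow> ts \<noteq> [] \<and> (\<forall>t \<in> set ts. decor (p + 1) t \<and> ordered_at p (leaf_labels t)) \<and>
     (0 < p \<longrightarrow> (\<exists>a \<in> set (leaf_labels (Node ts)). a \<le> p - 2))"

fun is_node :: "'a ltree \<Rightarrow> bool" where
  "is_node (Leaf a) \<longleftrightarrow> False"
| "is_node (Node ts) \<longleftrightarrow> True"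

lemma set_leaf_labels: "set (leaf_labels t) = set_ltree t"
  by (induction t) auto

lemma decor_label_ge: "decor p t \<Longrightarrow> a \<in> set (leaf_labels t) \<Longrightarrow> -1 \<le> a"
proof (induction p t rule: decor.induct)
  case (2 p ts)
  then show ?case by (auto simp del: decor.simps simp: decor.simps(2)[of p ts])
qed auto

lemma decor_leaf_labels_nonempty: "decor p t \<Longrightarrow> leaf_labels t \<noteq> []"
proof (induction p t rule: decor.induct)
  case (2 p ts)
  then show ?case by (cases ts) auto
qed auto

lemma decor_nodes_from:
  "decor q t \<Longrightarrow> (p, Node ts) \<in> nodes_from q t \<Longrightarrow> decor p (Node ts)"
proof (induction q t rule: decor.induct)
  case (2 q us)
  show ?case
  proof (cases "(p, Node ts) = (q, Node us)")
    case False
    then obtain t where "t \<in> set us" "(p, Node ts) \<in> nodes_from (q + 1) t"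
      using 2(3) by auto
    then show ?thesis using 2 by auto
  qed (use 2 in auto)
qed auto

lemma decorated_tree_if_decor:
  assumes "decor 0 T"
  shows "decorated_tree T"
  unfolding decorated_tree_def
proof (intro conjI allI impI ballI)
  show "\<exists>ts. T = Node ts" using assms by (cases T) auto
  show "-1 \<le> a" if "a \<in> set_ltree T" for a
    using decor_label_ge[OF assms] that by (simp add: set_leaf_labels)
next
  fix p ts assume "(p, Node ts) \<in> nodes_from 0 T"
  from decor_nodes_from[OF assms this] have d: "decor p (Node ts)" .
  then show "ts \<noteq> []" by simp
  show "a < p" if "Leaf a \<in> set ts" for a using d that by auto
  show "\<exists>a\<in>set_ltree (Node ts). a \<le> p - 2" if "0 < p"
    using d that by (auto simp: set_leaf_labels)
  show "p \<le> leaf_labels t ! j" if "t \<in> set ts" "i < length (leaf_labels t)"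
    "leaf_labels t ! i = p" "j < i" for t i j
    using d that by (auto simp: ordered_at_def sorted_wrt_iff_nth_less)
qed

text \<open>A child of the root is a leaf, whose label is then -1, or a node of depth 1, for which
  condition (2) gives a leaf labeled -1. This makes the counts of free leaves in
  \<open>h_tree\<close> positive.\<close>

lemma free_leaf_in_root_subtree: "decor 0 T \<Longrightarrow> -1 \<in> set (leaf_labels T)"
proof (cases T)
  case (Node ts)
  assume d: "decor 0 T"
  then obtain t us where ts: "ts = t # us" using Node by (cases ts) auto
  show ?thesis
  proof (cases t)
    case (Leaf a) then show ?thesis using d Node ts by auto
  next
    case (Node vs)
    then obtain a where "a \<in> set (leaf_labels t)" "a \<le> -1"
      using d \<open>T = Node ts\<close> ts by auto
    moreover have "-1 \<le> a" using decor_label_ge[OF d] \<open>a \<in> _\<close> \<open>T = Node ts\<close> ts by auto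
    ultimately show ?thesis using \<open>T = Node ts\<close> ts by auto
  qed
qed auto

section \<open>Codes under attaching, grafting, raising and lowering\<close>

lemma tcode_rpath: "decor p t \<Longrightarrow> \<exists>r. tcode p t = replicate (rpath t) Down @ Open # r"
proof (induction t arbitrary: p rule: rpath.induct)
  case (2 ts)
  then have ne: "ts \<noteq> []" by simp
  then obtain bs l where ts: "ts = bs @ [l]" by (metis rev_exhaust)
  then obtain r where "tcode (p + 1) l = replicate (rpath l) Down @ Open # r"
    using 2 by fastforce
  then show ?case using ts by auto
qed auto

lemma replicate_Down_Open_inject:
  "replicate m Down @ Open # r = replicate n Down @ Open # r' \<longleftrightarrow> m = n \<and> r = r'"
proof (induction m arbitrary: n)
  case 0 then show ?case by (cases n) auto
next
  case (Suc m) then show ?case by (cases n) auto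
qed

text \<open>The code visits children from right to left, so its leading \<open>Down\<close> steps
  follow the rightmost path. In this way the lengths used by \<open>h_tree\<close> are read off a
  reversed word.\<close>

lemma rpath_eqI: "decor p t \<Longrightarrow> tcode p t = replicate m Down @ Open # r \<Longrightarrow> rpath t = m"
  using tcode_rpath[of p t] by (auto simp: replicate_Down_Open_inject)

lemma leaf_labels_attach:
  "decor p t \<Longrightarrow> 1 \<le> k \<Longrightarrow> k \<le> rpath t \<Longrightarrow> leaf_labels (attach k t) = leaf_labels t @ [-1]"
proof (induction k t arbitrary: p rule: attach.induct)
  case (4 i ts)
  then obtain bs l where ts: "ts = bs @ [l]" by (cases ts rule: rev_exhaust) auto
  then show ?case using 4(1)[of "p + 1"] 4(2-) by simp
qed auto

text \<open>The new leaf is rightmost at its node, hence the first child created there: an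
  \<open>Open\<close> directly after \<open>k\<close> steps \<open>Down\<close>. Only a node of
  depth 0 counts the label -1, so a matching \<open>Close\<close> appears exactly for
  \<open>p = 0\<close>, at the very end.\<close>

lemma tcode_attach:
  assumes "decor p t" "0 \<le> p" "1 \<le> k" "k \<le> rpath t" "tcode p t = replicate k Down @ r"
  shows "tcode p (attach k t) = replicate k Down @ Open # r @ (if p = 0 then [Close] else [])"
  using assms
proof (induction k t arbitrary: p r rule: attach.induct)
  case (3 ts)
  then show ?case by (auto simp flip: replicate_append_same)
next
  case (4 i ts)
  then obtain bs l where ts: "ts = bs @ [l]" by (cases ts rule: rev_exhaust) auto
  have last_ts: "last ts = l" using ts by simp
  have dl: "decor (p + 1) l" using 4(2) ts by simp
  then obtain r' where r': "tcode (p + 1) l = replicate (rpath l) Down @ Open # r'"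
    using tcode_rpath by blast
  have k: "Suc i \<le> rpath l" using 4 ts by simp
  define r'' where "r'' = replicate (rpath l - Suc i) Down @ Open # r'"
  have r'': "tcode (p + 1) l = replicate (Suc i) Down @ r''"
    using r' k unfolding r''_def
    by (metis (no_types, lifting) append.assoc le_add_diff_inverse replicate_add)
  have IH: "tcode (p + 1) (attach (Suc i) l) = replicate (Suc i) Down @ Open # r''"
    using 4(1)[unfolded last_ts, OF _ _ _ _ _ r''] dl k 4(3) ts by simp
  have L: "leaf_labels (attach (Suc i) l) = leaf_labels l @ [-1]"
    using leaf_labels_attach[OF dl _ k] by simp
  show ?case using 4(6) 4(3) IH L r'' ts
    by (auto simp flip: replicate_append_same)
qed auto

lemma leaf_labels_subst_last:
  "decor p t \<Longrightarrow> leaf_labels (subst_last s t) = butlast (leaf_labels t) @ leaf_labels s"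
proof (induction s t arbitrary: p rule: subst_last.induct)
  case (2 s ts)
  then obtain bs l where ts: "ts = bs @ [l]" by (cases ts rule: rev_exhaust) auto
  then have "decor (p + 1) l" using 2 by simp
  then show ?case using 2(1)[of "p + 1"] ts decor_leaf_labels_nonempty
    by (auto simp: butlast_append)
qed auto

text \<open>The nodes on the rightmost path have depths from \<open>p\<close> to
  \<open>p + rpath t - 1\<close> and count the labels from \<open>p - 1\<close> to
  \<open>p + rpath t - 2\<close>. All labels of \<open>s\<close> but the last exceed this range, and
  the last equals the label that it replaces, so no block of closings on the path changes.\<close>

lemma tcode_subst_last:
  assumes "decor p t" "leaf_labels s \<noteq> []" "last (leaf_labels t) = last (leaf_labels s)"
    and "\<forall>a \<in> set (butlast (leaf_labels s)). p + int (rpath t) - 1 \<le> a"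
    and "tcode p t = replicate (rpath t) Down @ Open # r"
  shows "tcode p (subst_last s t) = replicate (rpath t) Down @ tcode (p + int (rpath t)) s @ r"
  using assms
proof (induction s t arbitrary: p r rule: subst_last.induct)
  case (2 s ts)
  then obtain bs l where ts: "ts = bs @ [l]" by (cases ts rule: rev_exhaust) auto
  have last_ts: "last ts = l" using ts by simp
  have dl: "decor (p + 1) l" using 2(2) ts by simp
  have ne: "leaf_labels l \<noteq> []" using decor_leaf_labels_nonempty[OF dl] .
  obtain r' where r': "tcode (p + 1) l = replicate (rpath l) Down @ Open # r'"
    using tcode_rpath dl by blast
  have "last (leaf_labels l) = last (leaf_labels s)" using 2(4) ts ne by simp
  \<comment> \<open>The placeholder \<open>ts_l\<close> will be \<open>Node ts\<close>. Knowing only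
    its path length keeps \<open>rpath\<close> folded, so that the depth
    \<open>p + 1 + rpath l\<close> can be restated as seen from the parent.\<close>
  then have IH: "tcode (p + 1) (subst_last s l) =
      replicate (rpath l) Down @ tcode (p + int (rpath ts_l)) s @ r'"
    if "rpath ts_l = Suc (rpath l)" for ts_l :: "int ltree"
    using 2(1)[unfolded last_ts, OF _ dl 2(3) _ _ r'] 2(5) ts that by (auto simp: algebra_simps)
  have L: "leaf_labels (subst_last s l) = butlast (leaf_labels l) @ leaf_labels s"
    using leaf_labels_subst_last[OF dl] .
  have c0: "count_list (butlast (leaf_labels s)) (p - 1) = 0"
  proof -
    have "p - 1 \<notin> set (butlast (leaf_labels s))"
      using 2(5) ts by (auto dest!: bspec)
    then show ?thesis by (simp add: count_list_0_iff)
  qed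
  have "leaf_labels s = butlast (leaf_labels s) @ [last (leaf_labels s)]"
    using 2(3) by simp
  then have c1: "count_list (leaf_labels s) (p - 1) = count_list [last (leaf_labels s)] (p - 1)"
    using c0 by (metis add_0 count_list_append)
  have "leaf_labels l = butlast (leaf_labels l) @ [last (leaf_labels l)]"
    using ne by simp
  then have "count_list (leaf_labels l) (p - 1) =
      count_list (butlast (leaf_labels l)) (p - 1) + count_list [last (leaf_labels l)] (p - 1)"
    by (metis count_list_append)
  then have c: "count_list (leaf_labels (subst_last s l)) (p - 1) = count_list (leaf_labels l) (p - 1)"
    using L c1 \<open>last (leaf_labels l) = last (leaf_labels s)\<close> by simp
  show ?case using 2(6) IH[of "Node ts"] c r' ts by auto
qed auto

lemma leaf_labels_map_ltree: "leaf_labels (map_ltree f t) = map f (leaf_labels t)"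
  by (induction t) (auto simp: map_concat comp_def intro!: arg_cong[of _ _ concat])

lemma count_list_map_add: "count_list (map (\<lambda>a. a + r) L) (q + r) = count_list L (q :: int)"
  by (induction L) auto

lemma tcode_map_add: "tcode (p + r) (map_ltree (\<lambda>a. a + r) t) = tcode p t"
proof (induction t arbitrary: p)
  case (Node ts)
  have "map (tcode (p + r + 1)) (rev (map (map_ltree (\<lambda>a. a + r)) ts)) = map (tcode (p + 1)) (rev ts)"
    using Node[of _ "p + 1"] by (auto simp: rev_map algebra_simps)
  moreover have "count_list (leaf_labels (map_ltree (\<lambda>a. a + r) (Node ts))) (p + r - 1) =
      count_list (leaf_labels (Node ts)) (p - 1)"
    unfolding leaf_labels_map_ltree using count_list_map_add[of r _ "p - 1"]
    by (simp add: algebra_simps)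
  ultimately show ?case by simp
qed simp

lemma leaf_labels_raise:
  "decor p t \<Longrightarrow> leaf_labels (raise_labels r t) =
     map (\<lambda>a. a + r) (butlast (leaf_labels t)) @ [last (leaf_labels t)]"
proof (induction r t arbitrary: p rule: raise_labels.induct)
  case (2 r ts)
  then obtain bs l where ts: "ts = bs @ [l]" by (cases ts rule: rev_exhaust) auto
  have last_ts: "last ts = l" using ts by simp
  have dl: "decor (p + 1) l" using 2 ts by simp
  then show ?case using 2(1)[of "p + 1"] ts decor_leaf_labels_nonempty[OF dl]
    by (auto simp: butlast_append leaf_labels_map_ltree map_concat comp_def)
qed auto

text \<open>Moving the root down by \<open>r\<close> together with all labels but the last keeps
  every count, apart from the share of the last leaf. Its label -1 is counted at depth 0 before the
  move and nowhere afterwards, all depths then being positive. Hence one \<open>Close\<close> is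
  lost exactly when \<open>p = 0\<close>.\<close>

lemma tcode_raise:
  assumes "decor p t" "0 \<le> p" "0 < r" "last (leaf_labels t) = -1" "is_node t \<or> 0 < p"
  shows "tcode (p + r) (raise_labels r t) @ (if p = 0 then [Close] else []) = tcode p t"
  using assms
proof (induction r t arbitrary: p rule: raise_labels.induct)
  case (2 r ts)
  then obtain bs l where ts: "ts = bs @ [l]" by (cases ts rule: rev_exhaust) auto
  have last_ts: "last ts = l" using ts by simp
  have dl: "decor (p + 1) l" using 2 ts by simp
  have ne: "leaf_labels l \<noteq> []" using decor_leaf_labels_nonempty[OF dl] .
  have "last (leaf_labels l) = -1" using 2(5) ts ne by simp
  then have IH: "tcode (p + r + 1) (raise_labels r l) = tcode (p + 1) l"
    using 2(1)[unfolded last_ts, OF _ dl] 2(3,4) ts by (auto simp: algebra_simps)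
  have a: "map (tcode (p + r + 1)) (rev (map (map_ltree (\<lambda>a. a + r)) bs)) = map (tcode (p + 1)) (rev bs)"
    using tcode_map_add[of "p + 1" r] by (auto simp: rev_map algebra_simps)
  have LN: "leaf_labels (Node ts) \<noteq> []" using decor_leaf_labels_nonempty[OF 2(2)] .
  define L where "L = butlast (leaf_labels (Node ts))"
  have L: "leaf_labels (Node ts) = L @ [-1]"
    unfolding L_def using LN 2(5) by (metis append_butlast_last_id)
  have R: "leaf_labels (raise_labels r (Node ts)) = map (\<lambda>a. a + r) L @ [-1]"
    unfolding leaf_labels_raise[OF 2(2)] L_def 2(5) ..
  have c: "count_list (leaf_labels (raise_labels r (Node ts))) (p + r - 1) + (if p = 0 then 1 else 0) =
      count_list (leaf_labels (Node ts)) (p - 1)"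
    unfolding L R using count_list_map_add[of r L "p - 1"] 2(3,4) by (auto simp: algebra_simps)
  have b: "tcode p (Node ts) = Down # tcode (p + 1) l @ concat (map (tcode (p + 1)) (rev bs)) @
      Up # replicate (count_list (leaf_labels (Node ts)) (p - 1)) Close"
    using ts by simp
  have "raise_labels r (Node ts) = Node (map (map_ltree (\<lambda>a. a + r)) bs @ [raise_labels r l])"
    using ts by simp
  then have d: "tcode (p + r) (raise_labels r (Node ts)) =
      Down # tcode (p + 1) l @ concat (map (tcode (p + 1)) (rev bs)) @
      Up # replicate (count_list (leaf_labels (raise_labels r (Node ts))) (p + r - 1)) Close"
    using IH a by simp
  show ?case unfolding b d c[symmetric] by (auto simp: replicate_append_same)
qed auto

lemma leaf_labels_lower:
  "leaf_labels (lower_labels t) = map (\<lambda>a. if a = -1 then -1 else a - 1) (leaf_labels t)"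
  by (simp add: lower_labels_def leaf_labels_map_ltree)

lemma lower_labels_Node: "lower_labels (Node ts) = Node (map lower_labels ts)"
  by (simp add: lower_labels_def)

lemma count_lower:
  "0 \<le> q \<Longrightarrow> (\<forall>a \<in> set L. -1 \<le> a) \<Longrightarrow>
   count_list (map (\<lambda>a. if a = -1 then -1 else a - 1) L) q = count_list L (q + 1 :: int)"
  by (induction L) auto

lemma count_lower_free:
  "(\<forall>a \<in> set L. -1 \<le> a) \<Longrightarrow>
   count_list (map (\<lambda>a :: int. if a = -1 then -1 else a - 1) L) (-1) = count_list L 0 + count_list L (-1)"
  by (induction L) auto

text \<open>For \<open>p\<close> at least 1 the label \<open>p - 1\<close> is nonnegative, and a
  lowered leaf has this label just when it had label \<open>p\<close> before; free leaves stay at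
  -1. At depth 0 the labels 0 and -1 merge instead, which is
  \<open>count_lower_free\<close>.\<close>

lemma tcode_lower:
  "decor (p + 1) t \<Longrightarrow> 1 \<le> p \<Longrightarrow> tcode p (lower_labels t) = tcode (p + 1) t"
proof (induction t arbitrary: p)
  case (Leaf a)
  then show ?case by (simp add: lower_labels_def)
next
  case (Node ts)
  have "map (tcode (p + 1)) (rev (map lower_labels ts)) = map (tcode (p + 1 + 1)) (rev ts)"
    using Node by (auto simp: rev_map)
  moreover have "count_list (leaf_labels (lower_labels (Node ts))) (p - 1) =
      count_list (leaf_labels (Node ts)) (p + 1 - 1)"
    unfolding leaf_labels_lower using count_lower[of "p - 1" "leaf_labels (Node ts)"]
      decor_label_ge[OF Node(2)] Node(3) by simp
  ultimately show ?case by (simp add: lower_labels_Node)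
qed

section \<open>Preservation of the decoration conditions\<close>

lemma ordered_at_append:
  "ordered_at p (xs @ ys) \<longleftrightarrow> ordered_at p xs \<and> ordered_at p ys \<and>
     (p \<in> set ys \<longrightarrow> (\<forall>x \<in> set xs. p \<le> x))"
  by (auto simp: ordered_at_def sorted_wrt_append)

lemma ordered_at_map_add: "ordered_at p L \<Longrightarrow> ordered_at (p + r) (map (\<lambda>a. a + r) L)"
  by (auto simp: ordered_at_def sorted_wrt_map elim: sorted_wrt_mono_rel[rotated])

lemma ordered_at_lower:
  "ordered_at (p + 1) L \<Longrightarrow> 0 \<le> p \<Longrightarrow> (\<forall>a \<in> set L. -1 \<le> a) \<Longrightarrow>
   ordered_at p (map (\<lambda>a. if a = -1 then -1 else a - 1) L)"
  unfolding ordered_at_def sorted_wrt_map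
  by (erule sorted_wrt_mono_rel[rotated]) (auto split: if_splits)

lemma ordered_at_singleton [simp]: "ordered_at p [a]" "ordered_at p []"
  by (auto simp: ordered_at_def)

lemma decor_lower:
  "decor (p + 1) t \<Longrightarrow> 0 \<le> p \<Longrightarrow> is_node t \<or> 1 \<le> p \<Longrightarrow> decor p (lower_labels t)"
proof (induction t arbitrary: p)
  case (Leaf a)
  then show ?case by (simp add: lower_labels_def)
next
  case (Node ts)
  have "decor (p + 1) (lower_labels t)" "ordered_at p (leaf_labels (lower_labels t))" if "t \<in> set ts" for t
  proof -
    have "decor (p + 1 + 1) t" using Node(2) that by simp
    then show "decor (p + 1) (lower_labels t)" using Node(1)[OF that] Node(3) by simp
    show "ordered_at p (leaf_labels (lower_labels t))"
      unfolding leaf_labels_lower using Node(2,3) that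
        decor_label_ge[OF \<open>decor (p + 1 + 1) t\<close>] by (auto intro!: ordered_at_lower)
  qed
  moreover have "\<exists>a \<in> set (leaf_labels (lower_labels (Node ts))). a \<le> p - 2" if "0 < p"
  proof -
    obtain a where "a \<in> set (leaf_labels (Node ts))" "a \<le> p + 1 - 2"
      using Node(2,3) by (auto simp del: diff_add_eq)
    then show ?thesis unfolding leaf_labels_lower set_map using that
      by (intro bexI[OF _ imageI[of a]]) auto
  qed
  ultimately show ?case using Node(2) by (auto simp: lower_labels_Node)
qed

lemma decor_map_add:
  "decor p t \<Longrightarrow> 0 < p \<Longrightarrow> 0 \<le> r \<Longrightarrow> decor (p + r) (map_ltree (\<lambda>a. a + r) t)"
proof (induction t arbitrary: p)
  case (Node ts)
  have "decor (p + r + 1) (map_ltree (\<lambda>a. a + r) t) \<and>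
      ordered_at (p + r) (leaf_labels (map_ltree (\<lambda>a. a + r) t))" if "t \<in> set ts" for t
    using Node(1)[OF that, of "p + 1"] Node(2-) that
    by (auto simp: algebra_simps leaf_labels_map_ltree intro: ordered_at_map_add)
  moreover have "\<exists>a \<in> set (leaf_labels (map_ltree (\<lambda>a. a + r) (Node ts))). a \<le> p + r - 2"
  proof -
    obtain a where "a \<in> set (leaf_labels (Node ts))" "a \<le> p - 2" using Node(2,3) by auto
    then show ?thesis unfolding leaf_labels_map_ltree by force
  qed
  ultimately show ?case using Node(2) by auto
qed auto

text \<open>The last leaf keeps its label -1. It lies below every node of the rightmost path and
  there witnesses condition (2); as no depth is negative, it never triggers condition (3).\<close>

lemma decor_raise:
  assumes "decor p t" "0 \<le> p" "0 < r" "last (leaf_labels t) = -1"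
  shows "decor (p + r) (raise_labels r t)"
  using assms
proof (induction r t arbitrary: p rule: raise_labels.induct)
  case (2 r ts)
  then obtain bs l where ts: "ts = bs @ [l]" by (cases ts rule: rev_exhaust) auto
  have last_ts: "last ts = l" using ts by simp
  have dl: "decor (p + 1) l" using 2 ts by simp
  have ne: "leaf_labels l \<noteq> []" using decor_leaf_labels_nonempty[OF dl] .
  have la: "last (leaf_labels l) = -1" using 2(5) ts ne by simp
  have IH: "decor (p + 1 + r) (raise_labels r l)"
    using 2(1)[unfolded last_ts, OF _ dl] 2(3,4) la ts by auto
  define L where "L = butlast (leaf_labels l)"
  have L: "leaf_labels l = L @ [-1]"
    unfolding L_def using ne la by (metis append_butlast_last_id)
  have R: "leaf_labels (raise_labels r l) = map (\<lambda>a. a + r) L @ [-1]"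
    unfolding leaf_labels_raise[OF dl] L_def la ..
  have "ordered_at p (L @ [-1])" using 2(2) ts L by auto
  then have o: "ordered_at (p + r) (leaf_labels (raise_labels r l))"
    unfolding R ordered_at_append using ordered_at_map_add[of p L r] 2(3,4) by auto
  have b: "decor (p + r + 1) (map_ltree (\<lambda>a. a + r) t)"
      "ordered_at (p + r) (leaf_labels (map_ltree (\<lambda>a. a + r) t))" if "t \<in> set bs" for t
    using decor_map_add[of "p + 1" t r] 2(2-4) ts that
    by (auto simp: algebra_simps leaf_labels_map_ltree intro: ordered_at_map_add)
  show ?case using IH o b R ts 2(3,4) by (auto simp: algebra_simps)
qed auto

lemma decor_attach:
  assumes "decor p t" "0 \<le> p" "1 \<le> k" "k \<le> rpath t"
  shows "decor p (attach k t)"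
  using assms
proof (induction k t arbitrary: p rule: attach.induct)
  case (4 i ts)
  then obtain bs l where ts: "ts = bs @ [l]" by (cases ts rule: rev_exhaust) auto
  have last_ts: "last ts = l" using ts by simp
  have dl: "decor (p + 1) l" using 4(2) ts by simp
  have k: "Suc i \<le> rpath l" using 4 ts by simp
  have IH: "decor (p + 1) (attach (Suc i) l)" using 4(1)[unfolded last_ts, OF _ dl] k 4(3) ts by simp
  have L: "leaf_labels (attach (Suc i) l) = leaf_labels l @ [-1]"
    using leaf_labels_attach[OF dl _ k] by simp
  have "ordered_at p (leaf_labels (attach (Suc i) l))"
    unfolding L ordered_at_append using 4(2,3) ts by auto
  then show ?case using IH L 4(2,3) ts by auto
qed auto

lemma decor_subst_last:
  assumes "decor p t" "0 \<le> p" "0 < rpath t \<or> 0 < p" "decor (p + int (rpath t)) s" "last (leaf_labels t) = -1"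
    "last (leaf_labels s) = -1"
    and "\<forall>a \<in> set (butlast (leaf_labels s)). p + int (rpath t) - 1 \<le> a"
  shows "decor p (subst_last s t)"
  using assms
proof (induction s t arbitrary: p rule: subst_last.induct)
  case (2 s ts)
  then obtain bs l where ts: "ts = bs @ [l]" by (cases ts rule: rev_exhaust) auto
  have last_ts: "last ts = l" using ts by simp
  have dl: "decor (p + 1) l" using 2(2) ts by simp
  have ne: "leaf_labels l \<noteq> []" using decor_leaf_labels_nonempty[OF dl] .
  have la: "last (leaf_labels l) = -1" using 2(6) ts ne by simp
  have IH: "decor (p + 1) (subst_last s l)"
  proof (rule 2(1)[unfolded last_ts, OF _ dl])
    have e: "p + 1 + int (rpath l) = p + int (rpath (Node ts))" using ts by simp
    show "decor (p + 1 + int (rpath l)) s" using 2(5) unfolding e .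
    show "\<forall>a \<in> set (butlast (leaf_labels s)). p + 1 + int (rpath l) - 1 \<le> a"
      using 2(8) unfolding e .
  qed (use 2 ts la in auto)
  define L where "L = butlast (leaf_labels l)"
  have L: "leaf_labels l = L @ [-1]"
    unfolding L_def using ne la by (metis append_butlast_last_id)
  have sne: "leaf_labels s \<noteq> []" using decor_leaf_labels_nonempty 2(5) by blast
  define K where "K = butlast (leaf_labels s)"
  have K: "leaf_labels s = K @ [-1]"
    unfolding K_def using sne 2(7) by (metis append_butlast_last_id)
  have Kge: "\<forall>a \<in> set K. p + int (rpath l) \<le> a" using 2(8) ts by (auto simp: K_def)
  have S: "leaf_labels (subst_last s l) = L @ K @ [-1]"
    using leaf_labels_subst_last[OF dl] K by (simp add: L_def)
  have oL: "ordered_at p L" using 2(2) ts L by (auto simp: ordered_at_append)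
  have oK: "ordered_at p K"
    using Kge by (induction K) (auto simp: ordered_at_def)
  \<comment> \<open>Condition (3) could only fail for a label \<open>p\<close> of the grafted tree
    behind a smaller label of \<open>l\<close>. By the lower bound \<open>Kge\<close> such a label
    forces \<open>rpath l = 0\<close>; then \<open>l\<close> is a single leaf and nothing precedes
    the graft.\<close>
  have "L = []" if "p \<in> set K"
  proof -
    have "rpath l = 0" using Kge that by auto
    then show ?thesis using dl by (cases l) (auto simp: L_def split: if_splits)
  qed
  then have "ordered_at p (leaf_labels (subst_last s l))"
    unfolding S ordered_at_append using oL oK Kge 2(3) by auto
  then show ?case using IH S 2(2,3) ts by auto
qed auto

section \<open>\<open>h_tree\<close> reverses the code\<close>

definition flip :: "step \<Rightarrow> step" where
  "flip x = (case x of Down \<Rightarrow> Close | Up \<Rightarrow> Open | Open \<Rightarrow> Up | Close \<Rightarrow> Down)"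

lemma flip_simps [simp]: "flip Down = Close" "flip Up = Open" "flip Open = Up" "flip Close = Down"
  by (simp_all add: flip_def)

text \<open>The leftmost leaf contributes an \<open>Open\<close> just before the \<open>Up\<close>
  of the root and one final \<open>Close\<close>. In the reversed word these are an
  \<open>Up\<close> right after the first \<open>Open\<close> and one more leading
  \<open>Down\<close>. The first \<open>Open\<close> is thus enclosed by \<open>Down\<close> and
  \<open>Up\<close>: the last leaf becomes a node with one leaf.\<close>

lemma h_tree_Leaf_hd:
  assumes d: "decor 0 (Node (Leaf a # t # ts))"
    and d2: "decor 0 (h_tree (Node (t # ts)))"
    and c2: "tcode 0 (h_tree (Node (t # ts))) = rev (map flip (tcode 0 (Node (t # ts))))"
    and l2: "last (leaf_labels (h_tree (Node (t # ts)))) = -1"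
  defines "T \<equiv> Node (Leaf a # t # ts)" and "T2 \<equiv> h_tree (Node (t # ts))" and "s \<equiv> Node [Leaf (-1)]"
  shows "decor 0 (subst_last s T2) \<and> tcode 0 (subst_last s T2) = rev (map flip (tcode 0 T)) \<and>
     last (leaf_labels (subst_last s T2)) = -1"
proof -
  have a: "a = -1" using d by simp
  define w where "w = concat (map (tcode 1) (rev (t # ts)))"
  define c where "c = count_list (leaf_labels (Node (t # ts))) (-1)"
  have w2: "tcode 0 (Node (t # ts)) = Down # w @ Up # replicate c Close"
    by (simp add: w_def c_def)
  have wT: "tcode 0 T = Down # w @ Open # Up # replicate (Suc c) Close"
    by (simp add: T_def w_def c_def a)
  define m where "m = rev (map flip w)"
  have m2: "tcode 0 T2 = replicate c Down @ Open # m @ [Close]"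
    unfolding T2_def c2 w2 by (simp add: m_def)
  have r: "rpath T2 = c" using rpath_eqI[OF d2[folded T2_def] m2] .
  have "-1 \<in> set (leaf_labels (Node (t # ts)))"
    using free_leaf_in_root_subtree[of "Node (t # ts)"] d by simp
  then have c: "0 < c" using count_list_0_iff[of "leaf_labels (Node (t # ts))" "-1"] unfolding c_def
    by linarith
  \<comment> \<open>Positivity of \<open>c\<close> matters: at depth 0 the free leaf would add a
    \<open>Close\<close>.\<close>
  have s: "tcode (int c) s = [Down, Open, Up]" using c by (simp add: s_def)
  have "tcode 0 (subst_last s T2) = replicate (rpath T2) Down @ tcode (0 + int (rpath T2)) s @ m @ [Close]"
    using d2 l2 m2 r by (intro tcode_subst_last) (auto simp: s_def T2_def)
  also have "\<dots> = replicate c Down @ [Down, Open, Up] @ m @ [Close]" using r s by simp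
  also have "\<dots> = rev (map flip (tcode 0 T))"
    unfolding wT by (simp add: m_def replicate_append_same[symmetric])
  finally have 1: "tcode 0 (subst_last s T2) = rev (map flip (tcode 0 T))" .
  have 2: "decor 0 (subst_last s T2)"
    using d2 l2 r c by (intro decor_subst_last) (auto simp: s_def T2_def)
  have "last (leaf_labels (subst_last s T2)) = -1"
    using leaf_labels_subst_last[OF d2[folded T2_def]] by (simp add: s_def)
  then show ?thesis using 1 2 by simp
qed

text \<open>The word of \<open>T\<close> has \<open>j\<close> closings at depth 1 and
  \<open>k\<close> at depth 0, separated by an \<open>Up\<close>; lowering the labels fuses the two
  blocks. In reversed words the difference is an \<open>Open\<close> after the first
  \<open>k\<close> of the \<open>k + j\<close> steps \<open>Down\<close>, and a final
  \<open>Close\<close>. This is a leaf attached to node number \<open>k\<close> of the rightmost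
  path, and \<open>k = fl T\<close>.\<close>

lemma h_tree_single:
  assumes d: "decor 0 (Node [Node us])"
  defines "T' \<equiv> lower_labels (Node us)"
  assumes d2: "decor 0 (h_tree T')" and c2: "tcode 0 (h_tree T') = rev (map flip (tcode 0 T'))"
  defines "T \<equiv> Node [Node us]"
  shows "decor 0 (attach (fl T) (h_tree T')) \<and>
     tcode 0 (attach (fl T) (h_tree T')) = rev (map flip (tcode 0 T)) \<and>
     last (leaf_labels (attach (fl T) (h_tree T'))) = -1"
proof -
  have du: "decor (0 + 1) (Node us)" using d by simp
  define w where "w = concat (map (tcode 2) (rev us))"
  define j where "j = count_list (leaf_labels (Node us)) 0"
  define k where "k = count_list (leaf_labels (Node us)) (-1)"
  have k: "fl T = k" by (simp add: T_def fl_def k_def)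
  have wT: "tcode 0 T = Down # Down # w @ Up # replicate j Close @ Up # replicate k Close"
    by (simp add: T_def w_def j_def k_def)
  have "map (tcode 1) (rev (map lower_labels us)) = map (tcode 2) (rev us)"
    using tcode_lower[of 1] du by (auto simp: rev_map)
  moreover have "count_list (leaf_labels T') (-1) = j + k"
    unfolding T'_def leaf_labels_lower j_def k_def
    using decor_label_ge[OF du] by (subst count_lower_free) auto
  ultimately have wT': "tcode 0 T' = Down # w @ Up # replicate (j + k) Close"
    unfolding T'_def lower_labels_Node by (simp add: w_def)
  define m where "m = rev (map flip w)"
  have m2: "tcode 0 (h_tree T') = replicate (k + j) Down @ Open # m @ [Close]"
    unfolding c2 wT' by (simp add: m_def add.commute)
  have r: "rpath (h_tree T') = k + j" using rpath_eqI[OF d2 m2] .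
  have "-1 \<in> set (leaf_labels (Node us))"
    using free_leaf_in_root_subtree[OF d] by simp
  then have k1: "1 \<le> k" using count_list_0_iff[of "leaf_labels (Node us)" "-1"] unfolding k_def
    by linarith
  have "tcode 0 (attach k (h_tree T')) =
      replicate k Down @ Open # (replicate j Down @ Open # m @ [Close]) @ (if (0::int) = 0 then [Close] else [])"
    using d2 k1 r m2 by (intro tcode_attach) (auto simp: replicate_add)
  also have "\<dots> = rev (map flip (tcode 0 T))"
    unfolding wT by (simp add: m_def)
  finally show ?thesis
    using decor_attach[OF d2 _ k1] leaf_labels_attach[OF d2 k1] r by (simp add: k)
qed

text \<open>The word of \<open>T\<close> arises from that of \<open>Node (t # ts)\<close> by
  inserting the word \<open>u\<close> of the leftmost child before the \<open>Up\<close> and adding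
  up the final closings. Reversed, the first \<open>Open\<close> of \<open>T2\<close> is replaced by
  the word of \<open>T1\<close> without its final \<open>Close\<close>; raising the labels of
  \<open>T1\<close> removes just this \<open>Close\<close>.\<close>

lemma h_tree_Node_hd:
  assumes d: "decor 0 (Node (Node us # t # ts))"
  defines "T1 \<equiv> h_tree (Node [Node us])" and "T2 \<equiv> h_tree (Node (t # ts))"
  assumes d1: "decor 0 T1" and c1: "tcode 0 T1 = rev (map flip (tcode 0 (Node [Node us])))"
    and l1: "last (leaf_labels T1) = -1"
    and d2: "decor 0 T2" and c2: "tcode 0 T2 = rev (map flip (tcode 0 (Node (t # ts))))"
    and l2: "last (leaf_labels T2) = -1"
  defines "T \<equiv> Node (Node us # t # ts)" and "s \<equiv> raise_labels (int (rpath T2)) T1"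
  shows "decor 0 (subst_last s T2) \<and> tcode 0 (subst_last s T2) = rev (map flip (tcode 0 T)) \<and>
     last (leaf_labels (subst_last s T2)) = -1"
proof -
  define w where "w = concat (map (tcode 1) (rev (t # ts)))"
  define a2 where "a2 = count_list (leaf_labels (Node (t # ts))) (-1)"
  define u where "u = tcode 1 (Node us)"
  define a1 where "a1 = count_list (leaf_labels (Node us)) (-1)"
  have wt: "tcode 0 (Node (t # ts)) = Down # w @ Up # replicate a2 Close"
    by (simp add: w_def a2_def)
  have wu: "tcode 0 (Node [Node us]) = Down # u @ Up # replicate a1 Close"
    by (simp add: u_def a1_def)
  have wT: "tcode 0 T = Down # w @ u @ Up # replicate (a1 + a2) Close"
    by (simp add: T_def w_def u_def a1_def a2_def)
  define m where "m = rev (map flip w)"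
  define n where "n = rev (map flip u)"
  have m2: "tcode 0 T2 = replicate a2 Down @ Open # m @ [Close]"
    unfolding c2 wt by (simp add: m_def)
  have n1: "tcode 0 T1 = replicate a1 Down @ Open # n @ [Close]"
    unfolding c1 wu by (simp add: n_def)
  have r: "rpath T2 = a2" using rpath_eqI[OF d2 m2] .
  have "-1 \<in> set (leaf_labels (Node (t # ts)))"
    using free_leaf_in_root_subtree[of "Node (t # ts)"] d by simp
  then have a2: "0 < a2" using count_list_0_iff[of "leaf_labels (Node (t # ts))" "-1"] unfolding a2_def
    by linarith
  have nd: "is_node T1" using d1 by (cases T1) auto
  have s: "tcode (int a2) s = replicate a1 Down @ Open # n"
    using tcode_raise[OF d1 _ _ l1, of "int a2"] a2 nd n1 r by (simp add: s_def)
  have ds: "decor (int a2) s"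
    using decor_raise[OF d1 _ _ l1, of "int a2"] a2 r by (simp add: s_def)
  have L: "leaf_labels s = map (\<lambda>a. a + int a2) (butlast (leaf_labels T1)) @ [-1]"
    using leaf_labels_raise[OF d1, of "int a2"] l1 r by (simp add: s_def)
  have ge: "\<forall>a \<in> set (butlast (leaf_labels s)). 0 + int (rpath T2) - 1 \<le> a"
    using decor_label_ge[OF d1] r by (auto simp: L dest: in_set_butlastD)
  have "tcode 0 (subst_last s T2) = replicate (rpath T2) Down @ tcode (0 + int (rpath T2)) s @ m @ [Close]"
    using d2 l2 m2 r ge by (intro tcode_subst_last) (auto simp: L)
  also have "\<dots> = replicate a2 Down @ replicate a1 Down @ Open # n @ m @ [Close]" using r s by simp
  also have "\<dots> = rev (map flip (tcode 0 T))"
    unfolding wT by (simp add: m_def n_def add.commute flip: replicate_add)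
  finally have 1: "tcode 0 (subst_last s T2) = rev (map flip (tcode 0 T))" .
  have 2: "decor 0 (subst_last s T2)"
    using d2 l2 r a2 ds ge by (intro decor_subst_last) (auto simp: L)
  have "last (leaf_labels (subst_last s T2)) = -1"
    using leaf_labels_subst_last[OF d2] by (simp add: L)
  then show ?thesis using 1 2 by simp
qed

text \<open>The clause on the last label is part of the induction because grafting needs the
  replaced leaf and the last leaf of the graft to have equal labels.\<close>

theorem h_tree_code:
  "decor 0 T \<Longrightarrow> decor 0 (h_tree T) \<and> tcode 0 (h_tree T) = rev (map flip (tcode 0 T)) \<and>
     last (leaf_labels (h_tree T)) = -1"
proof (induction T rule: h_tree.induct)
  case (4 ts)
  have "decor 0 (lower_labels (Node ts))" using 4(2) by (intro decor_lower) auto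
  from 4(1)[OF this] show ?case using h_tree_single[OF 4(2)] by simp
next
  case (5 a t ts)
  have "decor 0 (Node (t # ts))" using 5(2) by simp
  from 5(1)[OF this] show ?case using h_tree_Leaf_hd[OF 5(2)] by simp
next
  case (6 us t ts)
  have 1: "decor 0 (Node (t # ts))" and 2: "decor 0 (Node [Node us])" using 6(3) by simp_all
  show ?case using h_tree_Node_hd[OF 6(3)] 6(1)[OF 2] 6(2)[OF refl 1] by (simp add: Let_def)
qed auto

section \<open>Tours\<close>

text \<open>The steps \<open>a\<close> and \<open>b\<close> act as opening and closing brackets; the stacks consist of pending darts.\<close>

primrec runs :: "('d \<Rightarrow> 'd) \<Rightarrow> step \<Rightarrow> step \<Rightarrow> ('d \<times> step) list \<Rightarrow> 'd list \<Rightarrow> 'd list \<Rightarrow> bool" where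
  "runs op a b [] S S' \<longleftrightarrow> S = S'"
| "runs op a b (x # W) S S' \<longleftrightarrow>
     (if snd x = a then runs op a b W (fst x # S) S'
      else if snd x = b then \<exists>t S1. S = t # S1 \<and> op t = fst x \<and> runs op a b W S1 S'
      else runs op a b W S S')"

lemma runs_append:
  "runs op a b (X @ Y) S S'' \<longleftrightarrow> (\<exists>S'. runs op a b X S S' \<and> runs op a b Y S' S'')"
  by (induction X arbitrary: S) auto

text \<open>Which dart a mirrored step uses is dictated by the dual map: it is the image under
  \<open>cw (dual M)\<close> of the dart that follows the original step. This is \<open>d\<close>
  itself when the step crosses the edge of \<open>d\<close>, and the opposite dart when it only
  passes \<open>d\<close>; see \<open>path_mirror\<close>.\<close>

definition mirror :: "('d \<Rightarrow> 'd) \<Rightarrow> ('d \<times> step) list \<Rightarrow> ('d \<times> step) list" where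
  "mirror op W = rev (map (\<lambda>(d, l). (if l = Down \<or> l = Up then d else op d, flip l)) W)"

lemma mirror_Nil [simp]: "mirror op [] = []"
  by (simp add: mirror_def)

lemma mirror_Cons:
  "mirror op ((d, l) # W) = mirror op W @ [(if l = Down \<or> l = Up then d else op d, flip l)]"
  by (simp add: mirror_def)

lemma map_snd_mirror: "map snd (mirror op W) = rev (map flip (map snd W))"
  by (simp add: mirror_def rev_map comp_def case_prod_beta)

lemma runs_mirror_Open:
  assumes "\<And>d. op (op d) = d"
  shows "runs op Open Close W S S' \<Longrightarrow> runs op Down Up (mirror op W) S' S"
proof (induction W arbitrary: S)
  case (Cons x W)
  obtain d l where x: "x = (d, l)" by (cases x)
  show ?case
    using Cons assms unfolding x by (cases l) (auto simp: mirror_Cons runs_append)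
qed simp

text \<open>Backwards the bracket met first is the former \<open>Up\<close>, whose dart is opposite
  to the one pushed at \<open>Down\<close>; hence \<open>map op\<close> on the stacks. For chords,
  \<open>mirror\<close> has already passed to the opposite darts, so there the stacks stay the
  same.\<close>

lemma runs_mirror_Down:
  assumes "\<And>d. op (op d) = d"
  shows "runs op Down Up W S S' \<Longrightarrow> runs op Open Close (mirror op W) (map op S') (map op S)"
proof (induction W arbitrary: S)
  case (Cons x W)
  obtain d l where x: "x = (d, l)" by (cases x)
  show ?case
    using Cons assms unfolding x
    by (cases l) (fastforce simp: mirror_Cons runs_append)+
qed simp

text \<open>
  \<open>seg op p ts W V Q\<close>: \<open>W\<close> is an initial part of the walk around a vertex of depth \<open>p\<close>, which has
  created the children \<open>ts\<close> there (in order of creation) and seen the darts \<open>V\<close> of this vertex.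
  \<open>Q\<close> is the stack of the darts that are still open, with the depths at which they will be closed.
\<close>

inductive seg :: "('d \<Rightarrow> 'd) \<Rightarrow> int \<Rightarrow> int ltree list \<Rightarrow> ('d \<times> step) list \<Rightarrow> 'd list \<Rightarrow> (int \<times> 'd) list \<Rightarrow> bool"
  for op where
  Empty: "seg op p [] [] [] []"
| Opening: "seg op p (ts @ [Leaf a]) (W @ [(d, Open)]) (V @ [d]) ((a, d) # Q)"
  if "seg op p ts W V Q" "-1 \<le> a" "a < p"
| Closing: "seg op p ts (W @ [(op d, Close)]) (V @ [op d]) Q"
  if "seg op p ts W V ((p, d) # Q)"
| Subtree: "seg op p (ts @ [Node (rev us)]) (W @ (d, Down) # W' @ [(op d, Up)]) (V @ [d]) (Q' @ Q)"
  if "seg op p ts W V Q" "seg op (p + 1) us W' V' Q'"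
    "\<forall>x \<in> set Q'. fst x \<le> p" "\<exists>x \<in> set Q'. fst x < p"

lemma seg_runs:
  "seg op p ts W V Q \<Longrightarrow> runs op Down Up W S S \<and> runs op Open Close W R (map snd Q @ R)"
proof (induction arbitrary: S R rule: seg.induct)
  case (Subtree p ts W V Q us W' V' Q' d)
  show ?case using Subtree.IH(1)[of S R] Subtree.IH(2)[of "d # S" "map snd Q @ R"]
    by (auto simp: runs_append)
next
  case (Opening p ts W V Q a d)
  show ?case using Opening.IH[of S R] by (auto simp: runs_append)
next
  case (Closing p ts W V d Q)
  show ?case using Closing.IH[of S R] by (auto simp: runs_append)
qed simp

lemma seg_label_bounds: "seg op p ts W V Q \<Longrightarrow> x \<in> set Q \<Longrightarrow> -1 \<le> fst x \<and> fst x \<le> p"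
  by (induction rule: seg.induct) auto

text \<open>Chords are closed at this vertex or in its subtrees, hence only if labeled at least
  \<open>p\<close>; the smaller labels survive. The newest chord is on top of the stack and the
  newest child is leftmost, so even the orders agree.\<close>

lemma seg_open_labels:
  "seg op p ts W V Q \<Longrightarrow>
   filter (\<lambda>a. a < p) (map fst Q) = filter (\<lambda>a. a < p) (leaf_labels (Node (rev ts)))"
proof (induction rule: seg.induct)
  case (Subtree p ts W V Q us W' V' Q' d)
  have "map fst Q' = filter (\<lambda>a. a < p + 1) (map fst Q')"
    using Subtree.hyps(3) by (intro filter_True[symmetric]) auto
  then have "filter (\<lambda>a. a < p) (map fst Q') =
      filter (\<lambda>a. a < p) (filter (\<lambda>a. a < p + 1) (leaf_labels (Node (rev us))))"
    unfolding Subtree.IH(2) by simp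
  also have "\<dots> = filter (\<lambda>a. a < p) (leaf_labels (Node (rev us)))"
    unfolding filter_filter by (intro filter_cong) auto
  finally show ?case using Subtree.IH(1) by simp
qed auto

lemma seg_open_labels_full:
  assumes "seg op p ts W V Q" "\<forall>x \<in> set Q. fst x < p"
  shows "map fst Q = filter (\<lambda>a. a < p) (leaf_labels (Node (rev ts)))"
proof -
  have "filter (\<lambda>a. a < p) (map fst Q) = map fst Q" using assms(2) by (intro filter_True) auto
  then show ?thesis using seg_open_labels[OF assms(1)] by simp
qed

lemma ordered_at_if_less: "\<forall>a \<in> set L. a < p \<Longrightarrow> ordered_at p L"
  by (induction L) (auto simp: ordered_at_def)

lemma ordered_at_filter: "ordered_at p (filter (\<lambda>a. a < p + 1) L) \<longleftrightarrow> ordered_at p L"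
  by (induction L) (auto simp: ordered_at_def)

lemma count_list_filter: "P a \<Longrightarrow> count_list (filter P L) a = count_list L a"
  by (induction L) auto

lemma no_label_below_lower:
  assumes "ordered_at p (map fst (P @ Q))" "x \<in> set P" "fst x < p" "y \<in> set Q"
  shows "fst y \<noteq> p"
  using assms by (auto simp: ordered_at_def sorted_wrt_append)

text \<open>\<open>ordered_at\<close> for the final stack excludes a chord labeled \<open>p\<close>
  below a smaller label, that is, one left open when a later child began. The replicated
  \<open>Close\<close> supplies the closings still due after the last child.\<close>

lemma seg_code:
  "seg op p ts W V Q \<Longrightarrow> ordered_at p (map fst Q) \<Longrightarrow>
   map snd W @ replicate (count_list (map fst Q) p) Close = concat (map (tcode (p + 1)) ts)"
proof (induction rule: seg.induct)
  case (Opening p ts W V Q a d)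
  have "p \<notin> set (map fst Q)" and o: "ordered_at p (map fst Q)"
    using Opening.prems Opening.hyps(3) by (auto simp: ordered_at_def)
  then have "count_list (map fst Q) p = 0" by (simp add: count_list_0_iff)
  then show ?case using Opening.IH[OF o] Opening.hyps by simp
next
  case (Closing p ts W V d Q)
  have "ordered_at p (map fst ((p, d) # Q))" using Closing.prems by (auto simp: ordered_at_def)
  from Closing.IH[OF this] show ?case by simp
next
  case (Subtree p ts W V Q us W' V' Q' d)
  have o: "ordered_at p (map fst Q)" using Subtree.prems by (auto simp: ordered_at_append)
  have "p \<notin> set (map fst Q)"
    using no_label_below_lower[OF Subtree.prems] Subtree.hyps(4) by auto
  then have "count_list (map fst Q) p = 0" by (simp add: count_list_0_iff)
  then have 1: "map snd W = concat (map (tcode (p + 1)) ts)" using Subtree.IH(1)[OF o] by simp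
  have l: "\<forall>x \<in> set Q'. fst x < p + 1" using Subtree.hyps(3) by auto
  then have o': "ordered_at (p + 1) (map fst Q')" by (intro ordered_at_if_less) auto
  have "p + 1 \<notin> set (map fst Q')" using l by auto
  then have "count_list (map fst Q') (p + 1) = 0" by (simp add: count_list_0_iff)
  then have 2: "map snd W' = concat (map (tcode (p + 1 + 1)) us)" using Subtree.IH(2)[OF o'] by simp
  have "count_list (map fst Q') p = count_list (leaf_labels (Node (rev us))) p"
    unfolding seg_open_labels_full[OF Subtree.hyps(2) l] by (simp add: count_list_filter)
  then show ?case using 1 2 \<open>count_list (map fst Q) p = 0\<close> by simp
qed auto

text \<open>Condition (3) for a child is read off the stack: the labels up to \<open>p\<close> below
  that child are those still open on return, in the same order, and larger labels do not affect the
  condition, by \<open>ordered_at_filter\<close>.\<close>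

lemma seg_decor:
  "seg op p ts W V Q \<Longrightarrow> ordered_at p (map fst Q) \<Longrightarrow>
   \<forall>t \<in> set ts. decor (p + 1) t \<and> ordered_at p (leaf_labels t)"
proof (induction rule: seg.induct)
  case (Opening p ts W V Q a d)
  then have "ordered_at p (map fst Q)" by (auto simp: ordered_at_def)
  from Opening.IH[OF this] show ?case using Opening.hyps by simp
next
  case (Closing p ts W V d Q)
  have "ordered_at p (map fst ((p, d) # Q))" using Closing.prems by (auto simp: ordered_at_def)
  from Closing.IH[OF this] show ?case by simp
next
  case (Subtree p ts W V Q us W' V' Q' d)
  have o: "ordered_at p (map fst Q)" "ordered_at p (map fst Q')"
    using Subtree.prems by (auto simp: ordered_at_append)
  have l: "\<forall>x \<in> set Q'. fst x < p + 1" using Subtree.hyps(3) by auto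
  then have o': "ordered_at (p + 1) (map fst Q')" by (intro ordered_at_if_less) auto
  have L: "map fst Q' = filter (\<lambda>a. a < p + 1) (leaf_labels (Node (rev us)))"
    using seg_open_labels_full[OF Subtree.hyps(2) l] .
  have 1: "ordered_at p (leaf_labels (Node (rev us)))"
    using o(2) unfolding L ordered_at_filter .
  have sub: "set (map fst Q') \<subseteq> set (leaf_labels (Node (rev us)))" unfolding L by auto
  obtain x where x: "x \<in> set Q'" "fst x < p" using Subtree.hyps(4) by auto
  then have "fst x \<in> set (leaf_labels (Node (rev us)))" using sub by force
  then have 2: "us \<noteq> []" "\<exists>a \<in> set (leaf_labels (Node (rev us))). a \<le> p + 1 - 2"
    using x(2) by auto
  have "decor (p + 1) (Node (rev us))"
    using 2 Subtree.IH(2)[OF o'] by (simp del: leaf_labels.simps)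
  then show ?case using 1 Subtree.IH(1)[OF o(1)] by auto
qed auto

section \<open>Parsing a bracketed word along a decorated tree\<close>

lemma ordered_split:
  "ordered_at p (map fst Q) \<Longrightarrow> \<forall>x \<in> set Q. fst x \<le> p \<Longrightarrow>
   \<exists>P N. Q = P @ N \<and> (\<forall>x \<in> set P. fst x = p) \<and> (\<forall>x \<in> set N. fst x < p)"
proof (induction Q)
  case (Cons x Q)
  show ?case
  proof (cases "fst x = p")
    case True
    obtain P N where "Q = P @ N" "\<forall>x \<in> set P. fst x = p" "\<forall>x \<in> set N. fst x < p"
      using Cons by (auto simp: ordered_at_def)
    then show ?thesis using True by (intro exI[of _ "x # P"] exI[of _ N]) auto
  next
    case False
    then have "\<forall>y \<in> set Q. fst y < p" using Cons(2,3) by (force simp: ordered_at_def)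
    then show ?thesis using False Cons(3) by (intro exI[of _ "[]"] exI[of _ "x # Q"]) auto
  qed
qed simp

lemma seg_closings:
  "seg op p ts W V (P @ Q) \<Longrightarrow> \<forall>x \<in> set P. fst x = p \<Longrightarrow> map snd Z = replicate (length P) Close \<Longrightarrow>
   runs op Open Close Z (map snd P @ R) R1 \<Longrightarrow>
   R1 = R \<and> seg op p ts (W @ Z) (V @ map fst Z) Q"
proof (induction P arbitrary: W V Z)
  case (Cons x P)
  obtain d where x: "x = (p, d)" using Cons(3) by (cases x) auto
  obtain z Z' where Z: "Z = z # Z'" using Cons(4) by (cases Z) auto
  then have z: "z = (op d, Close)" using Cons(4,5) x by (cases z) auto
  have "seg op p ts (W @ [(op d, Close)]) (V @ [op d]) (P @ Q)"
    using seg.Closing[of op p ts W V d "P @ Q"] Cons(2) x by simp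
  from Cons(1)[OF this] show ?case using Cons(3-5) x Z z by auto
qed auto

text \<open>Arbitrary lower stacks and an arbitrary earlier walk make this compose along forests:
  the closings in the code of \<open>t\<close> consume only chords opened within \<open>t\<close>,
  and the chords that remain go above the vertex.\<close>

definition parses :: "('d \<Rightarrow> 'd) \<Rightarrow> int \<Rightarrow> int ltree \<Rightarrow> bool" where
  "parses op p t \<longleftrightarrow> (\<forall>ts W V Q Z S S1 R R1.
     map snd Z = tcode (p + 1) t \<longrightarrow> runs op Down Up Z S S1 \<longrightarrow> runs op Open Close Z R R1 \<longrightarrow>
     seg op p ts W V Q \<longrightarrow>
     S1 = S \<and> (\<exists>V' Q'. seg op p (ts @ [t]) (W @ Z) (V @ V') (Q' @ Q) \<and>
       (\<forall>x \<in> set Q'. fst x < p) \<and> R1 = map snd Q' @ R))"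

lemma map_eq_concat_snoc:
  assumes "map f Z = concat (map g (xs @ [x]))"
  obtains Z1 Z2 where "Z = Z1 @ Z2" "map f Z1 = concat (map g xs)" "map f Z2 = g x"
  using assms by (auto simp: map_eq_append_conv)

lemma seg_parse_forest:
  assumes "\<forall>t \<in> set vs. parses op p t"
  shows "map snd Z = concat (map (tcode (p + 1)) vs) \<Longrightarrow> runs op Down Up Z S S1 \<Longrightarrow>
    runs op Open Close Z R R1 \<Longrightarrow>
    S1 = S \<and> (\<exists>V Q. seg op p vs Z V Q \<and> (\<forall>x \<in> set Q. fst x < p) \<and> R1 = map snd Q @ R)"
  using assms
proof (induction vs arbitrary: Z S1 R1 rule: rev_induct)
  case Nil
  then show ?case by (auto intro: seg.Empty exI[of _ "[]"])
next
  case (snoc t vs)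
  obtain Z1 Z2 where Z: "Z = Z1 @ Z2" "map snd Z1 = concat (map (tcode (p + 1)) vs)"
    "map snd Z2 = tcode (p + 1) t"
    using map_eq_concat_snoc[OF snoc(2)] .
  obtain S' R' where r: "runs op Down Up Z1 S S'" "runs op Down Up Z2 S' S1"
    "runs op Open Close Z1 R R'" "runs op Open Close Z2 R' R1"
    using snoc(3,4) Z(1) by (auto simp: runs_append)
  obtain V Q where 1: "S' = S" "seg op p vs Z1 V Q" "\<forall>x \<in> set Q. fst x < p" "R' = map snd Q @ R"
    using snoc(1)[OF Z(2) r(1,3)] snoc(5) by auto
  have "parses op p t" using snoc(5) by simp
  then obtain V' Q' where "S1 = S'" "seg op p (vs @ [t]) (Z1 @ Z2) (V @ V') (Q' @ Q)"
    "\<forall>x \<in> set Q'. fst x < p" "R1 = map snd Q' @ R'"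
    unfolding parses_def using Z(3) r(2,4) 1(2) by blast
  then show ?case using 1 Z(1)
    by (intro conjI exI[of _ "V @ V'"] exI[of _ "Q' @ Q"]) (simp_all add: ball_Un)
qed

lemma parses_if_decor:
  "decor (p + 1) t \<Longrightarrow> ordered_at p (leaf_labels t) \<Longrightarrow> 0 \<le> p \<Longrightarrow> parses op p t"
proof (induction t arbitrary: p)
  case (Leaf a)
  show ?case unfolding parses_def
  proof (intro allI impI)
    fix ts :: "int ltree list" and W V Q Z S S1 R R1
    assume a: "map snd Z = tcode (p + 1) (Leaf a :: int ltree)" "runs op Down Up Z S S1"
      "runs op Open Close Z R R1" "seg op p ts W V Q"
    obtain d where Z: "Z = [(d, Open)]" using a(1) by (auto simp: map_eq_Cons_conv)
    show "S1 = S \<and> (\<exists>V' Q'. seg op p (ts @ [Leaf a]) (W @ Z) (V @ V') (Q' @ Q) \<and>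
       (\<forall>x \<in> set Q'. fst x < p) \<and> R1 = map snd Q' @ R)"
      using a Leaf seg.Opening[OF a(4), of a d] unfolding Z
      by (auto intro!: exI[of _ "[d]"] exI[of _ "[(a, d)]"])
  qed
next
  case (Node us)
  show ?case unfolding parses_def
  proof (intro allI impI)
    fix ts :: "int ltree list" and W V Q Z S S1 R R1
    assume a: "map snd Z = tcode (p + 1) (Node us)" "runs op Down Up Z S S1"
      "runs op Open Close Z R R1" "seg op p ts W V Q"
    define k where "k = count_list (leaf_labels (Node us)) p"
    obtain d Z1 d2 cs where Z: "Z = (d, Down) # Z1 @ (d2, Up) # cs"
      and Z1: "map snd Z1 = concat (map (tcode (p + 1 + 1)) (rev us))"
      and cs: "map snd cs = replicate k Close"
      using a(1) unfolding k_def
      by (auto simp: map_eq_Cons_conv map_eq_append_conv append_eq_map_conv)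
    have ncs: "\<forall>x \<in> set cs. snd x = Close" using cs by (metis in_set_replicate list.set_map imageI)
    have csT: "runs op Down Up cs X Y \<longleftrightarrow> X = Y" for X Y
      using ncs by (induction cs) auto
    obtain S2 where S2: "runs op Down Up Z1 (d # S) S2" "\<exists>t. S2 = t # S1 \<and> op t = d2"
      using a(2) csT unfolding Z by (auto simp: runs_append)
    obtain R2 where R2: "runs op Open Close Z1 R R2" "runs op Open Close cs R2 R1"
      using a(3) unfolding Z by (auto simp: runs_append)
    have "\<forall>t \<in> set (rev us). parses op (p + 1) t" using Node by simp
    from seg_parse_forest[OF this Z1 S2(1) R2(1)] obtain V' Q1 where
      1: "S2 = d # S" "seg op (p + 1) (rev us) Z1 V' Q1" "\<forall>x \<in> set Q1. fst x < p + 1" "R2 = map snd Q1 @ R"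
      by auto
    have d2: "d2 = op d" "S1 = S" using S2(2) 1(1) by auto
    have L: "map fst Q1 = filter (\<lambda>a. a < p + 1) (leaf_labels (Node us))"
      using seg_open_labels_full[OF 1(2,3)] by simp
    have o: "ordered_at p (map fst Q1)" unfolding L ordered_at_filter using Node.prems(2) .
    have le: "\<forall>x \<in> set Q1. fst x \<le> p" using 1(3) by auto
    \<comment> \<open>The child has been left, and its open chords labeled \<open>p\<close> form the
      top block \<open>P\<close>. Its length equals the number \<open>k\<close> of closings that end
      the code, so these closings empty exactly this block.\<close>
    obtain P N where PN: "Q1 = P @ N" "\<forall>x \<in> set P. fst x = p" "\<forall>x \<in> set N. fst x < p"
      using ordered_split[OF o le] by blast
    obtain b where b: "b \<in> set (leaf_labels (Node us))" "b \<le> p + 1 - 2"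
      using Node.prems(1,3) by (simp only: decor.simps) auto
    then have "b \<in> set (map fst Q1)" unfolding L by auto
    then have ex: "\<exists>x \<in> set Q1. fst x < p" using b(2) by auto
    have "k = count_list (map fst Q1) p" unfolding L k_def by (simp add: count_list_filter)
    also have "\<dots> = length P"
    proof -
      have "count_list (map fst P) p = length P" using PN(2) by (induction P) auto
      moreover have "p \<notin> set (map fst N)" using PN(3) by auto
      ultimately show ?thesis unfolding PN(1) by (simp add: count_list_0_iff)
    qed
    finally have k: "k = length P" .
    have "seg op p (ts @ [Node (rev (rev us))]) (W @ (d, Down) # Z1 @ [(op d, Up)]) (V @ [d]) (Q1 @ Q)"
      by (rule seg.Subtree[OF a(4) 1(2) le ex])
    then have "seg op p (ts @ [Node us]) (W @ (d, Down) # Z1 @ [(op d, Up)]) (V @ [d]) (P @ N @ Q)"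
      unfolding PN(1) by simp
    from seg_closings[OF this PN(2) cs[unfolded k], of "map snd N @ R" R1]
    have "R1 = map snd N @ R \<and> seg op p (ts @ [Node us]) (W @ Z) (V @ [d] @ map fst cs) (N @ Q)"
      using R2(2) unfolding 1(4) PN(1) Z d2 by simp
    then show "S1 = S \<and> (\<exists>V' Q'. seg op p (ts @ [Node us]) (W @ Z) (V @ V') (Q' @ Q) \<and>
       (\<forall>x \<in> set Q'. fst x < p) \<and> R1 = map snd Q' @ R)"
      using PN(3) d2 by blast
  qed
qed

text \<open>No rotation enters here: labels and the pairing of darts suffice for reversing a word.
  The rotation of a map is added by \<open>tour\<close>.\<close>

definition tree_tour :: "('d \<Rightarrow> 'd) \<Rightarrow> ('d \<times> step) list \<Rightarrow> int ltree \<Rightarrow> bool" where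
  "tree_tour op W T \<longleftrightarrow> decor 0 T \<and> map snd W = tcode 0 T \<and>
     runs op Down Up W [] [] \<and> runs op Open Close W [] []"

lemma tree_tour_mirror:
  assumes "\<And>d. op (op d) = d" "tree_tour op W T"
  shows "tree_tour op (mirror op W) (h_tree T)"
  using assms h_tree_code[of T] runs_mirror_Open[OF assms(1), of W "[]" "[]"]
    runs_mirror_Down[OF assms(1), of W "[]" "[]"]
  by (auto simp: tree_tour_def map_snd_mirror)

lemma runs_closings:
  "map snd Z = replicate k Close \<Longrightarrow> runs op Open Close Z (map snd Q) [] \<Longrightarrow>
   Z = map (\<lambda>x. (op (snd x), Close)) Q"
proof (induction Z arbitrary: k Q)
  case (Cons z Z)
  obtain k' where k': "k = Suc k'" using Cons(2) by (cases k) auto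
  obtain x Q' where Q: "Q = x # Q'" using Cons(2,3) k' by (cases Q) auto
  show ?case using Cons(1)[of k' Q'] Cons(2,3) k' Q by (cases z) auto
qed auto

lemma tree_tour_seg:
  assumes "tree_tour op W T"
  obtains e us W' V Q where "T = Node (rev us)" "seg op 0 us W' V Q" "\<forall>x \<in> set Q. fst x = -1" "Q \<noteq> []"
    "W = (e, Down) # W' @ (op e, Up) # map (\<lambda>x. (op (snd x), Close)) Q"
proof -
  have d: "decor 0 T" and w: "map snd W = tcode 0 T"
    and r1: "runs op Down Up W [] []" and r2: "runs op Open Close W [] []"
    using assms by (auto simp: tree_tour_def)
  obtain us where T: "T = Node us" using d by (cases T) auto
  define k where "k = count_list (leaf_labels (Node us)) (-1)"
  obtain e Z1 d2 cs where Z: "W = (e, Down) # Z1 @ (d2, Up) # cs"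
    and Z1: "map snd Z1 = concat (map (tcode (0 + 1)) (rev us))"
    and cs: "map snd cs = replicate k Close"
    using w unfolding k_def T
    by (auto simp: map_eq_Cons_conv map_eq_append_conv append_eq_map_conv)
  have ncs: "\<forall>x \<in> set cs. snd x = Close" using cs by (metis in_set_replicate list.set_map imageI)
  have csT: "runs op Down Up cs X Y \<longleftrightarrow> X = Y" for X Y
    using ncs by (induction cs) auto
  obtain S2 where S2: "runs op Down Up Z1 [e] S2" "\<exists>t. S2 = [t] \<and> op t = d2"
    using r1 csT unfolding Z by (auto simp: runs_append)
  obtain R2 where R2: "runs op Open Close Z1 [] R2" "runs op Open Close cs R2 []"
    using r2 unfolding Z by (auto simp: runs_append)
  have "\<forall>t \<in> set (rev us). parses op 0 t" using d T by (auto intro: parses_if_decor)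
  from seg_parse_forest[OF this Z1 S2(1) R2(1)] obtain V Q where
    1: "S2 = [e]" "seg op 0 (rev us) Z1 V Q" "\<forall>x \<in> set Q. fst x < 0" "R2 = map snd Q"
    by auto
  have L: "map fst Q = filter (\<lambda>a. a < 0) (leaf_labels T)"
    using seg_open_labels_full[OF 1(2,3)] T by simp
  have "-1 \<in> set (map fst Q)" unfolding L using free_leaf_in_root_subtree[OF d] by simp
  then have "Q \<noteq> []" by auto
  moreover have "\<forall>x \<in> set Q. fst x = -1" using 1(3) seg_label_bounds[OF 1(2)] by force
  moreover have "cs = map (\<lambda>x. (op (snd x), Close)) Q"
    using runs_closings[OF cs] R2(2) 1(4) by simp
  ultimately show thesis using that[of "rev us" Z1 V Q e] T 1(1,2) S2(2) Z by simp
qed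

text \<open>The chords still open when the walk leaves the root of the tree all have label -1; they
  end at the root vertex of the map and are closed there in stack order. There being one at all, the
  tree has an edge.\<close>

lemma tree_tourI:
  assumes s: "seg op 0 us W' V Q" and l: "\<forall>x \<in> set Q. fst x < 0" and ne: "Q \<noteq> []"
  shows "tree_tour op ((e, Down) # W' @ (op e, Up) # map (\<lambda>x. (op (snd x), Close)) Q) (Node (rev us))"
proof -
  have o: "ordered_at 0 (map fst Q)" using l by (intro ordered_at_if_less) auto
  have L: "map fst Q = filter (\<lambda>a. a < 0) (leaf_labels (Node (rev us)))"
    using seg_open_labels_full[OF s l] .
  have un: "us \<noteq> []" using L ne by auto
  have m1: "\<forall>x \<in> set Q. fst x = -1" using l seg_label_bounds[OF s] by force
  have "0 \<notin> set (map fst Q)" using l by auto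
  then have "map snd W' = concat (map (tcode (0 + 1)) us)"
    using seg_code[OF s o] by (simp add: count_list_0_iff)
  moreover have "length Q = count_list (leaf_labels (Node (rev us))) (-1)"
  proof -
    have "length Q = count_list (map fst Q) (-1)" using m1 by (induction Q) auto
    then show ?thesis unfolding L by (simp add: count_list_filter)
  qed
  moreover have "decor 0 (Node (rev us))" using seg_decor[OF s o] un by auto
  moreover have "runs op Open Close (map (\<lambda>x. (op (snd x), Close)) Q) (map snd Q) []"
    by (induction Q) auto
  moreover have "runs op Down Up (map (\<lambda>x. (op (snd x), Close)) Q) [] []"
    by (induction Q) auto
  ultimately show ?thesis
    using seg_runs[OF s, of "[e]" "[]"]
    by (auto simp: tree_tour_def runs_append map_replicate_const comp_def)
qed

section \<open>Tours in maps\<close>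

definition next_dart :: "'d rooted_map \<Rightarrow> 'd \<times> step \<Rightarrow> 'd" where
  "next_dart M x = cw M (if snd x = Down \<or> snd x = Up then opp M (fst x) else fst x)"

text \<open>A walk around the spanning tree: a tree edge is crossed and the rotation continues at
  its far end, whereas a chord is passed at its near end.\<close>

primrec path :: "'d rooted_map \<Rightarrow> 'd \<Rightarrow> ('d \<times> step) list \<Rightarrow> 'd \<Rightarrow> bool" where
  "path M x [] y \<longleftrightarrow> x = y"
| "path M x (z # Z) y \<longleftrightarrow> x = fst z \<and> path M (next_dart M z) Z y"

definition tour :: "'d rooted_map \<Rightarrow> ('d \<times> step) list \<Rightarrow> bool" where
  "tour M W \<longleftrightarrow> path M (root_dart M) W (root_dart M) \<and> distinct (map fst W) \<and> fst ` set W = darts M"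

lemma path_append: "path M x (X @ Y) z \<longleftrightarrow> (\<exists>y. path M x X y \<and> path M y Y z)"
  by (induction X arbitrary: x) auto

lemma next_dart_simps [simp]:
  "next_dart M (d, Down) = cw M (opp M d)" "next_dart M (d, Up) = cw M (opp M d)"
  "next_dart M (d, Open) = cw M d" "next_dart M (d, Close) = cw M d"
  by (simp_all add: next_dart_def)

text \<open>Euler's formula is left out, so that it appears as an explicit assumption where crossing
  chords are excluded. Both \<open>M\<close> and \<open>dual M\<close> will be instances.\<close>

locale dart_map =
  fixes M :: "'d rooted_map"
  assumes finite_darts: "finite (darts M)"
    and opp_permutes: "opp M permutes darts M"
    and opp_neq: "d \<in> darts M \<Longrightarrow> opp M d \<noteq> d"
    and opp_opp [simp]: "opp M (opp M d) = d"
    and cw_permutes: "cw M permutes darts M"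
    and root_in: "root_dart M \<in> darts M"
    and connected: "connected_map M"
begin

abbreviation head :: "'d \<Rightarrow> 'd set" where
  "head d \<equiv> vertex_of M (opp M d)"

lemma opp_in_iff [simp]: "opp M d \<in> darts M \<longleftrightarrow> d \<in> darts M"
  using permutes_in_image[OF opp_permutes] .

lemma cw_in_iff [simp]: "cw M d \<in> darts M \<longleftrightarrow> d \<in> darts M"
  using permutes_in_image[OF cw_permutes] .

lemma opp_eq_iff [simp]: "opp M a = opp M b \<longleftrightarrow> a = b"
  by (metis opp_opp)

lemma permutation_cw: "permutation (cw M)"
  using finite_darts cw_permutes by (auto simp: permutation_permutes)

lemma in_vertex_of_self: "d \<in> vertex_of M d"
  unfolding vertex_of_def by (rule permutation_self_in_orbit[OF permutation_cw])

lemma vertex_of_eq: "y \<in> vertex_of M x \<Longrightarrow> vertex_of M y = vertex_of M x"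
  unfolding vertex_of_def by (rule orbit_cyclic_eq3[OF cyclic_on_orbit'[OF permutation_cw]])

lemma vertex_of_cw [simp]: "vertex_of M (cw M d) = vertex_of M d"
  unfolding vertex_of_def by (rule permutation_orbit_step[OF permutation_cw])

lemma vertex_of_funpow [simp]: "vertex_of M ((cw M ^^ n) d) = vertex_of M d"
  by (induction n) auto

lemma vertex_of_subset: "d \<in> darts M \<Longrightarrow> vertex_of M d \<subseteq> darts M"
  unfolding vertex_of_def by (rule permutes_orbit_subset[OF cw_permutes])

text \<open>Returning to \<open>d\<close> after passing pairwise distinct darts means having gone
  around the vertex exactly once.\<close>

lemma vertex_of_cycle:
  assumes V: "V = map (\<lambda>i. (cw M ^^ i) (cw M d)) [0..<length V]"
    and c: "(cw M ^^ length V) (cw M d) = d" and dist: "distinct (d # V)"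
  shows "vertex_of M d = set (d # V)" "darts_after M d = V"
proof -
  define n where "n = Suc (length V)"
  have dV: "d # V = map (\<lambda>i. (cw M ^^ i) d) [0..<n]"
  proof (rule nth_equalityI)
    fix i assume i: "i < length (d # V)"
    show "(d # V) ! i = map (\<lambda>i. (cw M ^^ i) d) [0..<n] ! i"
    proof (cases i)
      case (Suc j)
      then have "V ! j = (cw M ^^ j) (cw M d)" using i by (subst V) simp
      then show ?thesis using Suc i by (simp add: n_def funpow_swap1 del: upt_Suc)
    qed (simp add: n_def del: upt_Suc)
  qed (simp add: n_def)
  have "(cw M ^^ n) d = d" using c by (simp add: n_def funpow_swap1)
  then have "vertex_of M d = {(cw M ^^ m) d | m. m < n}"
    unfolding vertex_of_def by (rule orbit_altdef_bounded) (simp add: n_def)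
  also have "\<dots> = set (d # V)" unfolding dV by auto
  finally show 1: "vertex_of M d = set (d # V)" .
  have "card (vertex_of M d) = n" unfolding 1 distinct_card[OF dist] by (simp add: n_def)
  then have "darts_after M d = tl (d # V)"
    unfolding dV darts_after_def by (simp add: n_def upt_conv_Cons del: upt_Suc)
  then show "darts_after M d = V" by simp
qed

lemma darts_after_props:
  assumes "d \<in> darts M"
  shows "set (d # darts_after M d) = vertex_of M d" "distinct (d # darts_after M d)"
    "darts_after M d = map (\<lambda>i. (cw M ^^ i) (cw M d)) [0..<length (darts_after M d)]"
    "(cw M ^^ length (darts_after M d)) (cw M d) = d"
proof -
  define n where "n = funpow_dist1 (cw M) d d"
  have s: "d \<in> orbit (cw M) d" using in_vertex_of_self[of d] by (simp add: vertex_of_def)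
  have i: "inj_on (\<lambda>n. (cw M ^^ n) d) {0..<n}"
    unfolding n_def by (rule inj_on_funpow_dist1[OF s])
  have v: "vertex_of M d = (\<lambda>n. (cw M ^^ n) d) ` {0..<n}"
    unfolding n_def vertex_of_def by (rule orbit_conv_funpow_dist1[OF s])
  have c: "card (vertex_of M d) = n" unfolding v by (simp add: card_image[OF i])
  have n: "(cw M ^^ n) d = d" "0 < n" unfolding n_def using funpow_dist1_prop[OF s] by auto
  have dd: "d # darts_after M d = map (\<lambda>i. (cw M ^^ i) d) [0..<n]"
    unfolding darts_after_def c using n(2) by (simp add: upt_conv_Cons)
  show "set (d # darts_after M d) = vertex_of M d" unfolding dd v by simp
  show "distinct (d # darts_after M d)" unfolding dd using i by (simp add: distinct_map)
  have l: "length (darts_after M d) = n - 1" by (simp add: darts_after_def c)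
  have "darts_after M d = map (\<lambda>i. (cw M ^^ i) d) (map Suc [0..<n - 1])"
    unfolding darts_after_def c using n(2) by (simp add: map_Suc_upt)
  then show "darts_after M d = map (\<lambda>i. (cw M ^^ i) (cw M d)) [0..<length (darts_after M d)]"
    unfolding l by (simp add: comp_def funpow_swap1)
  show "(cw M ^^ length (darts_after M d)) (cw M d) = d"
    using n unfolding l by (metis Suc_pred' funpow_simps_right(2) comp_apply)
qed

lemma connected_closed:
  assumes "X \<subseteq> darts M" "X \<noteq> {}" "\<And>d. d \<in> X \<Longrightarrow> opp M d \<in> X" "\<And>d. d \<in> X \<Longrightarrow> cw M d \<in> X"
  shows "X = darts M"
proof -
  obtain x where x: "x \<in> X" using assms(2) by auto
  have "y \<in> X" if "y \<in> darts M" for y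
  proof -
    have "(x, y) \<in> {(a, b). a \<in> darts M \<and> (b = opp M a \<or> b = cw M a)}\<^sup>*"
      using connected x that assms(1) unfolding connected_map_def by blast
    then show ?thesis using x by (induction rule: rtrancl_induct) (auto intro: assms)
  qed
  then show ?thesis using assms(1) by auto
qed

text \<open>The edges inside and outside \<open>X\<close> form the separation. By connectedness some
  step of \<open>cw\<close> leaves \<open>X\<close>, which gives a vertex on both sides, and by
  \<open>cut\<close> this vertex can only be \<open>v\<close>. The hypothesis that the given map is
  non-separable is always applied through this criterion.\<close>

lemma cut_vertex:
  assumes ns: "\<not> separable M" and X: "X \<subseteq> darts M" "X \<noteq> {}" "X \<noteq> darts M"
    and X_opp: "\<And>d. d \<in> X \<Longrightarrow> opp M d \<in> X"
    and cut: "\<And>d. d \<in> X \<Longrightarrow> vertex_of M d \<noteq> v \<Longrightarrow> vertex_of M d \<subseteq> X"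
  shows False
proof -
  define E where "E Y = (\<lambda>d. {d, opp M d}) ` Y" for Y
  have Y_opp: "opp M d \<in> darts M - X" if "d \<in> darts M - X" for d
    using that X_opp[of "opp M d"] by auto
  have inc: "(\<exists>e \<in> E Y. incident u e) \<longleftrightarrow> u \<inter> Y \<noteq> {}" if "\<And>d. d \<in> Y \<Longrightarrow> opp M d \<in> Y" for u Y
  proof
    assume "\<exists>e \<in> E Y. incident u e"
    then obtain d where "d \<in> Y" "u \<inter> {d, opp M d} \<noteq> {}" by (auto simp: E_def incident_def)
    then show "u \<inter> Y \<noteq> {}" using that[of d] by auto
  next
    assume "u \<inter> Y \<noteq> {}"
    then obtain d where "d \<in> u" "d \<in> Y" by auto
    then show "\<exists>e \<in> E Y. incident u e"
      by (intro bexI[of _ "{d, opp M d}"]) (auto simp: E_def incident_def)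
  qed
  have iA: "(\<exists>e \<in> E X. incident u e) \<longleftrightarrow> u \<inter> X \<noteq> {}" for u using inc[of X] X_opp by blast
  have iB: "(\<exists>e \<in> E (darts M - X). incident u e) \<longleftrightarrow> u \<inter> (darts M - X) \<noteq> {}" for u
    using inc[of "darts M - X"] Y_opp by blast
  have uniq: "u = v" if u: "u \<in> vertices M" "u \<inter> X \<noteq> {}" "u \<inter> (darts M - X) \<noteq> {}" for u
  proof (rule ccontr)
    assume "u \<noteq> v"
    obtain d z where "d \<in> u" "d \<in> X" "u = vertex_of M z" using u by (auto simp: vertices_def)
    then have "u = vertex_of M d" using vertex_of_eq by metis
    then show False using cut[OF \<open>d \<in> X\<close>] \<open>u \<noteq> v\<close> u(3) by auto
  qed
  obtain d where d: "d \<in> X" "cw M d \<notin> X" using connected_closed[OF X(1,2) X_opp] X(3) by blast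
  have dd: "d \<in> darts M" using d X by auto
  have w: "vertex_of M d \<in> vertices M" "vertex_of M d \<inter> X \<noteq> {}" "vertex_of M d \<inter> (darts M - X) \<noteq> {}"
    using d dd in_vertex_of_self[of d] in_vertex_of_self[of "cw M d"]
    by (auto simp: vertices_def)
  have "\<exists>!u. u \<in> vertices M \<and> (\<exists>e \<in> E X. incident u e) \<and> (\<exists>e \<in> E (darts M - X). incident u e)"
    unfolding iA iB
  proof (rule ex1I[of _ "vertex_of M d"])
    show "vertex_of M d \<in> vertices M \<and> vertex_of M d \<inter> X \<noteq> {} \<and> vertex_of M d \<inter> (darts M - X) \<noteq> {}"
      using w by blast
    show "u = vertex_of M d"
      if "u \<in> vertices M \<and> u \<inter> X \<noteq> {} \<and> u \<inter> (darts M - X) \<noteq> {}" for u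
      using that uniq[of u] uniq[OF w] by simp
  qed
  moreover have "E X \<union> E (darts M - X) = edges M" using X(1) by (auto simp: E_def edges_def)
  moreover have "E X \<inter> E (darts M - X) = {}"
  proof -
    have "e \<subseteq> X" if "e \<in> E X" for e using that X_opp by (auto simp: E_def)
    moreover have "e \<inter> X = {} \<and> e \<noteq> {}" if "e \<in> E (darts M - X)" for e
      using that Y_opp by (auto simp: E_def)
    ultimately show ?thesis by blast
  qed
  moreover have "E X \<noteq> {}" "E (darts M - X) \<noteq> {}" using X by (auto simp: E_def)
  ultimately show False using ns unfolding separable_def by blast
qed

lemma no_loop:
  assumes "\<not> separable M" "2 \<le> card (edges M)" "d \<in> darts M"
  shows "head d \<noteq> vertex_of M d"
proof
  assume e: "head d = vertex_of M d"
  show False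
  proof (rule cut_vertex[OF assms(1), of "{d, opp M d}" "vertex_of M d"])
    show "{d, opp M d} \<noteq> darts M"
    proof
      assume D: "{d, opp M d} = darts M"
      have "edges M \<subseteq> {{d, opp M d}}" unfolding edges_def D[symmetric] by auto
      then have "card (edges M) \<le> 1" using card_mono[of "{{d, opp M d}}"] by simp
      then show False using assms(2) by simp
    qed
  qed (use assms(3) e in auto)
qed

text \<open>A child entered by \<open>d\<close> is left through \<open>opp M d\<close>, and the walk
  resumes at \<open>cw M d\<close>. Seen from the vertex, every step, with or without a subtree,
  advances the rotation by one dart.\<close>

lemma seg_path_chain:
  "seg (opp M) p ts W V Q \<Longrightarrow> path M x W y \<Longrightarrow>
   V = map (\<lambda>i. (cw M ^^ i) x) [0..<length V] \<and> y = (cw M ^^ length V) x"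
proof (induction arbitrary: y rule: seg.induct)
  case (Subtree p ts W V Q us W' V' Q' d)
  then show ?case by (auto simp: path_append)
next
  case (Opening p ts W V Q a d)
  then show ?case by (auto simp: path_append)
next
  case (Closing p ts W V d Q)
  then show ?case by (auto simp: path_append)
qed auto

lemma seg_vertex_darts:
  "seg (opp M) p ts W V Q \<Longrightarrow> d \<in> set V \<Longrightarrow> \<exists>l. l \<noteq> Up \<and> (d, l) \<in> set W"
  by (induction arbitrary: d rule: seg.induct) (auto; blast)+

text \<open>The walk below \<open>d\<close> starts just after \<open>opp M d\<close> and ends at it,
  so \<open>V'\<close> is a full turn around the new vertex, and a single one by
  distinctness.\<close>

lemma seg_subtree_vertex:
  assumes s: "seg (opp M) (p + 1) us W' V' Q'" and p: "path M d ((d, Down) # W' @ [(opp M d, Up)]) y"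
    and dist: "opp M d \<notin> fst ` set W'" "distinct (map fst W')" and vd: "distinct V'"
  shows "head d = set (opp M d # V')" "darts_after M (opp M d) = V'"
    "path M (cw M (opp M d)) W' (opp M d)"
proof -
  show p': "path M (cw M (opp M d)) W' (opp M d)" using p by (auto simp: path_append)
  note c = seg_path_chain[OF s p']
  have "opp M d \<notin> set V'" using seg_vertex_darts[OF s] dist(1) by force
  then show "head d = set (opp M d # V')" "darts_after M (opp M d) = V'"
    using vertex_of_cycle[of V' "opp M d"] c vd by auto
qed

lemma seg_distinct_vertex_darts:
  "seg (opp M) p ts W V Q \<Longrightarrow> distinct (map fst W) \<Longrightarrow> distinct V"
proof (induction rule: seg.induct)
  case (Opening p ts W V Q a d)
  then show ?case using seg_vertex_darts[OF Opening.hyps(1), of d] by force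
next
  case (Closing p ts W V d Q)
  then show ?case using seg_vertex_darts[OF Closing.hyps(1), of "opp M d"] by force
next
  case (Subtree p ts W V Q us W' V' Q' d)
  have "distinct V" using Subtree by simp
  moreover have "d \<notin> fst ` set W" using Subtree.prems by simp
  then have "d \<notin> set V" using seg_vertex_darts[OF Subtree.hyps(1), of d] by force
  ultimately show ?case by simp
qed simp

lemma seg_subtree_parts:
  assumes s: "seg (opp M) (p + 1) us W' V' Q'" and p: "path M x (W @ (d, Down) # W' @ [(opp M d, Up)]) y"
    and di: "distinct (map fst (W @ (d, Down) # W' @ [(opp M d, Up)]))"
  shows "\<exists>z. path M x W z" "distinct (map fst W)" "distinct (map fst W')" "opp M d \<notin> fst ` set W'"
    "head d = set (opp M d # V')" "darts_after M (opp M d) = V'"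
    "path M (cw M (opp M d)) W' (opp M d)"
proof -
  show d: "distinct (map fst W)" "distinct (map fst W')" "opp M d \<notin> fst ` set W'" using di by auto
  show "\<exists>z. path M x W z" using p by (auto simp: path_append)
  have "path M d ((d, Down) # W' @ [(opp M d, Up)]) y" using p by (auto simp: path_append)
  from seg_subtree_vertex[OF s this d(3,2) seg_distinct_vertex_darts[OF s d(2)]]
  show "head d = set (opp M d # V')" "darts_after M (opp M d) = V'"
    "path M (cw M (opp M d)) W' (opp M d)" .
qed

end

lemma dart_map_if_planar: "planar_map M \<Longrightarrow> dart_map M"
  using planar_map_opp_opp[of M] unfolding dart_map_def planar_map_def by simp

section \<open>The search follows a parsed tour\<close>

lemma explore_append:
  "explore M p (xs @ ys) depth U =
     (let (cs, depth', U') = explore M p xs depth U; (cs', depth'', U'') = explore M p ys depth' U'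
      in (cs @ cs', depth'', U''))"
proof (induction xs arbitrary: depth U)
  case (Cons d xs)
  show ?case by (auto simp: Cons split: option.split prod.split)
qed simp

context dart_map
begin

lemma seg_open_mem: "seg (opp M) p ts W V Q \<Longrightarrow> x \<in> set Q \<Longrightarrow> (snd x, Open) \<in> set W"
  by (induction rule: seg.induct) auto

lemma seg_opp_closed:
  "seg (opp M) p ts W V Q \<Longrightarrow> d \<in> fst ` set W \<Longrightarrow> opp M d \<in> fst ` set W \<or> opp M d \<in> (opp M \<circ> snd) ` set Q"
proof (induction rule: seg.induct)
  case (Closing p ts W V t Q)
  have "t \<in> fst ` set W" using seg_open_mem[OF Closing.hyps, of "(p, t)"] by force
  show ?case
  proof (cases "d = opp M t")
    case True
    then show ?thesis using \<open>t \<in> fst ` set W\<close> by simp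
  next
    case False
    then have "d \<in> fst ` set W" using Closing.prems by auto
    from Closing.IH[OF this] show ?thesis by (simp, blast)
  qed
next
  case (Subtree p ts W V Q us W' V' Q' d')
  then show ?case by (auto simp: image_iff)
next
  case (Opening p ts W V Q a d')
  then show ?case by (auto simp: image_iff)
qed simp

lemma seg_down_vertex:
  "seg (opp M) p ts W V Q \<Longrightarrow> path M x W y \<Longrightarrow> distinct (map fst W) \<Longrightarrow> (d, Down) \<in> set W \<Longrightarrow>
   head d \<subseteq> fst ` set W \<and> (opp M d, Up) \<in> set W"
proof (induction arbitrary: x y rule: seg.induct)
  case (Subtree p ts W V Q us W' V' Q' d')
  note u = seg_subtree_parts[OF Subtree.hyps(2) Subtree.prems(1,2)]
  note di = u(2-4) and v = u(5,7)
  obtain z where z: "path M x W z" using u(1) by blast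
  consider "(d, Down) \<in> set W" | "d = d'" | "(d, Down) \<in> set W'" using Subtree.prems(3) by auto
  then show ?case
  proof cases
    case 1
    then show ?thesis using Subtree.IH(1)[OF z(1) di(1)] by auto
  next
    case 2
    have "set V' \<subseteq> fst ` set W'" using seg_vertex_darts[OF Subtree.hyps(2)] by force
    then show ?thesis using 2 v by auto
  next
    case 3
    then show ?thesis using Subtree.IH(2)[OF v(2) di(2)] by auto
  qed
next
  case (Opening p ts W V Q a d')
  then show ?case by (fastforce simp: path_append)
next
  case (Closing p ts W V d' Q)
  then show ?case by (fastforce simp: path_append)
qed simp

text \<open>The dart opposite to a \<open>Down\<close> dart is used by an \<open>Up\<close>, while
  the darts in \<open>V\<close> are used by other steps; a dart occurs only once.\<close>

lemma seg_down_vertex_neq: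
  assumes "seg (opp M) p ts W V Q" "path M x W y" "distinct (map fst W)"
    and "(d, Down) \<in> set W" "opp M d \<noteq> z" "vertex_of M z = set (z # V)"
  shows "head d \<noteq> vertex_of M z"
proof
  assume e: "head d = vertex_of M z"
  have u: "(opp M d, Up) \<in> set W" using seg_down_vertex[OF assms(1-4)] by simp
  have "opp M d \<in> set V" using e in_vertex_of_self[of "opp M d"] assms(5,6) by auto
  then obtain l where "l \<noteq> Up" "(opp M d, l) \<in> set W" using seg_vertex_darts[OF assms(1)] by auto
  then show False using u assms(3) eq_key_imp_eq_value by metis
qed

text \<open>The walk predicts each decision of the search: a \<open>Down\<close> dart leads to an
  unvisited vertex, an \<open>Open\<close> dart to a visited one whose depth is the label, and the
  edge of a \<open>Close\<close> dart has been examined. The hypotheses on \<open>Q\<close> concern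
  the chords leaving the walk: their far ends are not in it and lie at vertices of known
  depth.\<close>

lemma explore_seg:
  "seg (opp M) p ts W V Q \<Longrightarrow> path M x W y \<Longrightarrow> finite U \<Longrightarrow>
   distinct (map fst W @ map (opp M \<circ> snd) Q) \<Longrightarrow> fst ` set W \<subseteq> U \<Longrightarrow>
   \<forall>d \<in> set V. depth (vertex_of M d) = Some p \<Longrightarrow>
   \<forall>x \<in> set Q. depth (head (snd x)) = Some (fst x) \<Longrightarrow>
   \<forall>d. (d, Down) \<in> set W \<longrightarrow> depth (head d) = None \<Longrightarrow>
   \<exists>depth'. explore M p V depth U = (ts, depth', U - fst ` set W - opp M ` fst ` set W) \<and>
     (\<forall>v. (\<forall>d. (d, Down) \<in> set W \<longrightarrow> v \<noteq> head d) \<longrightarrow> depth' v = depth v)"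
proof (induction arbitrary: x y U depth rule: seg.induct)
  case (Empty p)
  then show ?case by simp
next
  case (Opening p ts W V Q a d)
  obtain z where z: "path M x W z" using Opening.prems(1) by (auto simp: path_append)
  define U1 where "U1 = U - fst ` set W - opp M ` fst ` set W"
  obtain depth' where IH: "explore M p V depth U = (ts, depth', U1)"
    "\<forall>v. (\<forall>d. (d, Down) \<in> set W \<longrightarrow> v \<noteq> head d) \<longrightarrow> depth' v = depth v"
    using Opening.IH[OF z Opening.prems(2), of depth] Opening.prems(3-) unfolding U1_def by auto
  have "opp M d \<notin> fst ` set W" using Opening.prems(3) by simp
  then have "d \<notin> opp M ` fst ` set W" by (metis imageE opp_opp)
  then have "d \<in> U1" using Opening.prems(3,4) unfolding U1_def by auto
  moreover have "finite U1" using Opening.prems(2) by (simp add: U1_def)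
  moreover have "depth' (head d) = Some a"
    using IH(2) Opening.prems(6,7) by (metis (no_types, lifting) UnCI fst_conv list.set_intros(1) option.distinct(1) set_append snd_conv)
  ultimately have "explore M p [d] depth' U1 = ([Leaf a], depth', U1 - {d, opp M d})"
    by simp
  moreover have "U1 - {d, opp M d} = U - fst ` set (W @ [(d, Open)]) - opp M ` fst ` set (W @ [(d, Open)])"
    unfolding U1_def by auto
  ultimately show ?case using IH by (auto simp: explore_append)
next
  case (Closing p ts W V d Q)
  obtain z where z: "path M x W z" using Closing.prems(1) by (auto simp: path_append)
  define U1 where "U1 = U - fst ` set W - opp M ` fst ` set W"
  \<comment> \<open>For the shorter walk this chord still leaves the walk. Its far end is the dart
    \<open>opp M d\<close> of the present vertex, so its depth is \<open>p\<close>, as its entry on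
    the stack demands.\<close>
  obtain depth' where IH: "explore M p V depth U = (ts, depth', U1)"
    "\<forall>v. (\<forall>d. (d, Down) \<in> set W \<longrightarrow> v \<noteq> head d) \<longrightarrow> depth' v = depth v"
    using Closing.IH[OF z Closing.prems(2), of depth] Closing.prems(3-) unfolding U1_def by auto
  have d: "d \<in> fst ` set W" using seg_open_mem[OF Closing.hyps, of "(p, d)"] by force
  then have "opp M d \<notin> U1" by (auto simp: U1_def)
  then have "explore M p [opp M d] depth' U1 = ([], depth', U1)" by simp
  moreover have "U1 = U - fst ` set (W @ [(opp M d, Close)]) - opp M ` fst ` set (W @ [(opp M d, Close)])"
    unfolding U1_def using d by auto
  ultimately show ?case using IH by (auto simp: explore_append)
next
  case (Subtree p ts W V Q us W' V' Q' d)
  let ?Z = "W @ (d, Down) # W' @ [(opp M d, Up)]"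
  have "distinct (map fst ?Z)" using Subtree.prems(3) by (simp add: Int_Un_distrib)
  note u = seg_subtree_parts[OF Subtree.hyps(2) Subtree.prems(1) this]
  note di = u(2-4) and v = u(5-7)
  obtain z where z: "path M x W z" using u(1) by blast
  define U1 where "U1 = U - fst ` set W - opp M ` fst ` set W"
  obtain depth' where IH1: "explore M p V depth U = (ts, depth', U1)"
    "\<forall>v. (\<forall>d. (d, Down) \<in> set W \<longrightarrow> v \<noteq> head d) \<longrightarrow> depth' v = depth v"
  proof -
    have a: "distinct (map fst W @ map (opp M \<circ> snd) Q)" "fst ` set W \<subseteq> U"
      using Subtree.prems(3,4) by (auto simp: comp_def)
    have b: "\<forall>d \<in> set V. depth (vertex_of M d) = Some p"
      "\<forall>x \<in> set Q. depth (head (snd x)) = Some (fst x)"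
      "\<forall>d. (d, Down) \<in> set W \<longrightarrow> depth (head d) = None"
      using Subtree.prems(5-7) by simp_all
    from Subtree.IH(1)[OF z(1) Subtree.prems(2) a b] show ?thesis
      unfolding U1_def[symmetric] by (elim exE conjE) (rule that)
  qed
  have oW: "opp M w \<in> fst ` set W \<or> opp M w \<in> (opp M \<circ> snd) ` set Q" if "w \<in> fst ` set W" for w
    using seg_opp_closed[OF Subtree.hyps(1) that] .
  have disj: "w \<notin> opp M ` fst ` set W" if "w = d \<or> w \<in> fst ` set W'" for w
  proof
    assume "w \<in> opp M ` fst ` set W"
    then have "w \<in> fst ` set W \<or> w \<in> (opp M \<circ> snd) ` set Q" using oW by blast
    moreover have "set (map fst ((d, Down) # W')) \<inter> (fst ` set W \<union> (opp M \<circ> snd) ` set Q) = {}"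
      using Subtree.prems(3) by (simp add: comp_def) blast
    moreover have "w \<in> set (map fst ((d, Down) # W'))" using that by auto
    ultimately show False by blast
  qed
  have dU1: "d \<in> U1" using Subtree.prems(3,4) disj[of d] unfolding U1_def by auto
  have fU1: "finite U1" using Subtree.prems(2) by (simp add: U1_def)
  define U2 where "U2 = U1 - {d, opp M d}"
  have W'U2: "fst ` set W' \<subseteq> U2"
  proof
    fix w assume w: "w \<in> fst ` set W'"
    have "fst ` set W' \<subseteq> U" using Subtree.prems(4) by (simp add: image_Un)
    moreover have "fst ` set W \<inter> fst ` set W' = {}" "d \<notin> fst ` set W'"
      using Subtree.prems(3) by (simp_all, blast)
    ultimately have "w \<in> U" "w \<notin> fst ` set W" "w \<noteq> d" "w \<noteq> opp M d"
      using w di(3) by blast+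
    then show "w \<in> U2" using disj[of w] w unfolding U2_def U1_def by auto
  qed
  have Wv: "head d3 \<subseteq> fst ` set W" if "(d3, Down) \<in> set W" for d3
    using seg_down_vertex[OF Subtree.hyps(1) z(1) di(1) that] by simp
  have notW: "vertex_of M w \<noteq> head d3"
    if "(d3, Down) \<in> set W" "w = opp M d \<or> w \<in> fst ` set W'" for d3 w
  proof
    assume "vertex_of M w = head d3"
    then have "w \<in> fst ` set W" using Wv[OF that(1)] in_vertex_of_self[of w] by auto
    moreover have "w \<in> set (map fst (W' @ [(opp M d, Up)]))" using that(2) by auto
    moreover have "set (map fst W) \<inter> set (map fst (W' @ [(opp M d, Up)])) = {}"
      using Subtree.prems(3) by (simp add: Int_Un_distrib)
    ultimately show False unfolding set_map by blast
  qed
  have None: "depth (head d) = None" using Subtree.prems(7) by simp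
  then have None': "depth' (head d) = None" using IH1(2) notW[of _ "opp M d"] by auto
  define depth2 where "depth2 = depth'(head d \<mapsto> p + 1)"
  have "\<forall>d' \<in> set V'. depth2 (vertex_of M d') = Some (p + 1)"
  proof
    fix d' assume "d' \<in> set V'"
    then have "vertex_of M d' = head d" using v(1) vertex_of_eq[of d' "opp M d"] by simp
    then show "depth2 (vertex_of M d') = Some (p + 1)" by (simp add: depth2_def)
  qed
  moreover have "\<forall>x \<in> set Q'. depth2 (head (snd x)) = Some (fst x)"
  proof
    fix x assume "x \<in> set Q'"
    then have s: "depth (head (snd x)) = Some (fst x)" using Subtree.prems(6) by simp
    then have "head (snd x) \<noteq> head d" using None by auto
    moreover have "depth' (head (snd x)) = Some (fst x)"
      using IH1(2) s Subtree.prems(7) by (metis UnCI option.distinct(1) set_append)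
    ultimately show "depth2 (head (snd x)) = Some (fst x)" by (simp add: depth2_def)
  qed
  moreover have "\<forall>d2. (d2, Down) \<in> set W' \<longrightarrow> depth2 (head d2) = None"
  proof (intro allI impI)
    fix d2 assume d2: "(d2, Down) \<in> set W'"
    have u: "opp M d2 \<in> fst ` set W'" using seg_down_vertex[OF Subtree.hyps(2) v(3) di(2) d2] by force
    then have "opp M d2 \<noteq> opp M d" using di(3) by metis
    then have "head d2 \<noteq> head d"
      using seg_down_vertex_neq[OF Subtree.hyps(2) v(3) di(2) d2 _ v(1)] by simp
    moreover have "depth (head d2) = None" using Subtree.prems(7) d2 by simp
    then have "depth' (head d2) = None" using IH1(2) notW[of _ "opp M d2"] u by auto
    ultimately show "depth2 (head d2) = None" by (simp add: depth2_def)
  qed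
  moreover have "finite U2" using fU1 by (simp add: U2_def)
  moreover have "distinct (map fst W' @ map (opp M \<circ> snd) Q')"
    using Subtree.prems(3) by (auto simp: comp_def)
  ultimately obtain depth3 where IH2:
    "explore M (p + 1) V' depth2 U2 = (us, depth3, U2 - fst ` set W' - opp M ` fst ` set W')"
    "\<forall>v. (\<forall>d. (d, Down) \<in> set W' \<longrightarrow> v \<noteq> head d) \<longrightarrow> depth3 v = depth2 v"
    using Subtree.IH(2)[OF v(3), of U2 depth2] W'U2 by blast
  have "explore M p [d] depth' U1 =
      ([Node (rev us)], depth3, U2 - fst ` set W' - opp M ` fst ` set W')"
    using dU1 fU1 None' v(2) IH2(1) by (simp add: depth2_def[symmetric] U2_def[symmetric])
  moreover have "U2 - fst ` set W' - opp M ` fst ` set W' = U - fst ` set ?Z - opp M ` fst ` set ?Z"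
    unfolding U2_def U1_def by auto
  moreover have "depth3 v = depth v"
    if "\<forall>d. (d, Down) \<in> set ?Z \<longrightarrow> v \<noteq> head d" for v
  proof -
    have "depth3 v = depth2 v" using IH2(2) that by auto
    also have "\<dots> = depth' v" using that by (simp add: depth2_def)
    also have "\<dots> = depth v" using IH1(2) that by auto
    finally show ?thesis .
  qed
  ultimately show ?case using IH1(1) by (auto simp: explore_append)
qed

lemma closings_chain:
  "path M x (map (\<lambda>x. (f x, Close)) Q) y \<Longrightarrow>
   map f Q = map (\<lambda>i. (cw M ^^ i) x) [0..<length (map f Q)] \<and> y = (cw M ^^ length (map f Q)) x"
proof (induction Q arbitrary: y rule: rev_induct)
  case (snoc q Q)
  then show ?case by (auto simp: path_append)
qed simp

lemma tour_root_vertex: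
  assumes t: "tour M W" and W: "W = (e, Down) # W' @ (opp M e, Up) # map (\<lambda>x. (opp M (snd x), Close)) Q"
  shows "e = root_dart M" "vertex_of M e = set (e # map (\<lambda>x. opp M (snd x)) Q)"
    "path M e ((e, Down) # W' @ [(opp M e, Up)]) (cw M e)"
proof -
  have p: "path M (root_dart M) W (root_dart M)" using t by (simp add: tour_def)
  then show e: "e = root_dart M" by (simp add: W)
  from p have "path M (cw M e) (map (\<lambda>x. (opp M (snd x), Close)) Q) e"
    by (auto simp: W path_append)
  note c = closings_chain[OF this]
  have "distinct (e # map (\<lambda>x. opp M (snd x)) Q)"
    using t by (simp add: tour_def W comp_def)
  from vertex_of_cycle(1)[OF _ _ this] c show "vertex_of M e = set (e # map (\<lambda>x. opp M (snd x)) Q)"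
    by metis
  show "path M e ((e, Down) # W' @ [(opp M e, Up)]) (cw M e)"
    using p by (auto simp: W path_append)
qed

lemma tour_parts:
  assumes t: "tour M W" and T: "tree_tour (opp M) W T"
  obtains e us W' V Q where "T = Node (rev us)" "seg (opp M) 0 us W' V Q" "\<forall>x \<in> set Q. fst x = -1"
    "e = root_dart M" "vertex_of M e = set (e # map (\<lambda>x. opp M (snd x)) Q)"
    "head e = set (opp M e # V)" "darts_after M (opp M e) = V"
    "path M (cw M (opp M e)) W' (opp M e)"
    "distinct (e # map fst W' @ opp M e # map (\<lambda>x. opp M (snd x)) Q)"
    "darts M = set (e # map fst W' @ opp M e # map (\<lambda>x. opp M (snd x)) Q)"
    "\<forall>d. (d, Down) \<in> set W' \<longrightarrow>
       opp M d \<in> fst ` set W' \<and> head d \<noteq> head e"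
proof -
  obtain e us W' V Q where us: "T = Node (rev us)" and s: "seg (opp M) 0 us W' V Q"
    and l: "\<forall>x \<in> set Q. fst x = -1"
    and W: "W = (e, Down) # W' @ (opp M e, Up) # map (\<lambda>x. (opp M (snd x), Close)) Q"
    using tree_tour_seg[OF T] by metis
  note r = tour_root_vertex[OF t W]
  have di: "distinct (e # map fst W' @ opp M e # map (\<lambda>x. opp M (snd x)) Q)"
    using t by (auto simp: tour_def W comp_def)
  have "darts M = fst ` set W" using t by (simp add: tour_def)
  then have D: "darts M = set (e # map fst W' @ opp M e # map (\<lambda>x. opp M (snd x)) Q)"
    by (simp add: W image_Un image_image)
  have di': "distinct (map fst ([] @ (e, Down) # W' @ [(opp M e, Up)]))" using di by auto
  \<comment> \<open>The root edge is handled as a tree edge entered from depth -1.\<close>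
  have s': "seg (opp M) (-1 + 1) us W' V Q" using s by simp
  have "path M e ([] @ (e, Down) # W' @ [(opp M e, Up)]) (cw M e)" using r(3) by simp
  note u = seg_subtree_parts[OF s' this di']
  have "opp M d \<in> fst ` set W' \<and> head d \<noteq> head e" if d: "(d, Down) \<in> set W'" for d
  proof -
    have m: "opp M d \<in> fst ` set W'" using seg_down_vertex[OF s u(7,3) d] by force
    then have "opp M d \<noteq> opp M e" using u(4) by metis
    from seg_down_vertex_neq[OF s u(7,3) d this u(5)] show ?thesis using m by simp
  qed
  then show thesis using that[OF us s l r(1,2) u(5-7) di D] by simp
qed

theorem tree_of_map_eq:
  assumes t: "tour M W" and T: "tree_tour (opp M) W T"
  shows "tree_of_map M = T"
proof -
  obtain e us W' V Q where us: "T = Node (rev us)" and s: "seg (opp M) 0 us W' V Q"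
    and l: "\<forall>x \<in> set Q. fst x = -1" and e: "e = root_dart M"
    and ve: "vertex_of M e = set (e # map (\<lambda>x. opp M (snd x)) Q)"
    and v: "head e = set (opp M e # V)" "darts_after M (opp M e) = V"
      "path M (cw M (opp M e)) W' (opp M e)"
    and di: "distinct (e # map fst W' @ opp M e # map (\<lambda>x. opp M (snd x)) Q)"
    and D: "darts M = set (e # map fst W' @ opp M e # map (\<lambda>x. opp M (snd x)) Q)"
    and down: "\<forall>d. (d, Down) \<in> set W' \<longrightarrow>
       opp M d \<in> fst ` set W' \<and> head d \<noteq> head e"
    by (rule tour_parts[OF t T]) (rule that; assumption)
  have ne: "head e \<noteq> vertex_of M e"
    using in_vertex_of_self[of "opp M e"] di unfolding ve by auto
  define depth where "depth = [vertex_of M e \<mapsto> -1, head e \<mapsto> (0::int)]"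
  have "\<forall>d \<in> set V. depth (vertex_of M d) = Some 0"
    using v(1) vertex_of_eq[of _ "opp M e"] by (auto simp: depth_def)
  moreover have "\<forall>x \<in> set Q. depth (head (snd x)) = Some (fst x)"
  proof
    fix x assume x: "x \<in> set Q"
    then have "head (snd x) = vertex_of M e"
      using ve vertex_of_eq[of "opp M (snd x)" e] by auto
    then show "depth (head (snd x)) = Some (fst x)"
      using ne l x by (simp add: depth_def)
  qed
  moreover have "\<forall>d. (d, Down) \<in> set W' \<longrightarrow> depth (head d) = None"
  proof (intro allI impI)
    fix d assume d: "(d, Down) \<in> set W'"
    have "opp M d \<notin> set (e # map (\<lambda>x. opp M (snd x)) Q)" using down[rule_format, OF d] di by (simp, blast)
    then have "head d \<noteq> vertex_of M e"
      using in_vertex_of_self[of "opp M d"] unfolding ve by metis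
    then show "depth (head d) = None" using down[rule_format, OF d] by (simp add: depth_def)
  qed
  moreover have "distinct (map fst W' @ map (opp M \<circ> snd) Q)" using di by (auto simp: comp_def)
  moreover have "fst ` set W' \<subseteq> darts M - {e, opp M e}"
    using di unfolding D by (simp add: subset_iff)
  moreover have "finite (darts M - {e, opp M e})" using finite_darts by simp
  ultimately obtain depth' U' where
    "explore M 0 V depth (darts M - {e, opp M e}) = (us, depth', U')"
    using explore_seg[OF s v(3), of "darts M - {e, opp M e}" depth] by blast
  then show ?thesis
    unfolding tree_of_map_def Let_def e[symmetric] v(2) us by (simp add: depth_def)
qed

end

section \<open>Maps with a tree tour are non-separable\<close>

context dart_map
begin

text \<open>No vertex entered below is \<open>v\<close>, so each tree edge passes its colour on to
  all darts of the vertex that it enters.\<close>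

lemma seg_monochromatic_avoiding:
  assumes col_opp: "\<And>d. col (opp M d) = (col d :: bool)"
    and mono: "\<And>d d'. vertex_of M d \<noteq> v \<Longrightarrow> d' \<in> vertex_of M d \<Longrightarrow> col d' = col d"
  shows "seg (opp M) p ts W V Q \<Longrightarrow> path M x W y \<Longrightarrow> distinct (map fst W) \<Longrightarrow>
    \<forall>d. (d, Down) \<in> set W \<longrightarrow> head d \<noteq> v \<Longrightarrow> \<forall>d \<in> set V. col d = c \<Longrightarrow>
    \<forall>d \<in> fst ` set W. col d = c"
proof (induction arbitrary: x y rule: seg.induct)
  case (Opening p ts W V Q a d)
  then show ?case by (auto simp: path_append)
next
  case (Closing p ts W V d Q)
  then show ?case by (auto simp: path_append)
next
  case (Subtree p ts W V Q us W' V' Q' d)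
  note u = seg_subtree_parts[OF Subtree.hyps(2) Subtree.prems(1,2)]
  note di = u(2-4) and v = u(5,7)
  obtain z where z: "path M x W z" using u(1) by blast
  have d: "col d = c" using Subtree.prems(4) by simp
  have "head d \<noteq> v" using Subtree.prems(3) by simp
  then have "\<forall>d' \<in> set V'. col d' = c" using mono[of "opp M d"] v(1) d col_opp by auto
  then have "\<forall>d \<in> fst ` set W'. col d = c"
    using Subtree.IH(2)[OF v(2) di(2)] Subtree.prems(3) by auto
  moreover have "\<forall>d \<in> fst ` set W. col d = c"
    using Subtree.IH(1)[OF z(1) di(1)] Subtree.prems(3,4) by auto
  ultimately show ?case using d col_opp by auto
qed simp

text \<open>
  At the special vertex itself the colour comes in through the leaves labeled less than its depth,
  of which every subtree has one.
\<close>

lemma seg_monochromatic_at: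
  assumes col_opp: "\<And>d. col (opp M d) = (col d :: bool)"
    and mono: "\<And>d d'. vertex_of M d \<noteq> v \<Longrightarrow> d' \<in> vertex_of M d \<Longrightarrow> col d' = col d"
  shows "seg (opp M) p ts W V Q \<Longrightarrow> path M x W y \<Longrightarrow> distinct (map fst W) \<Longrightarrow>
    \<forall>d. (d, Down) \<in> set W \<longrightarrow> head d \<noteq> v \<Longrightarrow>
    \<forall>x \<in> set Q. fst x < p \<longrightarrow> col (snd x) = c \<Longrightarrow> \<forall>d \<in> fst ` set W. col d = c"
proof (induction arbitrary: x y rule: seg.induct)
  case (Opening p ts W V Q a d)
  then show ?case by (auto simp: path_append)
next
  case (Closing p ts W V d Q)
  obtain z where z: "path M x W z" using Closing.prems(1) by (auto simp: path_append)
  have "\<forall>d \<in> fst ` set W. col d = c"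
    using Closing.IH[OF z] Closing.prems(2-) by auto
  moreover have "d \<in> fst ` set W" using seg_open_mem[OF Closing.hyps, of "(p, d)"] by force
  ultimately show ?case using col_opp by auto
next
  case (Subtree p ts W V Q us W' V' Q' d)
  note u = seg_subtree_parts[OF Subtree.hyps(2) Subtree.prems(1,2)]
  note di = u(2-4) and v = u(5,7)
  obtain z where z: "path M x W z" using u(1) by blast
  have "head d \<noteq> v" using Subtree.prems(3) by simp
  then have "\<forall>d' \<in> set V'. col d' = col d" using mono[of "opp M d"] v(1) col_opp by auto
  moreover have "\<forall>d'. (d', Down) \<in> set W' \<longrightarrow> head d' \<noteq> v"
    using Subtree.prems(3) by simp
  ultimately have W': "\<forall>d' \<in> fst ` set W'. col d' = col d"
    using seg_monochromatic_avoiding[where col = col and v = v, OF col_opp mono Subtree.hyps(2) v(2) di(2)]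
    by metis
  obtain t where t: "t \<in> set Q'" "fst t < p" using Subtree.hyps(4) by auto
  have "snd t \<in> fst ` set W'" using seg_open_mem[OF Subtree.hyps(2) t(1)] by force
  moreover have "col (snd t) = c" using Subtree.prems(4) t by simp
  ultimately have d: "col d = c" using W' by blast
  moreover have "\<forall>d \<in> fst ` set W. col d = c"
    using Subtree.IH(1)[OF z(1) di(1)] Subtree.prems(3,4) by simp
  ultimately show ?case using W' col_opp by auto
qed simp

text \<open>The exceptional vertex may now be entered, and this happens at most once. Its tree edge
  then says nothing about its other darts; the colour is recovered from the chords leaving its
  subtree.\<close>

lemma seg_monochromatic:
  assumes col_opp: "\<And>d. col (opp M d) = (col d :: bool)"
    and mono: "\<And>d d'. vertex_of M d \<noteq> v \<Longrightarrow> d' \<in> vertex_of M d \<Longrightarrow> col d' = col d"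
  shows "seg (opp M) p ts W V Q \<Longrightarrow> path M x W y \<Longrightarrow> distinct (map fst W) \<Longrightarrow>
    \<forall>d \<in> set V. col d = c \<Longrightarrow> \<forall>x \<in> set Q. col (snd x) = c \<Longrightarrow> \<forall>d \<in> fst ` set W. col d = c"
proof (induction arbitrary: x y rule: seg.induct)
  case (Opening p ts W V Q a d)
  then show ?case by (auto simp: path_append)
next
  case (Closing p ts W V d Q)
  have "col d = c" using Closing.prems(3) col_opp by simp
  moreover obtain z where z: "path M x W z" using Closing.prems(1) by (auto simp: path_append)
  ultimately have "\<forall>d \<in> fst ` set W. col d = c"
    using Closing.IH[OF z] Closing.prems(2-) by simp
  then show ?case using Closing.prems(3) by auto
next
  case (Subtree p ts W V Q us W' V' Q' d)
  note u = seg_subtree_parts[OF Subtree.hyps(2) Subtree.prems(1,2)]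
  note di = u(2-4) and w = u(5,7)
  obtain z where z: "path M x W z" using u(1) by blast
  have d: "col d = c" using Subtree.prems(3) by simp
  have "\<forall>d \<in> fst ` set W'. col d = c"
  proof (cases "head d = v")
    case False
    then have "\<forall>d' \<in> set V'. col d' = c" using mono[of "opp M d"] w(1) d col_opp by auto
    then show ?thesis using Subtree.IH(2)[OF w(2) di(2)] Subtree.prems(4) by simp
  next
    case True
    have "\<forall>d'. (d', Down) \<in> set W' \<longrightarrow> head d' \<noteq> v"
    proof (intro allI impI)
      fix d' assume d': "(d', Down) \<in> set W'"
      have "opp M d' \<in> fst ` set W'"
        using seg_down_vertex[OF Subtree.hyps(2) w(2) di(2) d'] by force
      then have "opp M d' \<noteq> opp M d" using di(3) by metis
      from seg_down_vertex_neq[OF Subtree.hyps(2) w(2) di(2) d' this w(1)]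
      show "head d' \<noteq> v" unfolding True .
    qed
    then show ?thesis
      using seg_monochromatic_at[where col = col and v = v, OF col_opp mono Subtree.hyps(2) w(2) di(2)] Subtree.prems(4) by simp
  qed
  moreover have "\<forall>d \<in> fst ` set W. col d = c"
    using Subtree.IH(1)[OF z(1) di(1)] Subtree.prems(3,4) by simp
  ultimately show ?case using d col_opp by auto
qed simp

text \<open>Colour each edge by its side of a supposed separation. Every vertex but one is
  monochromatic, and the tour then has a single colour. The cases are whether the exceptional vertex
  is the origin of the root, its head, or neither.\<close>

theorem tour_not_separable:
  assumes t: "tour M W" and T: "tree_tour (opp M) W T"
  shows "\<not> separable M"
proof
  assume "separable M"
  then obtain A B v where AB: "A \<union> B = edges M" "A \<inter> B = {}" "A \<noteq> {}" "B \<noteq> {}"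
    and v: "\<And>u. u \<in> vertices M \<Longrightarrow> (\<exists>e \<in> A. incident u e) \<Longrightarrow> (\<exists>e \<in> B. incident u e) \<Longrightarrow> u = v"
    unfolding separable_def by metis
  define col where "col d \<longleftrightarrow> {d, opp M d} \<in> A" for d
  have col_opp: "col (opp M d) = col d" for d by (simp add: col_def insert_commute)
  have mono: "col d' = col d" if a: "vertex_of M d \<noteq> v" "d' \<in> vertex_of M d" for d d'
  proof (cases "d \<in> darts M")
    case False
    then have "cw M d = d" using cw_permutes by (simp add: permutes_not_in)
    then have "vertex_of M d = {d}" by (simp add: vertex_of_def orbit_eq_singleton_iff)
    then show ?thesis using a by simp
  next
    case True
    then have "d' \<in> darts M" using vertex_of_subset a by auto
    have E: "{x, opp M x} \<in> A \<union> B" if "x \<in> darts M" for x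
      unfolding AB(1) edges_def using that by auto
    have i: "incident (vertex_of M d) {x, opp M x}" if "x \<in> vertex_of M d" for x
      using that by (auto simp: incident_def)
    have u: "vertex_of M d \<in> vertices M" using True by (simp add: vertices_def)
    show ?thesis
      using v[OF u] a E[OF True] E[OF \<open>d' \<in> darts M\<close>] i[OF a(2)] i[OF in_vertex_of_self[of d]]
      unfolding col_def by blast
  qed
  obtain e us W' V Q where s: "seg (opp M) 0 us W' V Q"
    and ve: "vertex_of M e = set (e # map (\<lambda>x. opp M (snd x)) Q)"
    and w: "head e = set (opp M e # V)" "path M (cw M (opp M e)) W' (opp M e)"
    and di: "distinct (e # map fst W' @ opp M e # map (\<lambda>x. opp M (snd x)) Q)"
    and D: "darts M = set (e # map fst W' @ opp M e # map (\<lambda>x. opp M (snd x)) Q)"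
    and down: "\<forall>d. (d, Down) \<in> set W' \<longrightarrow>
       opp M d \<in> fst ` set W' \<and> head d \<noteq> head e"
    by (rule tour_parts[OF t T]) (rule that; assumption)
  have di': "distinct (map fst W')" using di by simp
  have W'c: "\<forall>d \<in> fst ` set W'. col d = col e"
  proof (cases "vertex_of M e = v")
    case True
    have "opp M e \<notin> set (e # map (\<lambda>x. opp M (snd x)) Q)" using di by auto
    then have "head e \<noteq> v" using True ve in_vertex_of_self[of "opp M e"] by metis
    then have "\<forall>d \<in> set V. col d = col e" using mono[of "opp M e"] w(1) col_opp by auto
    moreover have "head d \<noteq> v" if d: "(d, Down) \<in> set W'" for d
    proof -
      have "opp M d \<in> fst ` set W'" using down[rule_format, OF d] by simp
      moreover have "fst ` set W' \<inter> set (e # map (\<lambda>x. opp M (snd x)) Q) = {}"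
        using di by (simp add: Int_Un_distrib)
      ultimately show ?thesis using True ve in_vertex_of_self[of "opp M d"] by blast
    qed
    ultimately show ?thesis using seg_monochromatic_avoiding[where col = col and v = v, OF col_opp mono s w(2) di'] by blast
  next
    case False
    have Q: "\<forall>x \<in> set Q. col (snd x) = col e"
    proof
      fix x assume "x \<in> set Q"
      then have "col (opp M (snd x)) = col e" using mono[OF False, of "opp M (snd x)"] ve by auto
      then show "col (snd x) = col e" using col_opp by simp
    qed
    show ?thesis
    proof (cases "head e = v")
      case True
      then show ?thesis
        using seg_monochromatic_at[where col = col and v = v, OF col_opp mono s w(2) di'] Q down by blast
    next
      case False
      then have "\<forall>d \<in> set V. col d = col e" using mono[of "opp M e"] w(1) col_opp by auto
      then show ?thesis using seg_monochromatic[where col = col and v = v, OF col_opp mono s w(2) di'] Q by blast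
    qed
  qed
  have all: "col d = col e" if "d \<in> darts M" for d
  proof -
    have "snd x \<in> fst ` set W'" if "x \<in> set Q" for x using seg_open_mem[OF s that] by force
    then have "\<forall>x \<in> set Q. col (snd x) = col e" using W'c by blast
    then show ?thesis using that W'c col_opp unfolding D by auto
  qed
  have "edges M \<subseteq> A \<or> edges M \<inter> A = {}"
  proof (cases "col e")
    case True
    then have "edges M \<subseteq> A" using all unfolding col_def edges_def by blast
    then show ?thesis ..
  next
    case False
    then have "edges M \<inter> A = {}" using all unfolding col_def edges_def by blast
    then show ?thesis ..
  qed
  then show False using AB by blast
qed

end

section \<open>The tour of the dual map\<close>

lemma runs_Open_Close_paired:
  "runs op Open Close W S S' \<Longrightarrow> (d, Open) \<in> set W \<Longrightarrow> d \<in> set S' \<or> (op d, Close) \<in> set W"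
  "runs op Open Close W S S' \<Longrightarrow> d \<in> set S \<Longrightarrow> d \<in> set S' \<or> (op d, Close) \<in> set W"
  "runs op Open Close W S S' \<Longrightarrow> (d, Close) \<in> set W \<Longrightarrow>
     \<exists>t. op t = d \<and> (t \<in> set S \<or> (t, Open) \<in> set W)"
proof (induction W arbitrary: S)
  case (Cons x W)
  obtain d' l where x: "x = (d', l)" by (cases x)
  {
    case 1
    then show ?case using Cons.IH(1,2) unfolding x by (cases l) fastforce+
  next
    case 2
    then show ?case using Cons.IH(2) unfolding x by (cases l) fastforce+
  next
    case 3
    then show ?case using Cons.IH(3) unfolding x by (cases l) fastforce+
  }
qed auto

context dart_map
begin

text \<open>The first equation drives the reversal of walks. The third shows that reversal also
  gives the correct root: a mirrored closed walk starts at the image of the old root under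
  \<open>cw (dual M)\<close>.\<close>

lemma cw_dual_simps:
  "cw (dual M) (cw M d) = opp M d" "cw (dual M) d = opp M (inv (cw M) d)"
  "root_dart (dual M) = cw (dual M) (root_dart M)" "opp (dual M) = opp M" "darts (dual M) = darts M"
proof -
  have b: "bij (cw M)" "bij (opp M)"
    using cw_permutes opp_permutes permutes_bij by auto
  have "inv (opp M) = opp M" by (intro inv_unique_comp) auto
  then have i: "inv (cw M \<circ> opp M) = opp M \<circ> inv (cw M)" using b by (simp add: o_inv_distrib)
  then show "cw (dual M) d = opp M (inv (cw M) d)" by (simp add: dual_def)
  have "inv (cw M) (cw M d) = d" using b(1) by (simp add: bij_is_inj)
  then show "cw (dual M) (cw M d) = opp M d" by (simp add: dual_def i)
  show "root_dart (dual M) = cw (dual M) (root_dart M)" by (simp add: dual_def i)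
qed (simp_all add: dual_def)

lemma path_mirror:
  "path M x Z y \<Longrightarrow> path (dual M) (cw (dual M) y) (mirror (opp M) Z) (cw (dual M) x)"
proof (induction Z arbitrary: x)
  case (Cons z Z)
  obtain d l where z: "z = (d, l)" by (cases z)
  have "path (dual M) (cw (dual M) y) (mirror (opp M) Z) (cw (dual M) (next_dart M z))"
    using Cons by simp
  moreover have "x = d" using Cons(2) z by simp
  ultimately show ?case unfolding z
    by (cases l) (auto simp: mirror_Cons path_append cw_dual_simps(1,4))
qed simp

text \<open>What needs proof is that each dart is again used once. Tree darts are kept and chord
  darts replaced by their opposites; the pairing of \<open>Open\<close> with \<open>Close\<close>
  shows that the opposite of a chord dart is again a chord dart.\<close>

lemma tour_mirror:
  assumes t: "tour M W" and T: "tree_tour (opp M) W T"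
  shows "tour (dual M) (mirror (opp M) W)"
proof -
  define Y where "Y = (\<lambda>x. if snd x = Down \<or> snd x = Up then fst x else opp M (fst x))"
  have mY: "map fst (mirror (opp M) W) = rev (map Y W)"
    by (simp add: mirror_def Y_def rev_map comp_def case_prod_beta cong: if_cong)
  have r: "runs (opp M) Open Close W [] []" using T by (simp add: tree_tour_def)
  have dW: "distinct (map fst W)" and D: "fst ` set W = darts M" using t by (auto simp: tour_def)
  have step_unique: "l = l'" if "(d, l) \<in> set W" "(d, l') \<in> set W" for d l l'
    using eq_key_imp_eq_value[OF dW that] .
  have chord: "\<exists>l'. l' \<noteq> Down \<and> l' \<noteq> Up \<and> (opp M d, l') \<in> set W"
    if "(d, l) \<in> set W" "l \<noteq> Down" "l \<noteq> Up" for d l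
  proof (cases l)
    case Open
    then show ?thesis using runs_Open_Close_paired(1)[OF r, of d] that by force
  next
    case Close
    then have "(d, Close) \<in> set W" using that by simp
    from runs_Open_Close_paired(3)[OF r this]
    obtain t where "opp M t = d" "(t, Open) \<in> set W" by auto
    then show ?thesis by force
  qed (use that in auto)
  have "inj_on Y (set W)"
  proof (rule inj_onI)
    fix x x' assume x: "x \<in> set W" "x' \<in> set W" "Y x = Y x'"
    obtain d l d' l' where e: "x = (d, l)" "x' = (d', l')" by (cases x, cases x')
    define tr where "tr k \<longleftrightarrow> k = Down \<or> k = Up" for k
    have "tr l \<longleftrightarrow> tr l'"
    proof (rule ccontr)
      assume "tr l \<noteq> tr l'"
      then consider "tr l" "\<not> tr l'" "d = opp M d'" | "\<not> tr l" "tr l'" "d' = opp M d"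
        using x(3) unfolding e Y_def tr_def by (auto split: if_splits)
      then show False
      proof cases
        case 1
        then show False using chord[of d' l'] x(1,2) step_unique unfolding e tr_def by metis
      next
        case 2
        then show False using chord[of d l] x(1,2) step_unique unfolding e tr_def by metis
      qed
    qed
    then have "d = d'" using x(3) unfolding e Y_def tr_def by (auto split: if_splits)
    then show "x = x'" using x(1,2) step_unique unfolding e by auto
  qed
  moreover have "distinct W" using dW by (simp add: distinct_map)
  ultimately have dY: "distinct (map Y W)" by (simp add: distinct_map)
  have "Y ` set W \<subseteq> darts M" unfolding D[symmetric]
    by (metis (mono_tags, lifting) D Y_def image_subsetI image_eqI opp_in_iff)
  moreover have "card (Y ` set W) = card (darts M)"
    using distinct_card[OF dY] distinct_card[OF dW] D by simp
  ultimately have "Y ` set W = darts M" using card_subset_eq[OF finite_darts] by blast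
  then have "fst ` set (mirror (opp M) W) = darts M"
    using arg_cong[OF mY, of set] by simp
  moreover have "path (dual M) (root_dart (dual M)) (mirror (opp M) W) (root_dart (dual M))"
    using t path_mirror unfolding cw_dual_simps(3) by (simp add: tour_def)
  ultimately show ?thesis using dY mY by (simp add: tour_def cw_dual_simps(5))
qed

section \<open>The dual as a planar map\<close>

lemma permutes_cw_opp: "(cw M \<circ> opp M) permutes darts M"
  using cw_permutes opp_permutes by (simp add: permutes_compose)

lemma vertex_of_dual: "vertex_of (dual M) d = left_face_of M d"
proof -
  have "permutation (cw M \<circ> opp M)"
    using permutes_cw_opp finite_darts permutation_permutes by blast
  from orbit_inv_eq[OF this, of d] show ?thesis
    by (simp add: vertex_of_def left_face_of_def dual_def)
qed

lemma left_face_of_dual: "left_face_of (dual M) (opp M d) = opp M ` vertex_of M d"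
proof -
  have "opp M ` orbit (inv (cw M)) d = orbit (cw (dual M) \<circ> opp (dual M)) (opp M d)"
  proof (rule orbit_inverse)
    show "d \<in> orbit (inv (cw M)) d"
      unfolding orbit_inv_eq[OF permutation_cw] by (rule permutation_self_in_orbit[OF permutation_cw])
  qed (simp add: cw_dual_simps(2,4))
  then show ?thesis
    by (simp add: vertex_of_def left_face_of_def orbit_inv_eq[OF permutation_cw])
qed

lemma connected_dual: "connected_map (dual M)"
proof -
  define R where "R = {(a, b). a \<in> darts (dual M) \<and> (b = opp (dual M) a \<or> b = cw (dual M) a)}"
  have "(x, y) \<in> R\<^sup>*" if "x \<in> darts M" "y \<in> darts M" for x y
  proof -
    define X where "X = {y. (x, y) \<in> R\<^sup>*}"
    have Xs: "X \<subseteq> darts M"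
    proof
      fix y assume "y \<in> X"
      then have "(x, y) \<in> R\<^sup>*" by (simp add: X_def)
      then show "y \<in> darts M"
      proof (induction rule: rtrancl_induct)
        case (step y z)
        have "inv (cw M) y \<in> darts M"
          using step(3) permutes_in_image[OF permutes_inv[OF cw_permutes]] by blast
        then show ?case using step by (auto simp: R_def cw_dual_simps(2,4))
      qed (use that in simp)
    qed
    have o: "opp M d \<in> X" if "d \<in> X" for d
      using that Xs unfolding X_def R_def by (auto simp: cw_dual_simps(4,5) intro: rtrancl_into_rtrancl)
    have c: "cw (dual M) d \<in> X" if "d \<in> X" for d
      using that Xs unfolding X_def R_def by (auto simp: cw_dual_simps(4,5) intro: rtrancl_into_rtrancl)
    have "cw M d \<in> X" if "d \<in> X" for d
    proof -
      have od: "opp M d \<in> X" using o that .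
      have "orbit (cw (dual M)) (opp M d) \<subseteq> X"
      proof
        fix z assume "z \<in> orbit (cw (dual M)) (opp M d)"
        then show "z \<in> X" by induction (use od c in auto)
      qed
      \<comment> \<open>One step of the face permutation leads from \<open>opp M d\<close> to
        \<open>cw M d\<close>. This permutation is the inverse of the dual rotation and has the same
        orbits, so the dual rotation also reaches \<open>cw M d\<close>.\<close>
      moreover have "cw M d \<in> left_face_of M (opp M d)"
        unfolding left_face_of_def by (rule orbit_eqI(1)) simp
      ultimately show ?thesis unfolding vertex_of_dual[symmetric] vertex_of_def by blast
    qed
    moreover have "x \<in> X" by (simp add: X_def)
    ultimately have "X = darts M" using connected_closed[OF Xs] o by blast
    then show ?thesis using that by (auto simp: X_def)
  qed
  then show ?thesis unfolding connected_map_def R_def by (simp add: cw_dual_simps(5))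
qed

lemma planar_dual:
  assumes "planar_map M"
  shows "planar_map (dual M)"
proof -
  have v: "vertices (dual M) = faces M"
    by (simp add: vertices_def faces_def vertex_of_dual cw_dual_simps(5))
  have "opp M ` darts M = darts M" using permutes_image[OF opp_permutes] .
  then have "faces (dual M) = left_face_of (dual M) ` opp M ` darts M"
    by (simp add: faces_def cw_dual_simps(5))
  also have "\<dots> = (\<lambda>v. opp M ` v) ` vertices M"
    by (simp add: vertices_def image_image left_face_of_dual)
  finally have f: "faces (dual M) = (\<lambda>v. opp M ` v) ` vertices M" .
  have "inj (opp M)" by (auto intro: injI)
  then have "inj ((`) (opp M))" by (simp add: inj_def inj_image_eq_iff)
  then have "card (faces (dual M)) = card (vertices M)"
    unfolding f by (rule card_image[OF inj_on_subset[OF _ subset_UNIV]])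
  moreover have "edges (dual M) = edges M" by (simp add: edges_def cw_dual_simps(4,5))
  moreover have "cw (dual M) permutes darts (dual M)"
    using permutes_inv[OF permutes_cw_opp] by (simp add: dual_def)
  moreover have "root_dart (dual M) \<in> darts (dual M)"
    using permutes_in_image[OF permutes_inv[OF cw_permutes]] root_in by (simp add: dual_def)
  ultimately show ?thesis
    using assms connected_dual v finite_darts opp_permutes opp_neq
    by (simp add: planar_map_def cw_dual_simps(4,5))
qed

end

lemma nsp_map_dual:
  assumes M: "nsp_map M" and t: "tour M W" and T: "tree_tour (opp M) W T"
  shows "nsp_map (dual M)" "tree_of_map (dual M) = h_tree T" "decorated_tree (h_tree T)"
proof -
  interpret dart_map M using M by (intro dart_map_if_planar) (simp add: nsp_map_def)
  have p: "planar_map (dual M)" using M planar_dual by (simp add: nsp_map_def)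
  then interpret D: dart_map "dual M" by (rule dart_map_if_planar)
  have t': "tour (dual M) (mirror (opp M) W)" using tour_mirror[OF t T] .
  have T': "tree_tour (opp (dual M)) (mirror (opp M) W) (h_tree T)"
    unfolding cw_dual_simps(4) using tree_tour_mirror[OF opp_opp T] .
  show "nsp_map (dual M)"
    using p D.tour_not_separable[OF t' T'] M
    by (simp add: nsp_map_def edges_def cw_dual_simps(4,5))
  show "tree_of_map (dual M) = h_tree T" using D.tree_of_map_eq[OF t' T'] .
  show "decorated_tree (h_tree T)" using T' by (intro decorated_tree_if_decor) (simp add: tree_tour_def)
qed

section \<open>Euler's formula and crossing chords\<close>

lemma orbit_eq_if_mem: "permutation f \<Longrightarrow> y \<in> orbit f x \<Longrightarrow> orbit f y = orbit f x"
  by (rule orbit_cyclic_eq3[OF cyclic_on_orbit'])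

text \<open>An orbit of \<open>g\<close> avoiding \<open>a\<close> and \<open>b\<close> never meets
  the transposition and is an orbit of \<open>f\<close>; any other one is the orbit of
  \<open>a\<close> or of \<open>b\<close>.\<close>

lemma orbits_comp_transpose:
  assumes f: "f permutes D" and D: "finite D" "a \<in> D" "b \<in> D"
  defines "g \<equiv> f \<circ> transpose a b"
  shows "orbit g ` D \<subseteq> (orbit f ` D - {orbit f a, orbit f b}) \<union> {orbit g a, orbit g b}"
proof
  have gp: "g permutes D" unfolding g_def using f D by (intro permutes_compose permutes_swap_id)
  have pf: "permutation f" and pg: "permutation g" using f gp D(1) permutation_permutes by blast+
  fix u assume "u \<in> orbit g ` D"
  then obtain x where x: "x \<in> D" "u = orbit g x" by auto
  show "u \<in> (orbit f ` D - {orbit f a, orbit f b}) \<union> {orbit g a, orbit g b}"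
  proof (cases "a \<in> u \<or> b \<in> u")
    case True
    then show ?thesis using orbit_eq_if_mem[OF pg] x(2) by blast
  next
    case False
    have "orbit g x = orbit f x"
    proof (rule orbit_cong0)
      show "x \<in> orbit g x" by (rule permutation_self_in_orbit[OF pg])
      show "g \<in> orbit g x \<rightarrow> orbit g x" by (auto intro: orbit.step)
      show "g y = f y" if "y \<in> orbit g x" for y
        using that False x(2) by (auto simp: g_def transpose_def)
    qed
    then have "u = orbit f x" using x(2) by simp
    moreover have "u \<noteq> orbit f a" "u \<noteq> orbit f b"
      using False permutation_self_in_orbit[OF pf] by auto
    ultimately show ?thesis using x(1) by blast
  qed
qed

text \<open>At most two orbits arise. They replace one orbit if \<open>a\<close> and
  \<open>b\<close> share it, and two orbits otherwise.\<close>

lemma card_orbits_comp_transpose: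
  assumes f: "f permutes D" and D: "finite D" "a \<in> D" "b \<in> D"
  shows "card (orbit (f \<circ> transpose a b) ` D) \<le> card (orbit f ` D) + 1"
    "orbit f a \<noteq> orbit f b \<Longrightarrow> card (orbit (f \<circ> transpose a b) ` D) \<le> card (orbit f ` D)"
proof -
  define g where "g = f \<circ> transpose a b"
  have fin: "finite (orbit f ` D)" using D(1) by simp
  have "card (orbit g ` D) \<le> card ((orbit f ` D - {orbit f a, orbit f b}) \<union> {orbit g a, orbit g b})"
    using orbits_comp_transpose[OF assms] fin unfolding g_def by (intro card_mono) auto
  also have "\<dots> \<le> card (orbit f ` D - {orbit f a, orbit f b}) + card {orbit g a, orbit g b}"
    by (rule card_Un_le)
  also have "card {orbit g a, orbit g b} \<le> 2" by (simp add: card_insert_if)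
  also have "card (orbit f ` D - {orbit f a, orbit f b}) = card (orbit f ` D) - card {orbit f a, orbit f b}"
    using D(2,3) by (intro card_Diff_subset) auto
  finally have le: "card (orbit g ` D) \<le> card (orbit f ` D) - card {orbit f a, orbit f b} + 2" by simp
  have sub: "card {orbit f a, orbit f b} \<le> card (orbit f ` D)"
    using D(2,3) fin by (intro card_mono) auto
  have "1 \<le> card {orbit f a, orbit f b}" by (simp add: card_insert_if)
  then show "card (orbit (f \<circ> transpose a b) ` D) \<le> card (orbit f ` D) + 1"
    using le sub unfolding g_def by linarith
  show "card (orbit (f \<circ> transpose a b) ` D) \<le> card (orbit f ` D)" if "orbit f a \<noteq> orbit f b"
    using le sub that unfolding g_def by simp
qed

lemma card_orbits_comp_involution:
  assumes "finite D" "f permutes D" "i permutes D" "\<And>x. i (i x) = x" "card {x \<in> D. i x \<noteq> x} \<le> 2 * n"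
  shows "card (orbit (f \<circ> i) ` D) \<le> card (orbit f ` D) + n"
  using assms(2-)
proof (induction n arbitrary: f i)
  case 0
  then have "{x \<in> D. i x \<noteq> x} = {}" using assms(1) by simp
  then have "i = id" using 0(2) by (auto simp: permutes_def fun_eq_iff)
  then show ?case by simp
next
  case (Suc n)
  show ?case
  proof (cases "{x \<in> D. i x \<noteq> x} = {}")
    case True
    then have "i = id" using Suc(3) by (auto simp: permutes_def fun_eq_iff)
    then show ?thesis by simp
  next
    case False
    then obtain a where a: "a \<in> D" "i a \<noteq> a" by auto
    define b where "b = i a"
    have b: "b \<in> D" "i b = a" "b \<noteq> a"
      using a Suc(3,4) permutes_in_image[OF Suc(3)] by (auto simp: b_def)
    define j where "j = transpose a b \<circ> i"
    have j: "j x = (if x = a \<or> x = b then x else i x)" for x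
      using b Suc(4)[of x] unfolding j_def transpose_def by (auto simp: b_def)
    have jp: "j permutes D" unfolding j_def
      using a b by (intro permutes_compose[OF Suc(3)] permutes_swap_id)
    have jj: "j (j x) = x" for x
    proof (cases "x = a \<or> x = b")
      case True then show ?thesis by (auto simp: j)
    next
      case False
      then have "i x \<noteq> a \<and> i x \<noteq> b" using Suc(4)[of x] b(2) by (auto simp: b_def)
      then show ?thesis using False Suc(4) by (simp add: j)
    qed
    have "{x \<in> D. j x \<noteq> x} = {x \<in> D. i x \<noteq> x} - {a, b}" by (auto simp: j)
    moreover have "card ({x \<in> D. i x \<noteq> x} - {a, b}) = card {x \<in> D. i x \<noteq> x} - 2"
      using a b assms(1) by (subst card_Diff_subset) auto
    ultimately have c: "card {x \<in> D. j x \<noteq> x} \<le> 2 * n" using Suc(5) by simp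
    have fp: "f \<circ> transpose a b permutes D"
      using a b by (intro permutes_compose[OF permutes_swap_id] Suc(2)) auto
    have "card (orbit (f \<circ> transpose a b \<circ> j) ` D) \<le> card (orbit (f \<circ> transpose a b) ` D) + n"
      by (rule Suc(1)[OF fp jp jj c])
    moreover have e: "f \<circ> transpose a b \<circ> j = f \<circ> i"
      unfolding j_def by (simp add: fun_eq_iff)
    ultimately have "card (orbit (f \<circ> i) ` D) \<le> card (orbit (f \<circ> transpose a b) ` D) + n"
      unfolding e by blast
    then show ?thesis
      using card_orbits_comp_transpose(1)[OF Suc(2) assms(1) a(1) b(1)] by linarith
  qed
qed

lemma path_orbit:
  "path M x Z y \<Longrightarrow> \<forall>z \<in> set Z. next_dart M z = f (fst z) \<Longrightarrow> d \<in> fst ` set Z \<or> d = y \<Longrightarrow>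
   d = x \<or> d \<in> orbit f x"
proof (induction Z arbitrary: x)
  case (Cons z Z)
  have x: "x = fst z" "path M (f x) Z y" using Cons(2,3) by auto
  show ?case
  proof (cases "d = x")
    case False
    then have "d = f x \<or> d \<in> orbit f (f x)" using Cons(1)[OF x(2)] Cons(3,4) x(1) by auto
    then show ?thesis using orbit_subset[of d f x] orbit.base[of f x] by auto
  qed simp
qed simp

lemma path_next_mem:
  "path M x Z y \<Longrightarrow> z \<in> set Z \<Longrightarrow> next_dart M z \<in> fst ` set Z \<union> {y}"
  "path M x Z y \<Longrightarrow> x \<in> fst ` set Z \<union> {y}"
  by (induction Z arbitrary: x) auto

context dart_map
begin

lemma card_opp_closed:
  assumes "X \<subseteq> darts M" "\<And>d. d \<in> X \<Longrightarrow> opp M d \<in> X"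
  shows "card X = 2 * card ((\<lambda>d. {d, opp M d}) ` X)"
proof -
  let ?C = "(\<lambda>d. {d, opp M d}) ` X"
  have X: "finite X" "\<Union>?C = X" using assms finite_darts finite_subset by auto
  have "2 * card ?C = card (\<Union>?C)"
  proof (rule card_partition)
    show "card c = 2" if c: "c \<in> ?C" for c
    proof -
      obtain d where "d \<in> X" "c = {d, opp M d}" using c by auto
      then show ?thesis using opp_neq[of d] assms(1) by (metis card_2_iff subsetD)
    qed
    show "c1 \<inter> c2 = {}" if "c1 \<in> ?C" "c2 \<in> ?C" "c1 \<noteq> c2" for c1 c2
      using that by (auto simp: insert_commute)
  qed (use X in auto)
  then show ?thesis unfolding X(2) by simp
qed

text \<open>
  The tour is a single cycle of \<open>cw \<circ> opp\<close> with \<open>opp\<close> restricted to the tree edges.  Multiplying by the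
  transpositions of the tree edges gives the vertices, by those of the chords the faces.  Every
  transposition increases the number of cycles by at most one, and the second one of two crossing
  chords does not increase it at all.
\<close>

theorem no_crossing_chords:
  assumes euler: "card (vertices M) + card (faces M) = card (edges M) + 2"
    and t: "tour M W"
    and chord: "\<And>d l. (d, l) \<in> set W \<Longrightarrow> l \<noteq> Down \<Longrightarrow> l \<noteq> Up \<Longrightarrow>
      \<exists>l'. l' \<noteq> Down \<and> l' \<noteq> Up \<and> (opp M d, l') \<in> set W"
    and W: "W = A @ (a, Open) # B @ (b, Open) # C @ (opp M a, Close) # E @ (opp M b, Close) # F"
  shows False
proof -
  define i where "i X d = (if d \<in> X then opp M d else d)" for X d
  define N where "N = {d. \<exists>l. (d, l) \<in> set W \<and> l \<noteq> Down \<and> l \<noteq> Up}"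
  define T where "T = darts M - N"
  define f where "f = cw M \<circ> i T"
  have dW: "distinct (map fst W)" and D: "fst ` set W = darts M"
    and pW: "path M (root_dart M) W (root_dart M)" using t by (auto simp: tour_def)
  have uniq: "l = l'" if "(d, l) \<in> set W" "(d, l') \<in> set W" for d l l'
    using eq_key_imp_eq_value[OF dW that] .
  have ND: "N \<subseteq> darts M" unfolding N_def D[symmetric] by force
  have No: "opp M d \<in> N" if "d \<in> N" for d using that chord unfolding N_def by blast
  have To: "opp M d \<in> T" if "d \<in> T" for d using that No[of "opp M d"] unfolding T_def by auto
  have ii: "i X (i X d) = d" if "\<And>d. d \<in> X \<Longrightarrow> opp M d \<in> X" for X d
    using that by (auto simp: i_def)
  have ip: "i X permutes darts M" if "X \<subseteq> darts M" "\<And>d. d \<in> X \<Longrightarrow> opp M d \<in> X" for X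
    unfolding permutes_def
  proof (intro conjI allI impI)
    show "i X x = x" if "x \<notin> darts M" for x using that \<open>X \<subseteq> darts M\<close> by (auto simp: i_def)
    show "\<exists>!x. i X x = y" for y using ii[OF that(2)] by metis
  qed
  have im: "{x \<in> darts M. i X x \<noteq> x} = X" if "X \<subseteq> darts M" for X
    using that opp_neq by (auto simp: i_def)
  have TD: "T \<subseteq> darts M" by (auto simp: T_def)
  define nT where "nT = card ((\<lambda>d. {d, opp M d}) ` T)"
  define nN where "nN = card ((\<lambda>d. {d, opp M d}) ` N)"
  have cT: "card T = 2 * nT" unfolding nT_def by (rule card_opp_closed[OF TD To])
  have cN: "card N = 2 * nN" unfolding nN_def by (rule card_opp_closed[OF ND No])
  have "card (darts M) = 2 * card (edges M)" unfolding edges_def by (rule card_opp_closed) auto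
  moreover have "card (darts M) = card T + card N"
    unfolding T_def using ND finite_darts by (metis card_Diff_subset card_mono finite_subset le_add_diff_inverse2)
  ultimately have cE: "card (edges M) = nT + nN" using cT cN by simp
  have fp: "f permutes darts M" unfolding f_def by (rule permutes_compose[OF ip[OF TD To] cw_permutes])
  have nf: "next_dart M z = f (fst z)" if "z \<in> set W" for z
  proof -
    obtain d l where z: "z = (d, l)" by (cases z)
    have "d \<in> darts M" using that z D by force
    then have "d \<in> T \<longleftrightarrow> l = Down \<or> l = Up"
      using that uniq unfolding T_def N_def z by blast
    then show ?thesis unfolding z f_def next_dart_def by (auto simp: i_def)
  qed
  have "orbit f ` darts M \<subseteq> {orbit f (root_dart M)}"
  proof
    fix u assume "u \<in> orbit f ` darts M"
    then obtain d where d: "d \<in> fst ` set W" "u = orbit f d" unfolding D by auto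
    have pf: "permutation f" using fp finite_darts permutation_permutes by blast
    have "d = root_dart M \<or> d \<in> orbit f (root_dart M)" using path_orbit[OF pW] nf d(1) by blast
    then show "u \<in> {orbit f (root_dart M)}" using orbit_eq_if_mem[OF pf] d(2) by auto
  qed
  then have c1: "card (orbit f ` darts M) \<le> 1"
    using card_mono[of "{orbit f (root_dart M)}"] by simp
  have "f \<circ> i T = cw M" unfolding f_def using ii[of T] To by (auto simp: fun_eq_iff)
  then have cV: "card (vertices M) \<le> 1 + nT"
    using card_orbits_comp_involution[OF finite_darts fp ip[OF TD To] ii[OF To], of nT] c1 im[OF TD] cT
    by (simp add: vertices_def vertex_of_def image_def)
  have ab: "a \<in> N" "b \<in> N" "opp M a \<in> N" "opp M b \<in> N"
    unfolding N_def W by auto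
  have abD: "a \<in> darts M" "b \<in> darts M" using ab ND by auto
  define f1 where "f1 = f \<circ> transpose a (opp M a)"
  define f2 where "f2 = f1 \<circ> transpose b (opp M b)"
  have f1p: "f1 permutes darts M" unfolding f1_def
    using abD by (intro permutes_compose[OF permutes_swap_id fp]) auto
  have f2p: "f2 permutes darts M" unfolding f2_def
    using abD by (intro permutes_compose[OF permutes_swap_id f1p]) auto
  have "card (orbit f1 ` darts M) \<le> 2"
    using card_orbits_comp_transpose(1)[OF fp finite_darts, of a "opp M a"] abD c1
    unfolding f1_def by simp
  moreover have "orbit f1 b \<noteq> orbit f1 (opp M b)"
  proof -
    \<comment> \<open>\<open>f1\<close> sends \<open>opp M a\<close> to the successor of
      \<open>a\<close>, so the stretch of the tour from that successor to \<open>opp M a\<close> is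
      invariant. That the chords cross means that this stretch contains \<open>b\<close> but not
      \<open>opp M b\<close>.\<close>
    define Z where "Z = B @ (b, Open) # C"
    define X where "X = fst ` set Z \<union> {opp M a}"
    have pZ: "path M (cw M a) Z (opp M a)" using pW unfolding W Z_def by (auto simp: path_append)
    define K where "K = (a, Open) # Z @ (opp M a, Close) # E @ [(opp M b, Close)]"
    have "W = A @ K @ F" by (simp add: W K_def Z_def)
    then have "distinct (map fst K)" using dW by simp
    then have aN: "a \<notin> X" and obX: "opp M b \<notin> X"
      unfolding K_def X_def by (simp_all, blast+)
    have fa: "f a = cw M a" "f (opp M a) = cw M (opp M a)"
      using ab unfolding f_def T_def i_def by auto
    have closed: "f1 d \<in> X" if dX: "d \<in> X" for d
    proof (cases "d = opp M a")
      case True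
      then show ?thesis using path_next_mem(2)[OF pZ] fa by (auto simp: f1_def X_def)
    next
      case False
      then obtain z where z: "z \<in> set Z" "d = fst z" using dX by (auto simp: X_def)
      then have "z \<in> set W" unfolding W Z_def by auto
      moreover have "d \<noteq> a" using dX aN by auto
      ultimately have "f1 d = next_dart M z"
        using False nf z(2) by (simp add: f1_def transpose_def)
      then show ?thesis using path_next_mem(1)[OF pZ z(1)] by (simp add: X_def)
    qed
    have bX: "b \<in> X" by (simp add: X_def Z_def)
    have "orbit f1 b \<subseteq> X"
    proof
      fix d assume "d \<in> orbit f1 b"
      then show "d \<in> X" by induction (use closed bX in auto)
    qed
    moreover have "permutation f1" using f1p finite_darts permutation_permutes by blast
    then have "opp M b \<in> orbit f1 (opp M b)" by (rule permutation_self_in_orbit)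
    ultimately show ?thesis using obX by blast
  qed
  ultimately have c2: "card (orbit f2 ` darts M) \<le> 2"
    using card_orbits_comp_transpose(2)[OF f1p finite_darts, of b "opp M b"] abD
    unfolding f2_def by simp
  define N' where "N' = N - {a, opp M a, b, opp M b}"
  have N'o: "opp M d \<in> N'" if "d \<in> N'" for d
  proof -
    have "d \<in> N" "d \<noteq> a" "d \<noteq> opp M a" "d \<noteq> b" "d \<noteq> opp M b" using that by (auto simp: N'_def)
    moreover have "opp M d \<noteq> a" "opp M d \<noteq> b" using calculation opp_opp by metis+
    ultimately show ?thesis using No by (simp add: N'_def)
  qed
  have N'D: "N' \<subseteq> darts M" using ND by (auto simp: N'_def)
  have dist: "a \<noteq> b" "a \<noteq> opp M a" "a \<noteq> opp M b" "b \<noteq> opp M a" "b \<noteq> opp M b"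
    using dW unfolding W by auto
  have "card {a, opp M a, b, opp M b} = 4" using dist by auto
  then have "card N' = 2 * nN - 4"
    unfolding N'_def using ab cN by (subst card_Diff_subset) auto
  moreover have "4 \<le> card N"
    using card_mono[of N "{a, opp M a, b, opp M b}"] ab finite_subset[OF ND finite_darts]
      \<open>card {a, opp M a, b, opp M b} = 4\<close> by simp
  ultimately have cN': "card N' \<le> 2 * (nN - 2)" "2 \<le> nN" using cN by auto
  \<comment> \<open>\<open>f\<close> crosses the tree edges only; once the transpositions of all
    chords are included, every edge is crossed, which is the face permutation.\<close>
  have "f2 \<circ> i N' = cw M \<circ> opp M"
  proof
    fix d
    have fN: "f d = cw M d" if "d \<in> N" for d
      using that by (auto simp: f_def i_def T_def)
    moreover have "f (opp M d) = cw M (opp M d)" if "d \<in> N" for d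
      using fN[OF No[OF that]] .
    moreover have "f d = cw M (opp M d)" if "d \<notin> N" for d
    proof (cases "d \<in> darts M")
      case True then show ?thesis using that by (auto simp: f_def i_def T_def)
    next
      case False
      then have "opp M d = d" using opp_permutes by (simp add: permutes_not_in)
      then show ?thesis using False by (auto simp: f_def i_def T_def)
    qed
    ultimately show "(f2 \<circ> i N') d = (cw M \<circ> opp M) d"
      using ab dist unfolding f2_def f1_def by (auto simp: i_def N'_def transpose_def)
  qed
  then have "card (faces M) \<le> 2 + (nN - 2)"
    using card_orbits_comp_involution[OF finite_darts f2p ip[OF N'D N'o] ii[OF N'o], of "nN - 2"] c2
      im[OF N'D] cN'(1)
    by (simp add: faces_def left_face_of_def image_def)
  \<comment> \<open>There are at most \<open>1 + nT\<close> vertices and \<open>nN\<close> faces,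
    but \<open>nT + nN\<close> edges: Euler's formula is missed by one.\<close>
  then show False using cV cE cN'(2) euler by linarith
qed

lemma runs_if_nested:
  assumes dW: "distinct (map fst W)"
    and closed: "\<And>d. (d, Open) \<in> set W \<Longrightarrow> (opp M d, Close) \<in> set W"
    and opened: "\<And>d A B. W = A @ (d, Close) # B \<Longrightarrow> (opp M d, Open) \<in> set A"
    and nested: "\<And>a b A B C E F.
      W \<noteq> A @ (a, Open) # B @ (b, Open) # C @ (opp M a, Close) # E @ (opp M b, Close) # F"
  shows "runs (opp M) Open Close W [] []"
proof -
  define c where "c P x \<longleftrightarrow> snd x = Open \<and> (opp M (fst x), Close) \<notin> set P" for P x
  \<comment> \<open>The stack after the prefix \<open>P\<close>, listed from the bottom.\<close>
  define pending where "pending P = map fst (filter (c P) P)" for P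
  have uniq: "l = l'" if "(d, l) \<in> set W" "(d, l') \<in> set W" for d l l'
    using eq_key_imp_eq_value[OF dW that] .
  have "runs (opp M) Open Close P [] (rev (pending P))" if "W = P @ R" for P R
    using that
  proof (induction P arbitrary: R rule: rev_induct)
    case Nil
    then show ?case by (simp add: pending_def)
  next
    case (snoc x P)
    obtain d l where x: "x = (d, l)" by (cases x)
    have IH: "runs (opp M) Open Close P [] (rev (pending P))" using snoc by simp
    have W: "W = P @ (d, l) # R" using snoc(2) x by simp
    have dP: "d \<notin> fst ` set P" and dPP: "distinct (map fst P)" using dW unfolding W by auto
    show ?case
    proof (cases l)
      case Open
      have "(opp M d, Close) \<notin> set P"
      proof
        assume "(opp M d, Close) \<in> set P"
        then obtain P1 P2 where P: "P = P1 @ (opp M d, Close) # P2" by (meson split_list)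
        then have "(opp M (opp M d), Open) \<in> set P1" using opened[of P1 "opp M d"] W by simp
        then show False using dP P by force
      qed
      moreover have "filter (c (P @ [x])) P = filter (c P) P"
        by (intro filter_cong) (auto simp: c_def x Open)
      ultimately have "pending (P @ [x]) = pending P @ [d]"
        by (simp add: pending_def c_def x Open)
      then show ?thesis using IH by (simp add: runs_append x Open)
    next
      case Close
      define t where "t = opp M d"
      have tP: "(t, Open) \<in> set P" using opened[of P d R] W Close by (simp add: t_def)
      moreover have "(opp M t, Close) \<notin> set P" using dP by (force simp: t_def)
      ultimately have "t \<in> set (pending P)" by (force simp: pending_def c_def)
      then obtain L1 L2 where L: "pending P = L1 @ t # L2" by (meson split_list)
      \<comment> \<open>A chord opened after \<open>t\<close> and still pending when
        \<open>t\<close> is closed would be closed later and cross \<open>t\<close>.\<close>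
      have "L2 = []"
      proof (rule ccontr)
        assume "L2 \<noteq> []"
        then obtain h where h: "h \<in> set L2" by (cases L2) auto
        obtain K1 y K2 where K: "filter (c P) P = K1 @ y # K2" "fst y = t" "map fst K2 = L2"
          using L unfolding pending_def by (auto simp: map_eq_append_conv map_eq_Cons_conv)
        have "y \<in> set (filter (c P) P)" unfolding K(1) by simp
        then have "c P y" by simp
        then have y: "y = (t, Open)" using K(2) by (cases y) (simp add: c_def)
        obtain us vs' where P: "P = us @ y # vs'"
          using \<open>y \<in> set (filter (c P) P)\<close> by (meson filter_is_subset split_list subsetD)
        have vs: "filter (c P) vs' = K2"
        proof -
          have "distinct P" using dPP by (simp add: distinct_map)
          then have "y \<notin> set (filter (c P) us)" "y \<notin> set (filter (c P) vs')" unfolding P by auto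
          moreover have "filter (c P) us @ y # filter (c P) vs' = K1 @ y # K2"
            using K(1) \<open>c P y\<close> unfolding P by simp
          ultimately show ?thesis by (simp add: append_Cons_eq_iff)
        qed
        obtain z where z: "z \<in> set K2" "fst z = h" using h K(3) by auto
        then have "z \<in> set (filter (c P) vs')" using vs by simp
        then have "z \<in> set vs'" "c P z" by simp_all
        then have "z = (h, Open)" using z(2) by (simp add: c_def prod_eq_iff)
        then have zz: "(opp M h, Close) \<notin> set P" "(h, Open) \<in> set vs'"
          using \<open>c P z\<close> \<open>z \<in> set vs'\<close> by (simp_all add: c_def)
        then obtain B C where B: "vs' = B @ (h, Open) # C" by (meson split_list)
        have "(h, Open) \<in> set W" unfolding W P B by simp
        then have "(opp M h, Close) \<in> set W" by (rule closed)
        moreover have "opp M h \<noteq> d"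
        proof
          assume "opp M h = d"
          then have "h = t" by (auto simp: t_def)
          then show False using dPP unfolding P B y by auto
        qed
        ultimately have "(opp M h, Close) \<in> set R" using zz(1) unfolding W by auto
        then obtain E F where "R = E @ (opp M h, Close) # F" by (meson split_list)
        then have "W = us @ (t, Open) # B @ (h, Open) # C @ (opp M t, Close) # E @ (opp M h, Close) # F"
          unfolding W P B y by (simp add: t_def Close)
        then show False using nested by blast
      qed
      have "distinct (pending P)"
        unfolding pending_def using dPP by (metis distinct_map_filter)
      then have tL: "t \<notin> set L1" using L by simp
      have "filter (c (P @ [x])) P = filter (\<lambda>y. fst y \<noteq> t) (filter (c P) P)"
        unfolding filter_filter by (intro filter_cong) (auto simp: c_def x Close t_def)
      then have "pending (P @ [x]) = filter (\<lambda>d. d \<noteq> t) (pending P)"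
        by (simp add: pending_def c_def x Close filter_map comp_def)
      also have "\<dots> = L1" unfolding L \<open>L2 = []\<close> using tL by (auto intro: filter_True)
      finally have "rev (pending P) = t # rev (pending (P @ [x]))" using L \<open>L2 = []\<close> by simp
      then show ?thesis using IH
        by (auto simp: runs_append x Close t_def intro!: exI[of _ "rev (pending P)"])
    next
      case Down
      have "filter (c (P @ [x])) P = filter (c P) P"
        by (intro filter_cong) (auto simp: c_def x Down)
      then have "pending (P @ [x]) = pending P" by (simp add: pending_def c_def x Down)
      then show ?thesis using IH by (simp add: runs_append x Down)
    next
      case Up
      have "filter (c (P @ [x])) P = filter (c P) P"
        by (intro filter_cong) (auto simp: c_def x Up)
      then have "pending (P @ [x]) = pending P" by (simp add: pending_def c_def x Up)
      then show ?thesis using IH by (simp add: runs_append x Up)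
    qed
  qed
  from this[of W "[]"] have "runs (opp M) Open Close W [] (rev (pending W))" by simp
  moreover have "pending W = []" using closed by (auto simp: pending_def c_def filter_empty_conv)
  ultimately show ?thesis by simp
qed

end

section \<open>The depth-first search as a tour\<close>

text \<open>
  \<open>search\<close> is \<open>seg\<close> without the stack discipline, which only holds for planar maps; \<open>dep\<close> is the depth
  of the origin of a dart.
\<close>

inductive search :: "('d \<Rightarrow> 'd) \<Rightarrow> ('d \<Rightarrow> int) \<Rightarrow> int \<Rightarrow> int ltree list \<Rightarrow> ('d \<times> step) list \<Rightarrow> 'd list \<Rightarrow> bool"
  for op dep where
  Empty: "search op dep p [] [] []"
| Opening: "search op dep p (ts @ [Leaf (dep (op d))]) (W @ [(d, Open)]) (V @ [d])"
  if "search op dep p ts W V" "-1 \<le> dep (op d)" "dep (op d) < p"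
| Closing: "search op dep p ts (W @ [(d, Close)]) (V @ [d])"
  if "search op dep p ts W V" "dep d = p"
| Subtree: "search op dep p (ts @ [Node (rev us)]) (W @ (d, Down) # W' @ [(op d, Up)]) (V @ [d])"
  if "search op dep p ts W V" "search op dep (p + 1) us W' V'"
    "\<forall>t. (t, Open) \<in> set W' \<longrightarrow> (op t, Close) \<in> set W' \<or> dep (op t) \<le> p"
    "\<forall>t. (t, Close) \<in> set W' \<longrightarrow> (op t, Open) \<in> set W'"
    "\<exists>t. (t, Open) \<in> set W' \<and> (op t, Close) \<notin> set W' \<and> dep (op t) < p"

lemma search_append:
  assumes "search op dep p ts W V" "search op dep p ts' W' V'"
  shows "search op dep p (ts @ ts') (W @ W') (V @ V')"
  using assms(2,1)
proof (induction rule: search.induct)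
  case (Opening p ts' W' V' d)
  then show ?case
    using search.Opening[of op dep p "ts @ ts'" "W @ W'" "V @ V'" d] by simp
next
  case (Closing p ts' W' V' d)
  then show ?case
    using search.Closing[of op dep p "ts @ ts'" "W @ W'" "V @ V'" d] by simp
next
  case (Subtree p ts' W' V' us W'' V'' d)
  then show ?case
    using search.Subtree[of op dep p "ts @ ts'" "W @ W'" "V @ V'" us W'' V'' d] by simp
qed simp

context dart_map
begin

lemma seg_open_not_closed:
  "seg (opp M) p ts W V Q \<Longrightarrow> distinct (map fst W) \<Longrightarrow>
   distinct (map snd Q) \<and> (\<forall>x \<in> set Q. (opp M (snd x), Close) \<notin> set W)"
proof (induction rule: seg.induct)
  case (Opening p ts W V Q a d)
  have IH: "distinct (map snd Q)" "\<forall>x \<in> set Q. (opp M (snd x), Close) \<notin> set W"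
    using Opening.IH Opening.prems by auto
  have dW: "d \<notin> fst ` set W" using Opening.prems by simp
  have "d \<notin> snd ` set Q" using seg_open_mem[OF Opening.hyps(1)] dW by force
  moreover have "(opp M d, Close) \<notin> set W"
  proof
    assume "(opp M d, Close) \<in> set W"
    then obtain t where "opp M t = opp M d" "(t, Open) \<in> set W"
      using runs_Open_Close_paired(3)[of "opp M" W "[]"] seg_runs[OF Opening.hyps(1), of "[]" "[]"] by fastforce
    then show False using dW by force
  qed
  ultimately show ?case using IH by auto
next
  case (Closing p ts W V d Q)
  have IH: "distinct (map snd ((p, d) # Q))" "\<forall>x \<in> set Q. (opp M (snd x), Close) \<notin> set W"
    using Closing.IH Closing.prems by auto
  then show ?case by auto
next
  case (Subtree p ts W V Q us W' V' Q' d)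
  have di: "distinct (map fst W)" "distinct (map fst W')" "fst ` set W \<inter> fst ` set W' = {}"
    using Subtree.prems by auto
  have IH: "distinct (map snd Q)" "\<forall>x \<in> set Q. (opp M (snd x), Close) \<notin> set W"
    "distinct (map snd Q')" "\<forall>x \<in> set Q'. (opp M (snd x), Close) \<notin> set W'"
    using Subtree.IH di by auto
  have Q: "snd x \<in> fst ` set W" if "x \<in> set Q" for x using seg_open_mem[OF Subtree.hyps(1) that] by force
  have Q': "snd x \<in> fst ` set W'" if "x \<in> set Q'" for x using seg_open_mem[OF Subtree.hyps(2) that] by force
  have 1: "t \<in> fst ` set W" if c: "(opp M t, Close) \<in> set W" for t
  proof -
    obtain t' where "opp M t' = opp M t" "(t', Open) \<in> set W"
      using runs_Open_Close_paired(3)[of "opp M" W "[]"] seg_runs[OF Subtree.hyps(1), of "[]" "[]"] c by fastforce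
    then show ?thesis by force
  qed
  have 2: "t \<in> fst ` set W'" if c: "(opp M t, Close) \<in> set W'" for t
  proof -
    obtain t' where "opp M t' = opp M t" "(t', Open) \<in> set W'"
      using runs_Open_Close_paired(3)[of "opp M" W' "[]"] seg_runs[OF Subtree.hyps(2), of "[]" "[]"] c by fastforce
    then show ?thesis by force
  qed
  have "snd ` set Q' \<inter> snd ` set Q = {}"   proof -
    have "snd ` set Q' \<subseteq> fst ` set W'" "snd ` set Q \<subseteq> fst ` set W" using Q Q' by blast+
    then show ?thesis using di(3) by blast
  qed
  moreover have "(opp M (snd x), Close) \<notin> set W'" if "x \<in> set Q" for x using Q[OF that] 2[of "snd x"] di(3) by blast
  moreover have "(opp M (snd x), Close) \<notin> set W" if "x \<in> set Q'" for x using Q'[OF that] 1[of "snd x"] di(3) by blast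
  ultimately show ?case using IH by auto
qed simp

text \<open>The labels come from \<open>dep\<close>, the nesting from \<open>runs\<close>. The
  condition on \<open>S\<close> keeps closings from reaching below the chords of \<open>W\<close>,
  so the popped chord is the top of \<open>Q\<close>, and its label is \<open>p\<close> because its
  far end has depth \<open>p\<close>.\<close>

lemma search_seg:
  "search (opp M) dep p ts W V \<Longrightarrow> runs (opp M) Open Close W S S' \<Longrightarrow> distinct (map fst W) \<Longrightarrow>
   \<forall>d. (d, Close) \<in> set W \<longrightarrow> opp M d \<notin> set S \<Longrightarrow>
   \<exists>Q. seg (opp M) p ts W V Q \<and> S' = map snd Q @ S \<and> (\<forall>x \<in> set Q. fst x = dep (opp M (snd x)))"
proof (induction arbitrary: S S' rule: search.induct)
  case (Empty p)
  then show ?case by (auto intro: seg.Empty exI[of _ "[]"])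
next
  case (Opening p ts W V d)
  obtain S1 where S1: "runs (opp M) Open Close W S S1" "S' = d # S1"
    using Opening.prems(1) by (auto simp: runs_append)
  obtain Q where "seg (opp M) p ts W V Q" "S1 = map snd Q @ S" "\<forall>x \<in> set Q. fst x = dep (opp M (snd x))"
    using Opening.IH[OF S1(1)] Opening.prems(2,3) by auto
  then show ?case
    using seg.Opening[OF _ Opening.hyps(2,3), of "opp M" ts W V Q d] S1(2)
    by (intro exI[of _ "(dep (opp M d), d) # Q"]) simp
next
  case (Closing p ts W V d)
  obtain t where t: "runs (opp M) Open Close W S (t # S')" "opp M t = d"
    using Closing.prems(1) by (auto simp: runs_append)
  obtain Q where Q: "seg (opp M) p ts W V Q" "t # S' = map snd Q @ S" "\<forall>x \<in> set Q. fst x = dep (opp M (snd x))"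
    using Closing.IH[OF t(1)] Closing.prems(2,3) by auto
  have "t \<notin> set S" using Closing.prems(3) t(2) by auto
  then obtain x Q1 where x: "Q = x # Q1" using Q(2) by (cases Q) auto
  then have "x = (p, t)" using Q(2,3) t(2) Closing.hyps(2) by (cases x) auto
  then show ?case
    using seg.Closing[of "opp M" p ts W V t Q1] Q x t(2) by (intro exI[of _ Q1]) auto
next
  case (Subtree p ts W V us W' V' d)
  obtain S1 where r: "runs (opp M) Open Close W S S1" "runs (opp M) Open Close W' S1 S'"
    using Subtree.prems(1) by (auto simp: runs_append)
  have di: "distinct (map fst W)" "distinct (map fst W')" "fst ` set W \<inter> fst ` set W' = {}"
    using Subtree.prems(2) by auto
  obtain Q where Q: "seg (opp M) p ts W V Q" "S1 = map snd Q @ S" "\<forall>x \<in> set Q. fst x = dep (opp M (snd x))"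
    using Subtree.IH(1)[OF r(1) di(1)] Subtree.prems(3) by auto
  have "\<forall>t. (t, Close) \<in> set W' \<longrightarrow> opp M t \<notin> set S1"
  proof (intro allI impI)
    fix t assume t: "(t, Close) \<in> set W'"
    then have "opp M t \<notin> set S" using Subtree.prems(3) by auto
    moreover have "opp M t \<in> fst ` set W'" using Subtree.hyps(4) t by force
    moreover {have "snd x \<in> fst ` set W" if "x \<in> set Q" for x
      using seg_open_mem[OF Q(1) that] by force
    then have "snd ` set Q \<subseteq> fst ` set W" by blast}
    ultimately show "opp M t \<notin> set S1" unfolding Q(2) using di(3) by (simp, blast)
  qed
  then obtain Q' where Q': "seg (opp M) (p + 1) us W' V' Q'" "S' = map snd Q' @ S1"
    "\<forall>x \<in> set Q'. fst x = dep (opp M (snd x))"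
    using Subtree.IH(2)[OF r(2) di(2)] by auto
  have "\<forall>x \<in> set Q'. fst x \<le> p"
  proof
    fix x assume x: "x \<in> set Q'"
    have "(opp M (snd x), Close) \<notin> set W'" using seg_open_not_closed[OF Q'(1) di(2)] x by blast
    then show "fst x \<le> p" using Subtree.hyps(3) seg_open_mem[OF Q'(1) x] Q'(3) x by auto
  qed
  moreover have "\<exists>x \<in> set Q'. fst x < p"
  proof -
    obtain t where t: "(t, Open) \<in> set W'" "(opp M t, Close) \<notin> set W'" "dep (opp M t) < p"
      using Subtree.hyps(5) by auto
    have "runs (opp M) Open Close W' [] (map snd Q')" using seg_runs[OF Q'(1), of "[]" "[]"] by simp
    then have "t \<in> snd ` set Q'" using runs_Open_Close_paired(1) t by fastforce
    then show ?thesis using Q'(3) t(3) by auto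
  qed
  ultimately show ?case
    using seg.Subtree[OF Q(1) Q'(1)] Q Q' by (intro exI[of _ "Q' @ Q"]) auto
qed

end

text \<open>What the search knows about chords without any nesting: a dart is passed as
  \<open>Close\<close> because its edge was examined before, either outside the walk (recorded in
  \<open>S\<close>) or at an earlier \<open>Open\<close>.\<close>

primrec opened :: "('d \<Rightarrow> 'd) \<Rightarrow> 'd set \<Rightarrow> ('d \<times> step) list \<Rightarrow> bool" where
  "opened op S [] \<longleftrightarrow> True"
| "opened op S (x # W) \<longleftrightarrow> (snd x = Close \<longrightarrow> fst x \<in> S) \<and>
     opened op (if snd x = Open then insert (op (fst x)) S else S) W"

lemma opened_append:
  "opened op S (X @ Y) \<longleftrightarrow> opened op S X \<and> opened op (S \<union> {op t | t. (t, Open) \<in> set X}) Y"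
proof (induction X arbitrary: S)
  case (Cons x X)
  have "(if snd x = Open then insert (op (fst x)) S else S) \<union> {op t | t. (t, Open) \<in> set X} =
      S \<union> {op t | t. (t, Open) \<in> set (x # X)}"
    by (cases x) auto
  then show ?case using Cons by simp
qed simp

lemma opened_mono:
  "opened op S W \<Longrightarrow> \<forall>d. (d, Close) \<in> set W \<longrightarrow> d \<in> S \<longrightarrow> d \<in> S' \<Longrightarrow> opened op S' W"
proof (induction W arbitrary: S S')
  case (Cons x W)
  have "opened op (if snd x = Open then insert (op (fst x)) S' else S') W"
    by (rule Cons.IH[of "if snd x = Open then insert (op (fst x)) S else S"]) (use Cons.prems in auto)
  then show ?case using Cons.prems by (cases x) auto
qed simp

lemma opened_closed: "opened op S W \<Longrightarrow> (d, Close) \<in> set W \<Longrightarrow> d \<in> S \<or> (\<exists>t. op t = d \<and> (t, Open) \<in> set W)"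
proof (induction W arbitrary: S)
  case (Cons x W)
  show ?case
  proof (cases "x = (d, Close)")
    case False
    then have "d \<in> (if snd x = Open then insert (op (fst x)) S else S) \<or> (\<exists>t. op t = d \<and> (t, Open) \<in> set W)"
      using Cons by auto
    then show ?thesis by (cases x) (auto split: if_splits)
  qed (use Cons.prems in auto)
qed simp

section \<open>Invariants of the search in a non-separable map\<close>

locale nonseparable_map = dart_map +
  assumes nonseparable: "\<not> separable M"
    and two_edges: "2 \<le> card (edges M)"
begin

text \<open>The decisive clause: a visited vertex that still has unexamined darts is the current
  vertex \<open>x\<close> or has depth below \<open>p\<close>. Hence a chord found at
  \<open>x\<close> gets a label below \<open>p\<close>. The root dart, staying outside
  \<open>U\<close>, will provide the other side of the cut in \<open>child_escape\<close>.\<close>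

definition state_ok :: "int \<Rightarrow> 'a set \<Rightarrow> ('a set \<rightharpoonup> int) \<Rightarrow> 'a set \<Rightarrow> bool" where
  "state_ok p x depth U \<longleftrightarrow> U \<subseteq> darts M \<and> (\<forall>d \<in> U. opp M d \<in> U) \<and>
     (\<forall>d \<in> darts M - U. depth (vertex_of M d) \<noteq> None) \<and> root_dart M \<notin> U \<and>
     (\<forall>d \<in> U. \<forall>q. depth (vertex_of M d) = Some q \<longrightarrow> q < p \<or> vertex_of M d = x) \<and>
     (\<forall>v q. depth v = Some q \<longrightarrow> -1 \<le> q) \<and> depth x = Some p \<and> 0 \<le> p"

text \<open>The depth map is the one before the exploration: a chord that stays open ends at a
  vertex visited earlier.\<close>

definition opens_ok :: "int \<Rightarrow> 'a set \<Rightarrow> ('a set \<rightharpoonup> int) \<Rightarrow> 'a set \<Rightarrow> ('a \<times> step) list \<Rightarrow> bool" where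
  "opens_ok p x depth U W \<longleftrightarrow> (\<forall>t. (t, Open) \<in> set W \<longrightarrow> t \<in> U \<and>
     ((opp M t, Close) \<in> set W \<or> opp M t \<notin> fst ` set W \<and>
       (head t = x \<or> (\<exists>q < p. depth (head t) = Some q))))"

text \<open>The contract of one call of \<open>explore\<close>, with a witness \<open>W\<close> for
  its walk. The \<open>search\<close> clause admits any \<open>dep\<close> extending the final
  depths, so calls can be combined although later ones add depths. The \<open>path\<close> clause
  compares \<open>W\<close> with merely passing the darts \<open>ds\<close>: seen from the vertex,
  detours into subtrees leave no trace.\<close>

inductive explored :: "int \<Rightarrow> 'a set \<Rightarrow> 'a list \<Rightarrow> ('a set \<rightharpoonup> int) \<Rightarrow> 'a set \<Rightarrow>
    int ltree list \<Rightarrow> ('a set \<rightharpoonup> int) \<Rightarrow> 'a set \<Rightarrow> ('a \<times> step) list \<Rightarrow> bool" where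
  exploredI: "explored p x ds depth U cs depth' U' W"
  if "state_ok p x depth' U'"
    "depth \<subseteq>\<^sub>m depth'"
    "U' = U - fst ` set W - opp M ` fst ` set W"
    "distinct (map fst W)"
    "\<And>d. d \<in> fst ` set W \<longleftrightarrow>
       d \<in> set ds \<or> d \<in> darts M \<and> depth (vertex_of M d) = None \<and> depth' (vertex_of M d) \<noteq> None"
    "opened (opp M) (- U) W"
    "\<And>t. (t, Open) \<in> set W \<Longrightarrow> t \<in> U \<and>
       ((opp M t, Close) \<in> set W \<or> opp M t \<notin> fst ` set W \<and>
         (head t = x \<or> (\<exists>q < p. depth (head t) = Some q)))"
    "\<And>d. (d, Down) \<in> set W \<Longrightarrow> d \<in> U \<and> (opp M d, Up) \<in> set W"
    "\<And>d. (d, Up) \<in> set W \<Longrightarrow> (opp M d, Down) \<in> set W"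
    "\<And>dep. (\<forall>d q. depth' (vertex_of M d) = Some q \<longrightarrow> dep d = q) \<Longrightarrow> search (opp M) dep p cs W ds"
    "\<And>z y. path M z (map (\<lambda>d. (d, Close)) ds) y \<Longrightarrow> path M z W y"

lemma loop_free: "d \<in> darts M \<Longrightarrow> head d \<noteq> vertex_of M d"
  using no_loop[OF nonseparable two_edges] .

lemma explored_Nil:
  "state_ok p x depth U \<Longrightarrow> explored p x [] depth U [] depth U []"
  by (intro exploredI) (auto simp: search.Empty)

lemma state_okD:
  assumes "state_ok p x depth U"
  shows "U \<subseteq> darts M" "\<And>d. d \<in> U \<Longrightarrow> opp M d \<in> U"
    "\<And>d. d \<in> darts M \<Longrightarrow> d \<notin> U \<Longrightarrow> depth (vertex_of M d) \<noteq> None" "root_dart M \<notin> U"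
    "\<And>d q. d \<in> U \<Longrightarrow> depth (vertex_of M d) = Some q \<Longrightarrow> q < p \<or> vertex_of M d = x"
    "\<And>v q. depth v = Some q \<Longrightarrow> -1 \<le> q" "depth x = Some p" "0 \<le> p"
  using assms unfolding state_ok_def by blast+

lemma explored_conjuncts:
  assumes "explored p x ds depth U cs depth' U' W"
  shows "state_ok p x depth' U'" "depth \<subseteq>\<^sub>m depth'" "U' = U - fst ` set W - opp M ` fst ` set W"
    "distinct (map fst W)"
    "\<forall>d. d \<in> fst ` set W \<longleftrightarrow>
       d \<in> set ds \<or> d \<in> darts M \<and> depth (vertex_of M d) = None \<and> depth' (vertex_of M d) \<noteq> None"
    "opened (opp M) (- U) W" "opens_ok p x depth U W"
    "\<forall>d. (d, Down) \<in> set W \<longrightarrow> d \<in> U \<and> (opp M d, Up) \<in> set W"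
    "\<forall>d. (d, Up) \<in> set W \<longrightarrow> (opp M d, Down) \<in> set W"
    "\<forall>dep. (\<forall>d q. depth' (vertex_of M d) = Some q \<longrightarrow> dep d = q) \<longrightarrow> search (opp M) dep p cs W ds"
    "\<forall>z y. path M z (map (\<lambda>d. (d, Close)) ds) y \<longrightarrow> path M z W y"
  using assms unfolding opens_ok_def by - ((erule explored.cases, hypsubst, (assumption | blast))+)

lemmas exploredD = explored_conjuncts(1-4) explored_conjuncts(5)[THEN spec] explored_conjuncts(6,7)
  explored_conjuncts(8,9)[THEN spec, THEN mp] explored_conjuncts(10)[THEN spec, THEN mp]
  explored_conjuncts(11)[THEN spec, THEN spec, THEN mp]

lemma explored_skip:
  assumes st: "state_ok p x depth U" and d: "d \<notin> U" "d \<in> darts M" "vertex_of M d = x" "d \<notin> set ds"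
    and e: "explored p x ds depth U cs depth' U' W"
  shows "explored p x (d # ds) depth U cs depth' U' ((d, Close) # W)"
proof -
  have x: "depth x = Some p" "depth' x = Some p" using state_okD(7) st exploredD(1)[OF e] by blast+
  have mem: "\<And>d. d \<in> fst ` set W \<longleftrightarrow>
       d \<in> set ds \<or> d \<in> darts M \<and> depth (vertex_of M d) = None \<and> depth' (vertex_of M d) \<noteq> None"
    by (rule exploredD(5)[OF e])
  have dW: "d \<notin> fst ` set W" using mem[of d] d x by simp
  have od: "opp M d \<notin> U" using st d(1) unfolding state_ok_def by (metis opp_opp)
  show ?thesis
  proof (rule exploredI)
    show "U' = U - fst ` set ((d, Close) # W) - opp M ` fst ` set ((d, Close) # W)"
      unfolding exploredD(3)[OF e] using d(1) od by auto
    show "distinct (map fst ((d, Close) # W))" using exploredD(4)[OF e] dW by simp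
    show "opened (opp M) (- U) ((d, Close) # W)" using exploredD(6)[OF e] d(1) by simp
    show "search (opp M) dep p cs ((d, Close) # W) (d # ds)"
      if dep: "\<forall>d q. depth' (vertex_of M d) = Some q \<longrightarrow> dep d = q" for dep
    proof -
      have "search (opp M) dep p ([] @ cs) ([(d, Close)] @ W) ([d] @ ds)"
      proof (rule search_append)
        show "search (opp M) dep p [] [(d, Close)] [d]"
          using search.Closing[OF search.Empty[of "opp M" dep p], of d] dep d(3) x by simp
      qed (rule exploredD(10)[OF e dep])
      then show ?thesis by simp
    qed
  next
    fix t assume "(t, Open) \<in> set ((d, Close) # W)"
    then have t: "(t, Open) \<in> set W" by simp
    then show "t \<in> U \<and> ((opp M t, Close) \<in> set ((d, Close) # W) \<or> opp M t \<notin> fst ` set ((d, Close) # W) \<and>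
       (head t = x \<or> (\<exists>q < p. depth (head t) = Some q)))"
      using exploredD(7)[OF e] unfolding opens_ok_def by (cases "opp M t = d") auto
  next
    show "path M z ((d, Close) # W) y" if "path M z (map (\<lambda>d. (d, Close)) (d # ds)) y" for z y
      using that exploredD(11)[OF e] by simp
    show "d' \<in> fst ` set ((d, Close) # W) \<longleftrightarrow> d' \<in> set (d # ds) \<or>
        d' \<in> darts M \<and> depth (vertex_of M d') = None \<and> depth' (vertex_of M d') \<noteq> None" for d'
      using mem[of d'] by auto
  qed (use exploredD(1,2,8,9)[OF e] in simp_all)
qed

lemma state_ok_remove:
  assumes st: "state_ok p x depth U" and d: "d \<in> U" "vertex_of M d = x" "depth (head d) = Some q"
  shows "state_ok p x depth (U - {d, opp M d})"
  unfolding state_ok_def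
proof (intro conjI)
  show "\<forall>d' \<in> U - {d, opp M d}. opp M d' \<in> U - {d, opp M d}"
    using st unfolding state_ok_def by (metis DiffD1 DiffD2 DiffI insertE insertCI opp_opp empty_iff)
  show "\<forall>d' \<in> darts M - (U - {d, opp M d}). depth (vertex_of M d') \<noteq> None"
  proof
    fix d' assume "d' \<in> darts M - (U - {d, opp M d})"
    then consider "d' \<in> darts M - U" | "d' = d" | "d' = opp M d" by blast
    then show "depth (vertex_of M d') \<noteq> None"
    proof cases
      case 1
      then show ?thesis using st unfolding state_ok_def by blast
    next
      case 2
      then show ?thesis using st d(2) by (simp add: state_ok_def)
    qed (use d(3) in simp)
  qed
qed (use st in \<open>auto simp: state_ok_def\<close>)

lemma explored_leaf:
  assumes st: "state_ok p x depth U" and d: "d \<in> U" "vertex_of M d = x" "d \<notin> set ds" "\<forall>d \<in> set ds. vertex_of M d = x"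
    and q: "depth (head d) = Some q"
    and e: "explored p x ds depth (U - {d, opp M d}) cs depth' U' W"
  shows "explored p x (d # ds) depth U (Leaf q # cs) depth' U' ((d, Open) # W)"
proof -
  have dD: "d \<in> darts M" and od: "opp M d \<in> U" using state_okD(1,2)[OF st] d(1) by blast+
  have x: "depth x = Some p" "depth' x = Some p" using state_okD(7) st exploredD(1)[OF e] by blast+
  \<comment> \<open>A loop would give the label \<open>p\<close> instead of a smaller one.\<close>
  have ne: "head d \<noteq> x" using loop_free[OF dD] d(2) by simp
  then have qp: "q < p" "-1 \<le> q" using state_okD(5)[OF st od q] state_okD(6)[OF st q] by auto
  have mem: "\<And>d. d \<in> fst ` set W \<longleftrightarrow>
       d \<in> set ds \<or> d \<in> darts M \<and> depth (vertex_of M d) = None \<and> depth' (vertex_of M d) \<noteq> None"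
    by (rule exploredD(5)[OF e])
  have dW: "d \<notin> fst ` set W" using mem[of d] d x by simp
  have odW: "opp M d \<notin> fst ` set W" using mem[of "opp M d"] q d(4) ne by auto
  show ?thesis
  proof (rule exploredI)
    show "U' = U - fst ` set ((d, Open) # W) - opp M ` fst ` set ((d, Open) # W)"
      unfolding exploredD(3)[OF e] by auto
    show "distinct (map fst ((d, Open) # W))" using exploredD(4)[OF e] dW by simp
    show "opened (opp M) (- U) ((d, Open) # W)"
    proof -
      have "opened (opp M) (insert (opp M d) (- U)) W"
        using exploredD(6)[OF e] by (rule opened_mono) (use dW in force)
      then show ?thesis by simp
    qed
    show "search (opp M) dep p (Leaf q # cs) ((d, Open) # W) (d # ds)"
      if dep: "\<forall>d q. depth' (vertex_of M d) = Some q \<longrightarrow> dep d = q" for dep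
    proof -
      have "depth' (head d) = Some q"
        using exploredD(2)[OF e] q unfolding map_le_def by (metis domI)
      then have dq: "dep (opp M d) = q" using dep by blast
      have "search (opp M) dep p ([Leaf q] @ cs) ([(d, Open)] @ W) ([d] @ ds)"
      proof (rule search_append)
        show "search (opp M) dep p [Leaf q] [(d, Open)] [d]"
          using search.Opening[OF search.Empty[of "opp M" dep p], of d] dq qp by simp
      qed (rule exploredD(10)[OF e dep])
      then show ?thesis by simp
    qed
  next
    fix t assume t: "(t, Open) \<in> set ((d, Open) # W)"
    show "t \<in> U \<and> ((opp M t, Close) \<in> set ((d, Open) # W) \<or> opp M t \<notin> fst ` set ((d, Open) # W) \<and>
       (head t = x \<or> (\<exists>q < p. depth (head t) = Some q)))"
    proof (cases "t = d")
      case True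
      then show ?thesis using d(1) odW qp q opp_neq[OF dD] by auto
    next
      case False
      then have "(t, Open) \<in> set W" using t by simp
      then have *: "t \<in> U - {d, opp M d} \<and> ((opp M t, Close) \<in> set W \<or> opp M t \<notin> fst ` set W \<and>
         (head t = x \<or> (\<exists>q < p. depth (head t) = Some q)))"
        using exploredD(7)[OF e] unfolding opens_ok_def by blast
      then have "opp M t \<noteq> d" by auto
      then show ?thesis using * by auto
    qed
  next
    show "path M z ((d, Open) # W) y" if "path M z (map (\<lambda>d. (d, Close)) (d # ds)) y" for z y
      using that exploredD(11)[OF e] by simp
    show "d' \<in> fst ` set ((d, Open) # W) \<longleftrightarrow> d' \<in> set (d # ds) \<or>
        d' \<in> darts M \<and> depth (vertex_of M d') = None \<and> depth' (vertex_of M d') \<noteq> None" for d'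
      using mem[of d'] by auto
    show "d' \<in> U \<and> (opp M d', Up) \<in> set ((d, Open) # W)" if "(d', Down) \<in> set ((d, Open) # W)" for d'
      using that exploredD(8)[OF e, of d'] by simp
  qed (use exploredD(1,2,9)[OF e] in simp_all)
qed

lemma state_ok_descend:
  assumes st: "state_ok p x depth U" and d: "d \<in> U" "vertex_of M d = x"
    and none: "depth (head d) = None"
  shows "state_ok (p + 1) (head d) (depth(head d \<mapsto> p + 1)) (U - {d, opp M d})"
  unfolding state_ok_def
proof (intro conjI)
  note s = state_okD[OF st]
  show "\<forall>d' \<in> U - {d, opp M d}. opp M d' \<in> U - {d, opp M d}"
  proof
    fix d' assume "d' \<in> U - {d, opp M d}"
    then have "opp M d' \<in> U" "opp M d' \<noteq> opp M d" "opp M d' \<noteq> d" using s(2) opp_opp by auto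
    then show "opp M d' \<in> U - {d, opp M d}" by simp
  qed
  show "\<forall>d' \<in> darts M - (U - {d, opp M d}). (depth(head d \<mapsto> p + 1)) (vertex_of M d') \<noteq> None"
  proof
    fix d' assume "d' \<in> darts M - (U - {d, opp M d})"
    then consider "d' \<in> darts M" "d' \<notin> U" | "d' = d" | "d' = opp M d" by blast
    then show "(depth(head d \<mapsto> p + 1)) (vertex_of M d') \<noteq> None"
      by cases (use s(3,7) d(2) in auto)
  qed
  show "\<forall>d' \<in> U - {d, opp M d}. \<forall>q. (depth(head d \<mapsto> p + 1)) (vertex_of M d') = Some q \<longrightarrow>
      q < p + 1 \<or> vertex_of M d' = head d"
  proof (intro ballI allI impI)
    fix d' q assume d': "d' \<in> U - {d, opp M d}"
      and q: "(depth(head d \<mapsto> p + 1)) (vertex_of M d') = Some q"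
    show "q < p + 1 \<or> vertex_of M d' = head d"
    proof (cases "vertex_of M d' = head d")
      case False
      then have "depth (vertex_of M d') = Some q" using q by simp
      \<comment> \<open>The parent may keep unexamined darts; its depth \<open>p\<close> is
        admissible because the current depth is now \<open>p + 1\<close>.\<close>
      then have "q < p \<or> q = p" using s(5)[of d' q] s(7) d' by auto
      then show ?thesis by auto
    qed simp
  qed
  show "\<forall>v q. (depth(head d \<mapsto> p + 1)) v = Some q \<longrightarrow> -1 \<le> q"
    using s(6,8) by auto
qed (use state_okD[OF st] in auto)

lemma path_closings: "path M z (map (\<lambda>i. ((cw M ^^ i) z, Close)) [0..<n]) ((cw M ^^ n) z)"
  by (induction n) (auto simp: path_append)

lemma path_darts_after:
  assumes "d \<in> darts M"
  shows "path M (cw M d) (map (\<lambda>d. (d, Close)) (darts_after M d)) d"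
proof -
  note a = darts_after_props(3,4)[OF assms]
  have "map (\<lambda>d. (d, Close)) (darts_after M d) =
      map (\<lambda>i. ((cw M ^^ i) (cw M d), Close)) [0..<length (darts_after M d)]"
    by (subst a(1)) simp
  then show ?thesis using path_closings[of "cw M d" "length (darts_after M d)"] a(2) by simp
qed

section \<open>One recursive call: the subtree entered through \<open>d\<close>\<close>

context
  fixes p x depth U d us depth1 U1 W1 v
  assumes st: "state_ok p x depth U" and d: "d \<in> U" "vertex_of M d = x"
    and v: "v = head d" and none: "depth v = None"
    and e1: "explored (p + 1) v (darts_after M (opp M d)) (depth(v \<mapsto> p + 1)) (U - {d, opp M d}) us depth1 U1 W1"
begin

lemma child_basic:
  shows "d \<in> darts M" "opp M d \<in> U" "opp M d \<in> darts M" "v \<noteq> x"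
    "v = set (opp M d # darts_after M (opp M d))" "distinct (opp M d # darts_after M (opp M d))"
    "depth1 v = Some (p + 1)" "depth \<subseteq>\<^sub>m depth1"
proof -
  note s = state_okD[OF st]
  show dD: "d \<in> darts M" "opp M d \<in> U" "opp M d \<in> darts M" using s(1,2) d(1) by auto
  show "v \<noteq> x" using s(7) none by auto
  show "v = set (opp M d # darts_after M (opp M d))" "distinct (opp M d # darts_after M (opp M d))"
    using darts_after_props(1,2)[OF dD(3)] v by auto
  note m = exploredD(2)[OF e1]
  show "depth1 v = Some (p + 1)" using m unfolding map_le_def by force
  show "depth \<subseteq>\<^sub>m depth1"
    unfolding map_le_def
  proof
    fix w assume w: "w \<in> dom depth"
    then have "w \<noteq> v" using none by auto
    then have "(depth(v \<mapsto> p + 1)) w = depth w" by simp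
    moreover have "w \<in> dom (depth(v \<mapsto> p + 1))" using w by simp
    ultimately show "depth w = depth1 w" using m unfolding map_le_def by metis
  qed
qed

lemma child_mem_W1:
  assumes "t \<in> fst ` set W1"
  shows "t \<in> U" "depth (vertex_of M t) = None" "depth1 (vertex_of M t) \<noteq> None" "t \<noteq> d" "t \<noteq> opp M d"
    "t \<in> darts M" "vertex_of M t \<subseteq> insert (opp M d) (fst ` set W1)"
proof -
  note b = child_basic and s = state_okD[OF st]
  note mem = exploredD(5)[OF e1]
  have V: "set (darts_after M (opp M d)) \<subseteq> fst ` set W1" using mem by blast
  have "t \<in> set (darts_after M (opp M d)) \<or> t \<in> darts M \<and> (depth(v \<mapsto> p + 1)) (vertex_of M t) = None \<and>
      depth1 (vertex_of M t) \<noteq> None"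
    using mem[of t] assms by blast
  then have *: "t \<in> darts M \<and> depth (vertex_of M t) = None \<and> depth1 (vertex_of M t) \<noteq> None \<and>
      t \<noteq> opp M d \<and> vertex_of M t \<subseteq> insert (opp M d) (fst ` set W1)"
  proof
    assume t: "t \<in> set (darts_after M (opp M d))"
    then have "t \<in> head d" using b(5) v by auto
    then have "vertex_of M t = v" using vertex_of_eq v by blast
    moreover have "t \<in> darts M" using \<open>t \<in> head d\<close> vertex_of_subset[OF b(3)] by blast
    moreover have "v \<subseteq> insert (opp M d) (fst ` set W1)" using b(5) V by auto
    ultimately show ?thesis using none b(6,7) t by auto
  next
    assume t: "t \<in> darts M \<and> (depth(v \<mapsto> p + 1)) (vertex_of M t) = None \<and> depth1 (vertex_of M t) \<noteq> None"
    then have "vertex_of M t \<noteq> v" "depth (vertex_of M t) = None" by (auto split: if_splits)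
    moreover have "vertex_of M t \<subseteq> fst ` set W1"
    proof
      fix w assume "w \<in> vertex_of M t"
      then have "w \<in> darts M" "vertex_of M w = vertex_of M t" using t vertex_of_subset vertex_of_eq by blast+
      then show "w \<in> fst ` set W1" using mem[of w] t by simp
    qed
    ultimately show ?thesis using t v by blast
  qed
  then show "depth (vertex_of M t) = None" "depth1 (vertex_of M t) \<noteq> None" "t \<noteq> opp M d" "t \<in> darts M"
    "vertex_of M t \<subseteq> insert (opp M d) (fst ` set W1)"
    by blast+
  show "t \<in> U" by (rule ccontr) (use s(3)[of t] * in simp)
  show "t \<noteq> d" using * s(7) d(2) by auto
qed

text \<open>The call uses all darts of the vertices that it visits. A dart left unexamined is
  therefore at a vertex unvisited so far, or at one whose depth was fixed before the call.\<close>

lemma child_U1: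
  assumes "t \<in> U1"
  shows "t \<in> U" "t \<noteq> d" "t \<noteq> opp M d" "t \<notin> fst ` set W1" "opp M t \<notin> fst ` set W1" "opp M t \<in> U1"
    "depth1 (vertex_of M t) = Some q \<Longrightarrow> depth (vertex_of M t) = Some q"
proof -
  note b = child_basic and s = state_okD[OF st]
  note U1 = exploredD(3)[OF e1]
  show t: "t \<in> U" "t \<noteq> d" "t \<noteq> opp M d" "t \<notin> fst ` set W1" using assms unfolding U1 by auto
  show "opp M t \<notin> fst ` set W1"
  proof
    assume "opp M t \<in> fst ` set W1"
    then have "opp M (opp M t) \<in> opp M ` fst ` set W1" by (rule imageI)
    then show False using assms unfolding U1 by simp
  qed
  show "opp M t \<in> U1" using state_okD(2)[OF exploredD(1)[OF e1] assms] .
  show "depth (vertex_of M t) = Some q" if q: "depth1 (vertex_of M t) = Some q"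
  proof -
    have ne: "vertex_of M t \<noteq> v"
    proof
      assume "vertex_of M t = v"
      then have "t \<in> set (opp M d # darts_after M (opp M d))" using in_vertex_of_self[of t] b(5) by blast
      then have "t \<in> set (darts_after M (opp M d))" using t(3) by simp
      then show False using exploredD(5)[OF e1, of t] t(4) by blast
    qed
    have "(depth(v \<mapsto> p + 1)) (vertex_of M t) \<noteq> None"
    proof
      assume n: "(depth(v \<mapsto> p + 1)) (vertex_of M t) = None"
      have "t \<in> darts M" using t(1) s(1) by blast
      moreover have "depth1 (vertex_of M t) \<noteq> None" using q by simp
      ultimately show False using exploredD(5)[OF e1, of t] t(4) n by blast
    qed
    then obtain q' where q': "(depth(v \<mapsto> p + 1)) (vertex_of M t) = Some q'" by auto
    then have "depth1 (vertex_of M t) = Some q'"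
      using exploredD(2)[OF e1] unfolding map_le_def by (metis domI)
    then show ?thesis using q q' ne by simp
  qed
qed

lemma child_state: "state_ok p x depth1 U1"
  unfolding state_ok_def
proof (intro conjI)
  note s = state_okD[OF st] and s1 = state_okD[OF exploredD(1)[OF e1]]
  show "\<forall>d \<in> U1. \<forall>q. depth1 (vertex_of M d) = Some q \<longrightarrow> q < p \<or> vertex_of M d = x"
    using child_U1(1,7) s(5) by blast
  show "depth1 x = Some p" using child_basic(8) s(7) unfolding map_le_def by (metis domI)
  show "U1 \<subseteq> darts M" "root_dart M \<notin> U1" using s1(1,4) .
  show "\<forall>d \<in> U1. opp M d \<in> U1" using s1(2) by blast
  show "\<forall>d \<in> darts M - U1. depth1 (vertex_of M d) \<noteq> None" using s1(3) by blast
  show "\<forall>v q. depth1 v = Some q \<longrightarrow> -1 \<le> q" using s1(6) by blast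
  show "0 \<le> p" using s(8) .
qed

text \<open>All darts of \<open>v\<close> other than the one of entry are used up by the call, so a
  chord left open cannot end at \<open>v\<close>. By the invariant on unexamined darts its end is
  \<open>x\<close> or has depth below \<open>p\<close>.\<close>

lemma child_open:
  assumes t: "(t, Open) \<in> set W1" "(opp M t, Close) \<notin> set W1"
  shows "t \<in> U" "opp M t \<notin> fst ` set W1"
    "head t = x \<or> (\<exists>q < p. depth (head t) = Some q)"
proof -
  note b = child_basic and s = state_okD[OF st]
  have *: "t \<in> U - {d, opp M d} \<and> opp M t \<notin> fst ` set W1 \<and> (head t = v \<or>
      (\<exists>q < p + 1. (depth(v \<mapsto> p + 1)) (head t) = Some q))"
    using exploredD(7)[OF e1] t unfolding opens_ok_def by blast
  then show "t \<in> U" "opp M t \<notin> fst ` set W1" by auto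
  have ne: "head t \<noteq> v"
  proof
    assume "head t = v"
    then have "opp M t \<in> set (opp M d # darts_after M (opp M d))"
      using in_vertex_of_self[of "opp M t"] b(5) by blast
    moreover have "opp M t \<noteq> opp M d" using * by auto
    ultimately show False using exploredD(5)[OF e1, of "opp M t"] * by auto
  qed
  then obtain q where q: "depth (head t) = Some q" using * by auto
  have "opp M t \<in> U" using * s(2) by auto
  then show "head t = x \<or> (\<exists>q < p. depth (head t) = Some q)"
    using s(5)[OF _ q] q by blast
qed

lemma child_close:
  assumes "(t, Close) \<in> set W1"
  shows "(opp M t, Open) \<in> set W1"
proof -
  have "t \<in> fst ` set W1" using assms by force
  then have "t \<notin> - (U - {d, opp M d})" using child_mem_W1(1,4,5) by auto
  then show ?thesis using opened_closed[OF exploredD(6)[OF e1] assms] by auto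
qed

text \<open>\<open>Down\<close> and \<open>Up\<close> occur in pairs and each \<open>Close\<close>
  has its \<open>Open\<close>, so only an \<open>Open\<close> can lack its opposite.\<close>

lemma child_opp:
  assumes "t \<in> fst ` set W1" "opp M t \<notin> fst ` set W1"
  shows "(t, Open) \<in> set W1"
proof -
  obtain l where l: "(t, l) \<in> set W1" using assms(1) by auto
  show ?thesis
  proof (cases l)
    case Down
    then show ?thesis using exploredD(8)[OF e1, of t] l assms(2) by force
  next
    case Up
    then show ?thesis using exploredD(9)[OF e1, of t] l assms(2) by force
  next
    case Close
    then show ?thesis using child_close[of t] l assms(2) by force
  qed (use l in simp)
qed

text \<open>Otherwise \<open>x\<close> would be a cut vertex, separating the edges of the subtree from the root edge.\<close>

lemma child_escape: "\<exists>t. (t, Open) \<in> set W1 \<and> (opp M t, Close) \<notin> set W1 \<and>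
  (\<exists>q < p. depth (head t) = Some q)"
proof (rule ccontr)
  assume "\<not> ?thesis"
  then have to_x: "head t = x" if "(t, Open) \<in> set W1" "(opp M t, Close) \<notin> set W1" for t
    using child_open(3)[OF that] that by blast
  note b = child_basic and s = state_okD[OF st]
  \<comment> \<open>\<open>Y\<close> consists of whole vertices, those visited by the call. A dart
    of \<open>X\<close> outside \<open>Y\<close> is the far end of an open chord and hence, under
    the assumption to be refuted, at \<open>x\<close>.\<close>
  define Y where "Y = insert (opp M d) (fst ` set W1)"
  define X where "X = Y \<union> opp M ` Y"
  have YU: "Y \<subseteq> U" using b(2) child_mem_W1(1) by (auto simp: Y_def)
  then have XU: "X \<subseteq> U" using s(2) by (auto simp: X_def)
  have Yv: "vertex_of M z \<subseteq> Y" if "z \<in> Y" for z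
  proof (cases "z = opp M d")
    case True
    have "set (darts_after M (opp M d)) \<subseteq> fst ` set W1" using exploredD(5)[OF e1] by blast
    then have "v \<subseteq> Y" using b(5) by (auto simp: Y_def)
    then show ?thesis using True v by simp
  next
    case False
    then show ?thesis using child_mem_W1(7) that unfolding Y_def by blast
  qed
  show False
  proof (rule cut_vertex[OF nonseparable])
    show "X \<subseteq> darts M" using XU s(1) by blast
    show "X \<noteq> {}" by (auto simp: X_def Y_def)
    show "X \<noteq> darts M" using XU s(4) root_in by blast
    show "opp M z \<in> X" if "z \<in> X" for z using that by (auto simp: X_def)
    show "vertex_of M z \<subseteq> X" if z: "z \<in> X" "vertex_of M z \<noteq> x" for z
    proof (cases "z \<in> Y")
      case True
      then show ?thesis using Yv by (auto simp: X_def)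
    next
      case False
      then obtain y where y: "y \<in> Y" "z = opp M y" using z(1) by (auto simp: X_def)
      have "y \<noteq> opp M d" using y(2) z(2) d(2) by auto
      then have yW: "y \<in> fst ` set W1" using y(1) by (simp add: Y_def)
      have n: "opp M y \<notin> fst ` set W1" using False y(2) by (simp add: Y_def)
      then have "(opp M y, Close) \<notin> set W1" by force
      then have "vertex_of M z = x" using to_x[OF child_opp[OF yW n]] y(2) by simp
      then show ?thesis using z(2) by simp
    qed
  qed
qed

end

end

context nonseparable_map
begin

lemma explored_subtree:
  assumes st: "state_ok p x depth U" and d: "d \<in> U" "vertex_of M d = x" "d \<notin> set ds" "\<forall>d \<in> set ds. vertex_of M d = x"
    and v: "v = head d" and none: "depth v = None"
    and e1: "explored (p + 1) v (darts_after M (opp M d)) (depth(v \<mapsto> p + 1)) (U - {d, opp M d}) us depth1 U1 W1"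
    and e2: "explored p x ds depth1 U1 cs depth' U' W2"
  shows "explored p x (d # ds) depth U (Node (rev us) # cs) depth' U' ((d, Down) # W1 @ (opp M d, Up) # W2)"
    (is "explored p x _ depth U _ depth' U' ?W")
proof -
  note a = st d(1,2) v none e1
  note b = child_basic[OF a] and s = state_okD[OF st] and w1 = child_mem_W1[OF a] and u1 = child_U1[OF a]
  note mem1 = exploredD(5)[OF e1] and mem2 = exploredD(5)[OF e2]
  have x1: "depth1 x = Some p" using state_okD(7)[OF child_state[OF a]] .
  have le: "depth1 w = Some q \<Longrightarrow> depth' w = Some q" for w q
    using exploredD(2)[OF e2] unfolding map_le_def by (metis domI)
  have le1: "depth w = Some q \<Longrightarrow> depth1 w = Some q" for w q
    using b(8) unfolding map_le_def by (metis domI)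
  have W12: "t \<notin> fst ` set W2" if "t \<in> fst ` set W1" for t
  proof
    assume "t \<in> fst ` set W2"
    then have "t \<in> set ds" using mem2[of t] w1(3)[OF that] by blast
    then show False using d(4) w1(2)[OF that] s(7) by auto
  qed
  have d_notin: "d \<notin> fst ` set W1" "opp M d \<notin> fst ` set W1" "d \<notin> fst ` set W2" "opp M d \<notin> fst ` set W2"
  proof -
    show "d \<notin> fst ` set W1" "opp M d \<notin> fst ` set W1" using w1(4,5) by blast+
    show "d \<notin> fst ` set W2" using mem2[of d] d x1 by simp
    have "opp M d \<notin> set ds" using d(4) b(4) v by auto
    then show "opp M d \<notin> fst ` set W2" using mem2[of "opp M d"] b(7) v by simp
  qed
  have U1: "U1 = U - {d, opp M d} - fst ` set W1 - opp M ` fst ` set W1" using exploredD(3)[OF e1] .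
  have W: "fst ` set ?W = {d, opp M d} \<union> fst ` set W1 \<union> fst ` set W2" by auto
  \<comment> \<open>A chord opened in the subtree may be closed later at \<open>x\<close>. So a dart
    met by \<open>W2\<close> with its edge already examined is either old for the whole call or the
    far end of such a chord.\<close>
  have U1_case: "t \<notin> U \<or> (opp M t, Open) \<in> set W1" if "t \<in> fst ` set W2" "t \<notin> U1" for t
  proof -
    have "t \<noteq> d" "t \<noteq> opp M d" "t \<notin> fst ` set W1" using that(1) d_notin(3,4) W12 by blast+
    then have "t \<notin> U \<or> t \<in> opp M ` fst ` set W1" using that(2) unfolding U1 by blast
    moreover have "(opp M t, Open) \<in> set W1" if t: "t \<in> opp M ` fst ` set W1"
    proof -
      obtain r where r: "r \<in> fst ` set W1" "t = opp M r" using t by blast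
      then have "opp M r \<notin> fst ` set W1" using \<open>t \<notin> fst ` set W1\<close> by simp
      from child_opp[OF a r(1) this] show ?thesis using r(2) by simp
    qed
    ultimately show ?thesis by blast
  qed
  show ?thesis
  proof (rule exploredI)
    show "state_ok p x depth' U'" using exploredD(1)[OF e2] .
    show "depth \<subseteq>\<^sub>m depth'" using b(8) exploredD(2)[OF e2] by (rule map_le_trans)
    show "U' = U - fst ` set ?W - opp M ` fst ` set ?W"
      unfolding exploredD(3)[OF e2] U1 W image_Un by auto
    show "distinct (map fst ?W)"
    proof -
      have "fst ` set W1 \<inter> fst ` set W2 = {}" using W12 by blast
      then show ?thesis
        using exploredD(4)[OF e1] exploredD(4)[OF e2] d_notin opp_neq[OF b(1)] by auto
    qed
  next
    fix t
    show "t \<in> fst ` set ?W \<longleftrightarrow>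
        t \<in> set (d # ds) \<or> t \<in> darts M \<and> depth (vertex_of M t) = None \<and> depth' (vertex_of M t) \<noteq> None"
    proof
      assume "t \<in> fst ` set ?W"
      then consider "t = d" | "t = opp M d" | "t \<in> fst ` set W1" | "t \<in> fst ` set W2" unfolding W by blast
      then show "t \<in> set (d # ds) \<or> t \<in> darts M \<and> depth (vertex_of M t) = None \<and> depth' (vertex_of M t) \<noteq> None"
      proof cases
        case 2
        then show ?thesis using b(3,7) none v le by simp
      next
        case 3
        then show ?thesis using w1(2,3,6)[OF 3] le by auto
      next
        case 4
        then show ?thesis using mem2[of t] le1 by (cases "depth (vertex_of M t)") auto
      qed simp
    next
      assume r: "t \<in> set (d # ds) \<or> t \<in> darts M \<and> depth (vertex_of M t) = None \<and> depth' (vertex_of M t) \<noteq> None"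
      show "t \<in> fst ` set ?W"
      proof (cases "t = d \<or> t \<in> set ds")
        case True
        then show ?thesis using mem2[of t] unfolding W by blast
      next
        case False
        then have t: "t \<in> darts M" "depth (vertex_of M t) = None" "depth' (vertex_of M t) \<noteq> None" using r by auto
        show ?thesis
        proof (cases "vertex_of M t = v")
          case True
          then have "t = opp M d \<or> t \<in> set (darts_after M (opp M d))"
            using in_vertex_of_self[of t] b(5) by auto
          then show ?thesis using mem1[of t] unfolding W by blast
        next
          case False
          then have "(depth(v \<mapsto> p + 1)) (vertex_of M t) = None" using t(2) by simp
          then show ?thesis using mem1[of t] mem2[of t] t(1,3) unfolding W
            by (cases "depth1 (vertex_of M t) = None") simp_all
        qed
      qed
    qed
  next
    have "opened (opp M) (- U) W1"
      using exploredD(6)[OF e1] by (rule opened_mono) (use d_notin(1,2) in force)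
    moreover have "opened (opp M) (- U \<union> {opp M t |t. (t, Open) \<in> set W1}) W2"
    proof (rule opened_mono[OF exploredD(6)[OF e2]], intro allI impI)
      fix t assume "(t, Close) \<in> set W2" "t \<in> - U1"
      then have "t \<notin> U \<or> (opp M t, Open) \<in> set W1" using U1_case[of t] by force
      then show "t \<in> - U \<union> {opp M t |t. (t, Open) \<in> set W1}"
        by (auto intro!: exI[of _ "opp M t"])
    qed
    ultimately show "opened (opp M) (- U) ?W" by (simp add: opened_append)
  next
    fix t assume "(t, Open) \<in> set ?W"
    then consider "(t, Open) \<in> set W1" | "(t, Open) \<in> set W2" by auto
    then show "t \<in> U \<and> ((opp M t, Close) \<in> set ?W \<or> opp M t \<notin> fst ` set ?W \<and>
         (head t = x \<or> (\<exists>q < p. depth (head t) = Some q)))"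
    proof cases
      case 1
      have tW1: "t \<in> fst ` set W1" using 1 by force
      show ?thesis
      proof (cases "(opp M t, Close) \<in> set W1")
        case True
        then show ?thesis using w1(1)[OF tW1] by auto
      next
        case False
        note o = child_open[OF a 1 False]
        have "(opp M t, Close) \<in> set W2" if "opp M t \<in> fst ` set ?W"
        proof -
          have "opp M t \<noteq> d" "opp M t \<noteq> opp M d" using tW1 d_notin(1,2) opp_opp by metis+
          then have "opp M t \<in> fst ` set W2" using that o(2) unfolding W by blast
          then obtain l where l: "(opp M t, l) \<in> set W2" by auto
          have n: "opp M t \<notin> U1" using tW1 unfolding U1 by blast
          show ?thesis
          proof (cases l)
            case Down
            then show ?thesis using exploredD(8)[OF e2, of "opp M t"] l n by simp
          next
            case Up
            then have "(t, Down) \<in> set W2" using exploredD(9)[OF e2, of "opp M t"] l by simp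
            then show ?thesis using W12[OF tW1] by force
          next
            case Open
            then show ?thesis using exploredD(7)[OF e2] l n unfolding opens_ok_def by blast
          qed (use l in simp)
        qed
        then show ?thesis using o by auto
      qed
    next
      case 2
      have t: "t \<in> U1" "(opp M t, Close) \<in> set W2 \<or> opp M t \<notin> fst ` set W2 \<and> (head t = x \<or>
          (\<exists>q < p. depth1 (head t) = Some q))"
        using exploredD(7)[OF e2] 2 unfolding opens_ok_def by blast+
      note o = u1(1-5,7)[OF u1(6)[OF t(1)]]
      show ?thesis
      proof (cases "(opp M t, Close) \<in> set W2")
        case True
        then show ?thesis using u1(1)[OF t(1)] by auto
      next
        case False
        then have "opp M t \<notin> fst ` set ?W" using t(2) o(2,3,4) unfolding W by blast
        moreover have "head t = x \<or> (\<exists>q < p. depth (head t) = Some q)"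
          using t(2) False o(6) by blast
        ultimately show ?thesis using u1(1)[OF t(1)] by blast
      qed
    qed
  next
    fix t assume "(t, Down) \<in> set ?W"
    then consider "t = d" | "(t, Down) \<in> set W1" | "(t, Down) \<in> set W2" by auto
    then show "t \<in> U \<and> (opp M t, Up) \<in> set ?W"
    proof cases
      case 2
      then show ?thesis using exploredD(8)[OF e1, of t] by simp
    next
      case 3
      then show ?thesis using exploredD(8)[OF e2, of t] u1(1)[of t] by simp
    qed (use d(1) in simp)
  next
    fix t assume "(t, Up) \<in> set ?W"
    then consider "t = opp M d" | "(t, Up) \<in> set W1" | "(t, Up) \<in> set W2" by auto
    then show "(opp M t, Down) \<in> set ?W"
      by cases (use exploredD(9)[OF e1, of t] exploredD(9)[OF e2, of t] in auto)
  next
    fix dep :: "'a \<Rightarrow> int" assume dep: "\<forall>d q. depth' (vertex_of M d) = Some q \<longrightarrow> dep d = q"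
    then have dep1: "\<forall>d q. depth1 (vertex_of M d) = Some q \<longrightarrow> dep d = q" using le by blast
    have dep0: "dep t = q" if "depth (vertex_of M t) = Some q" for t q using that le1 dep1 by blast
    have "search (opp M) dep p ([] @ [Node (rev us)]) ([] @ (d, Down) # W1 @ [(opp M d, Up)]) ([] @ [d])"
    proof (rule search.Subtree[OF search.Empty exploredD(10)[OF e1 dep1]])
      show "\<forall>t. (t, Open) \<in> set W1 \<longrightarrow> (opp M t, Close) \<in> set W1 \<or> dep (opp M t) \<le> p"
      proof (intro allI impI)
        fix t assume t: "(t, Open) \<in> set W1"
        show "(opp M t, Close) \<in> set W1 \<or> dep (opp M t) \<le> p"
        proof (cases "(opp M t, Close) \<in> set W1")
          case False
          from child_open(3)[OF a t this] show ?thesis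
          proof
            assume "head t = x"
            then show ?thesis using dep0[of "opp M t" p] s(7) by simp
          next
            assume "\<exists>q < p. depth (head t) = Some q"
            then show ?thesis using dep0[of "opp M t"] by auto
          qed
        qed simp
      qed
      show "\<forall>t. (t, Close) \<in> set W1 \<longrightarrow> (opp M t, Open) \<in> set W1" using child_close[OF a] by blast
      show "\<exists>t. (t, Open) \<in> set W1 \<and> (opp M t, Close) \<notin> set W1 \<and> dep (opp M t) < p"
        using child_escape[OF a] dep0 by blast
    qed
    from search_append[OF this exploredD(10)[OF e2 dep]]
    show "search (opp M) dep p (Node (rev us) # cs) ?W (d # ds)" by simp
  next
    fix z y assume p: "path M z (map (\<lambda>d. (d, Close)) (d # ds)) y"
    then have "path M (cw M d) W2 y" using exploredD(11)[OF e2] by simp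
    moreover have "path M (cw M (opp M d)) W1 (opp M d)"
      using exploredD(11)[OF e1 path_darts_after[OF b(3)]] .
    ultimately show "path M z ?W y" using p by (auto simp: path_append)
  qed
qed

text \<open>The outer induction is on the number of unexamined darts, the inner one on
  \<open>ds\<close>: skipping a dart leaves \<open>U\<close> unchanged, while the calls after a new
  edge start from a smaller set.\<close>

lemma explore_explored:
  "state_ok p x depth U \<Longrightarrow> distinct ds \<Longrightarrow> \<forall>d \<in> set ds. d \<in> darts M \<and> vertex_of M d = x \<Longrightarrow>
   explore M p ds depth U = (cs, depth', U') \<Longrightarrow> \<exists>W. explored p x ds depth U cs depth' U' W"
proof (induction "card U" arbitrary: p x ds depth U cs depth' U' rule: less_induct)
  case less
  note outer = less.hyps
  have fU: "finite U" using state_okD(1)[OF less.prems(1)] finite_darts finite_subset by blast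
  show ?case using less.prems
  proof (induction ds arbitrary: cs depth' U')
    case Nil
    then have "cs = []" "depth' = depth" "U' = U" by simp_all
    then show ?case using explored_Nil[OF less.prems(1)] by blast
  next
    case (Cons d ds)
    note st = Cons.prems(1)
    have ds: "distinct ds" "d \<notin> set ds" "\<forall>d \<in> set ds. d \<in> darts M \<and> vertex_of M d = x"
      "d \<in> darts M" "vertex_of M d = x" "\<forall>d \<in> set ds. vertex_of M d = x"
      using Cons.prems(2,3) by auto
    show ?case
    proof (cases "d \<in> U")
      case False
      then have "explore M p ds depth U = (cs, depth', U')" using Cons.prems(4) by simp
      then show ?thesis using Cons.IH[OF st ds(1,3)] explored_skip[OF st False ds(4,5,2)] by blast
    next
      case True
      define v where "v = head d"
      have less: "card (U - {d, opp M d}) < card U"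
        using True fU by (intro psubset_card_mono) auto
      show ?thesis
      proof (cases "depth v")
        case None
        obtain us depth1 U1 where 1: "explore M (p + 1) (darts_after M (opp M d)) (depth(v \<mapsto> p + 1))
            (U - {d, opp M d}) = (us, depth1, U1)"
          by (metis prod_cases3)
        obtain cs2 depth2 U2 where 2: "explore M p ds depth1 U1 = (cs2, depth2, U2)"
          by (metis prod_cases3)
        have r: "cs = Node (rev us) # cs2" "depth' = depth2" "U' = U2"
          using Cons.prems(4) True fU None 1 2 by (simp_all add: v_def)
        have oD: "opp M d \<in> darts M" using ds(4) by simp
        have "\<forall>d' \<in> set (darts_after M (opp M d)). d' \<in> darts M \<and> vertex_of M d' = v"
          using darts_after_props(1)[OF oD] vertex_of_subset[OF oD] vertex_of_eq v_def by (metis list.set_intros(2) subsetD)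
        moreover have "distinct (darts_after M (opp M d))" using darts_after_props(2)[OF oD] by simp
        ultimately obtain W1 where e1: "explored (p + 1) v (darts_after M (opp M d)) (depth(v \<mapsto> p + 1))
            (U - {d, opp M d}) us depth1 U1 W1"
          using outer[OF less state_ok_descend[OF st True ds(5)], folded v_def] None 1 by blast
        have "card U1 < card U"
        proof -
          have "U1 \<subseteq> U - {d, opp M d}" unfolding exploredD(3)[OF e1] by blast
          then have "card U1 \<le> card (U - {d, opp M d})" using fU by (intro card_mono) auto
          then show ?thesis using less by simp
        qed
        from outer[OF this child_state[OF st True ds(5) v_def None e1] ds(1,3) 2]
        obtain W2 where "explored p x ds depth1 U1 cs2 depth2 U2 W2" by blast
        then show ?thesis
          using explored_subtree[OF st True ds(5,2,6) v_def None e1] unfolding r by blast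
      next
        case (Some q)
        obtain cs2 depth2 U2 where 2: "explore M p ds depth (U - {d, opp M d}) = (cs2, depth2, U2)"
          by (metis prod_cases3)
        have r: "cs = Leaf q # cs2" "depth' = depth2" "U' = U2"
          using Cons.prems(4) True fU Some 2 by (simp_all add: v_def)
        from outer[OF less state_ok_remove[OF st True ds(5) Some[unfolded v_def]] ds(1,3) 2]
        obtain W2 where "explored p x ds depth (U - {d, opp M d}) cs2 depth2 U2 W2" by blast
        then show ?thesis
          using explored_leaf[OF st True ds(5,2,6) Some[unfolded v_def]] unfolding r by blast
      qed
    qed
  qed
qed

text \<open>Euler's formula counts all orbits at once, so crossings can be excluded only when the
  whole tour is known. This is why the search was first described by \<open>search\<close> and
  \<open>opened\<close>, and the nested \<open>seg\<close> is derived only here.\<close>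

theorem tour_exists:
  assumes euler: "card (vertices M) + card (faces M) = card (edges M) + 2"
  shows "\<exists>W T. tour M W \<and> tree_tour (opp M) W T"
proof -
  define e where "e = root_dart M"
  define v where "v = vertex_of M e"
  define u where "u = head e"
  define V where "V = darts_after M (opp M e)"
  define C where "C = darts_after M e"
  define depth where "depth = [v \<mapsto> -1, u \<mapsto> (0::int)]"
  define U where "U = darts M - {e, opp M e}"
  have eD: "e \<in> darts M" "opp M e \<in> darts M" using root_in by (simp_all add: e_def)
  have uv: "u \<noteq> v" using loop_free[OF eD(1)] by (simp add: u_def v_def)
  have v_set: "v = set (e # C)" "distinct (e # C)"
    using darts_after_props(1,2)[OF eD(1)] by (simp_all add: v_def C_def)
  have u_set: "u = set (opp M e # V)" "distinct (opp M e # V)"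
    using darts_after_props(1,2)[OF eD(2)] by (simp_all add: u_def V_def)
  have vw: "vertex_of M t = v" if "t \<in> v" for t using that vertex_of_eq unfolding v_def by blast
  have uw: "vertex_of M t = u" if "t \<in> u" for t using that vertex_of_eq unfolding u_def by blast
  have vD: "v \<subseteq> darts M" and uD: "u \<subseteq> darts M"
    using vertex_of_subset eD by (simp_all add: v_def u_def)
  have U_opp: "opp M t \<in> U" if "t \<in> U" for t
  proof -
    have "opp M t \<noteq> opp M e" "opp M t \<noteq> e" using that opp_opp unfolding U_def by auto
    then show ?thesis using that by (simp add: U_def)
  qed
  have st: "state_ok 0 u depth U"
    unfolding state_ok_def
  proof (intro conjI)
    show "\<forall>d \<in> darts M - U. depth (vertex_of M d) \<noteq> None"
      by (auto simp: U_def depth_def u_def v_def)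
    show "\<forall>d \<in> U. \<forall>q. depth (vertex_of M d) = Some q \<longrightarrow> q < 0 \<or> vertex_of M d = u"
      by (auto simp: depth_def)
    show "\<forall>v q. depth v = Some q \<longrightarrow> -1 \<le> q" by (auto simp: depth_def)
    show "depth u = Some 0" by (simp add: depth_def)
    show "\<forall>d \<in> U. opp M d \<in> U" using U_opp by blast
  qed (auto simp: U_def e_def)
  obtain cs depth' U' where ex0: "explore M 0 V depth U = (cs, depth', U')" by (metis prod_cases3)
  have dV: "distinct V" "\<forall>d \<in> set V. d \<in> darts M \<and> vertex_of M d = u" using u_set uw uD by auto
  obtain W1 where ex: "explored 0 u V depth U cs depth' U' W1"
    using explore_explored[OF st dV ex0] by blast
  note mem = exploredD(5)[OF ex]
  have W1: "t \<in> U" "t \<notin> v" "vertex_of M t \<subseteq> insert (opp M e) (fst ` set W1)" if t: "t \<in> fst ` set W1" for t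
  proof -
    have "t \<in> set V \<or> t \<in> darts M \<and> depth (vertex_of M t) = None \<and> depth' (vertex_of M t) \<noteq> None"
      using mem[of t] t by blast
    then have "t \<in> U \<and> t \<notin> v \<and> vertex_of M t \<subseteq> insert (opp M e) (fst ` set W1)"
    proof
      assume t: "t \<in> set V"
      then have tu: "t \<in> u" "t \<noteq> opp M e" using u_set by auto
      then have "t \<notin> v" using uw vw uv by metis
      moreover have "t \<noteq> e" using \<open>t \<notin> v\<close> v_set(1) by auto
      moreover have "t \<in> U" using \<open>t \<noteq> e\<close> tu uD by (auto simp: U_def)
      moreover have "set V \<subseteq> fst ` set W1" using mem by blast
      then have "u \<subseteq> insert (opp M e) (fst ` set W1)" using u_set(1) by auto
      ultimately show ?thesis using uw[OF tu(1)] by simp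
    next
      assume t: "t \<in> darts M \<and> depth (vertex_of M t) = None \<and> depth' (vertex_of M t) \<noteq> None"
      then have n: "vertex_of M t \<noteq> v" "vertex_of M t \<noteq> u" by (auto simp: depth_def split: if_splits)
      then have "t \<noteq> e" "t \<noteq> opp M e" "t \<notin> v" using vw by (auto simp: u_def v_def)
      moreover have "vertex_of M t \<subseteq> fst ` set W1"
      proof
        fix w assume "w \<in> vertex_of M t"
        then have "w \<in> darts M" "vertex_of M w = vertex_of M t" using t vertex_of_subset vertex_of_eq by blast+
        then show "w \<in> fst ` set W1" using mem[of w] t by simp
      qed
      ultimately show ?thesis using t by (auto simp: U_def)
    qed
    then show "t \<in> U" "t \<notin> v" "vertex_of M t \<subseteq> insert (opp M e) (fst ` set W1)" by blast+
  qed
  have e_notin: "e \<notin> fst ` set W1" "opp M e \<notin> fst ` set W1" using W1(1) unfolding U_def by blast+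
  have opens: "t \<in> U" "(opp M t, Close) \<notin> set W1 \<Longrightarrow> opp M t \<notin> fst ` set W1 \<and> head t = v \<and>
      depth (head t) = Some (-1)" if t: "(t, Open) \<in> set W1" for t
  proof -
    have *: "t \<in> U \<and> ((opp M t, Close) \<in> set W1 \<or> opp M t \<notin> fst ` set W1 \<and>
       (head t = u \<or> (\<exists>q < 0. depth (head t) = Some q)))"
      using exploredD(7)[OF ex] t unfolding opens_ok_def by blast
    then show "t \<in> U" by blast
    assume n: "(opp M t, Close) \<notin> set W1"
    have "head t \<noteq> u"
    proof
      assume "head t = u"
      then have "opp M t \<in> set (opp M e # V)" using in_vertex_of_self[of "opp M t"] u_set(1) by blast
      moreover have "opp M t \<noteq> opp M e" using * by (auto simp: U_def)
      ultimately show False using mem[of "opp M t"] * n by auto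
    qed
    then show "opp M t \<notin> fst ` set W1 \<and> head t = v \<and> depth (head t) = Some (-1)"
      using * n uv by (auto simp: depth_def split: if_splits)
  qed
  have closes: "(opp M t, Open) \<in> set W1" if t: "(t, Close) \<in> set W1" for t
  proof -
    have "t \<in> U" using W1(1)[of t] t by force
    then show ?thesis using opened_closed[OF exploredD(6)[OF ex] t] by auto
  qed
  have opp_W1: "(t, Open) \<in> set W1 \<and> head t = v"
    if t: "t \<in> fst ` set W1" "opp M t \<notin> fst ` set W1" for t
  proof -
    obtain l where l: "(t, l) \<in> set W1" using t(1) by auto
    have "l = Open"
    proof (cases l)
      case Down
      then show ?thesis using exploredD(8)[OF ex, of t] l t(2) by force
    next
      case Up
      then show ?thesis using exploredD(9)[OF ex, of t] l t(2) by force
    next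
      case Close
      then show ?thesis using closes[of t] l t(2) by force
    qed simp
    moreover have "(opp M t, Close) \<notin> set W1" using t(2) by force
    ultimately show ?thesis using opens(2)[of t] l by blast
  qed
  define X where "X = {e, opp M e} \<union> fst ` set W1 \<union> opp M ` fst ` set W1"
  have "fst ` set W1 \<subseteq> darts M" using W1(1) unfolding U_def by blast
  then have XD: "X \<subseteq> darts M" using eD unfolding X_def by auto
  \<comment> \<open>If the search missed a dart, the root vertex would separate the reached edges
    from the others.\<close>
  have X: "X = darts M"
  proof (rule ccontr)
    assume "X \<noteq> darts M"
    then show False
    proof (rule cut_vertex[OF nonseparable XD, rotated])
      show "X \<noteq> {}" by (simp add: X_def)
      show "opp M z \<in> X" if zX: "z \<in> X" for z
      proof -
        consider "z = e" | "z = opp M e" | "z \<in> fst ` set W1" | y where "y \<in> fst ` set W1" "z = opp M y"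
          using zX unfolding X_def by blast
        then show ?thesis by cases (simp_all add: X_def)
      qed
      show "vertex_of M z \<subseteq> X" if z: "z \<in> X" "vertex_of M z \<noteq> v" for z
      proof -
        have "set V \<subseteq> fst ` set W1" using mem by blast
        then have uX: "u \<subseteq> X" using u_set(1) by (auto simp: X_def)
        have "z \<noteq> e" using z(2) by (auto simp: v_def)
        then consider "z = opp M e" | "z \<in> fst ` set W1" | y where "y \<in> fst ` set W1" "z = opp M y" "z \<notin> fst ` set W1"
          using z(1) unfolding X_def by blast
        then show ?thesis
        proof cases
          case 1
          then show ?thesis using uX by (simp add: u_def)
        next
          case 2
          then show ?thesis using W1(3) unfolding X_def by blast
        next
          case 3
          then show ?thesis using opp_W1[of y] z(2) by simp
        qed
      qed
    qed
  qed
  have cover: "t \<in> insert (opp M e) (fst ` set W1) \<or> t \<in> v" if t: "t \<in> darts M" for t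
  proof -
    consider "t = e" | "t = opp M e" | "t \<in> fst ` set W1" | y where "y \<in> fst ` set W1" "t = opp M y" "t \<notin> fst ` set W1"
      using t unfolding X[symmetric] X_def by blast
    then show ?thesis
    proof cases
      case 1
      then show ?thesis using v_set(1) by simp
    next
      case 4
      then have "vertex_of M t = v" using opp_W1[of y] by simp
      then show ?thesis using in_vertex_of_self[of t] by blast
    qed auto
  qed
  \<comment> \<open>The search starts beyond the root edge and never explores the root vertex; the
    other darts there are appended as closings.\<close>
  define W where "W = (e, Down) # W1 @ (opp M e, Up) # map (\<lambda>d. (d, Close)) C"
  have W_darts: "fst ` set W = v \<union> insert (opp M e) (fst ` set W1)"
    unfolding W_def v_set(1) by (simp add: image_image image_Un Un_commute insert_commute)
  have oe: "opp M e \<notin> v" using vw[of "opp M e"] uv by (auto simp: u_def)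
  have dW: "distinct (map fst W)"
  proof -
    have "fst ` set W1 \<inter> set (e # C) = {}" using W1(2) v_set(1) by blast
    then show ?thesis
      using exploredD(4)[OF ex] e_notin v_set oe by (auto simp: W_def comp_def)
  qed
  have t: "tour M W"
    unfolding tour_def
  proof (intro conjI)
    have "path M (cw M (opp M e)) W1 (opp M e)"
      using exploredD(11)[OF ex] path_darts_after[OF eD(2)] by (simp add: V_def)
    then show "path M (root_dart M) W (root_dart M)"
      using path_darts_after[OF eD(1)] unfolding W_def e_def[symmetric] C_def by (auto simp: path_append)
    show "fst ` set W = darts M"
    proof
      show "fst ` set W \<subseteq> darts M" using vD eD W1(1) unfolding W_darts U_def by blast
      show "darts M \<subseteq> fst ` set W" using cover unfolding W_darts by blast
    qed
  qed (rule dW)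
  \<comment> \<open>There are no loops, so the far end of a dart of the root vertex lies in
    \<open>W1\<close>. Its opposite does not, and an unpaired dart of \<open>W1\<close> is an
    \<open>Open\<close>.\<close>
  have C_open: "(opp M t, Open) \<in> set W1" if t: "t \<in> set C" for t
  proof -
    have tv: "t \<in> v" "t \<noteq> e" using t v_set by auto
    then have tD: "t \<in> darts M" using vD by blast
    have "opp M t \<notin> v" using vw loop_free[OF tD] tv(1) by metis
    moreover have "opp M t \<noteq> opp M e" using tv(2) by simp
    ultimately have "opp M t \<in> fst ` set W1" using cover[of "opp M t"] tD by simp
    moreover have "opp M (opp M t) \<notin> fst ` set W1" using W1(2) tv(1) opp_opp by metis
    ultimately show ?thesis using opp_W1 by blast
  qed
  have open_close: "(opp M t, Close) \<in> set W" if "(t, Open) \<in> set W" for t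
  proof -
    have t: "(t, Open) \<in> set W1" using that by (auto simp: W_def)
    show ?thesis
    proof (cases "(opp M t, Close) \<in> set W1")
      case False
      have "opp M t \<in> v" using opens(2)[OF t False] in_vertex_of_self[of "opp M t"] by blast
      moreover have "opp M t \<noteq> e" using U_opp[OF opens(1)[OF t]] by (auto simp: U_def)
      ultimately have "opp M t \<in> set C" using v_set(1) by simp
      then show ?thesis by (simp add: W_def)
    qed (simp add: W_def)
  qed
  have close_open: "(opp M t, Open) \<in> set W" if "(t, Close) \<in> set W" for t
    using that closes C_open by (auto simp: W_def)
  have "opened (opp M) {} W"
  proof -
    have "opened (opp M) {} W1"
    proof (rule opened_mono[OF exploredD(6)[OF ex]], intro allI impI)
      fix d assume "(d, Close) \<in> set W1" "d \<in> - U"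
      then show "d \<in> {}" using W1(1)[of d] by force
    qed
    moreover have "opened (opp M) S (map (\<lambda>d. (d, Close)) L)" if "set L \<subseteq> S" for L S
      using that by (induction L) auto
    moreover have "set C \<subseteq> {opp M t |t. (t, Open) \<in> set W1}"
      using C_open by (force intro!: exI[of _ "opp M t" for t])
    ultimately show ?thesis by (simp add: W_def opened_append)
  qed
  then have opened: "(opp M d, Open) \<in> set A" if "W = A @ (d, Close) # B" for d A B
    using that by (auto simp: opened_append)
  have runs: "runs (opp M) Open Close W [] []"
  proof (rule runs_if_nested[OF dW open_close opened])
    show "W \<noteq> A @ (a, Open) # B @ (b, Open) # C @ (opp M a, Close) # E @ (opp M b, Close) # F" for A a B b C E F
    proof
      assume "W = A @ (a, Open) # B @ (b, Open) # C @ (opp M a, Close) # E @ (opp M b, Close) # F"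
      then show False
      proof (rule no_crossing_chords[OF euler t, rotated])
        show "\<exists>l'. l' \<noteq> Down \<and> l' \<noteq> Up \<and> (opp M d, l') \<in> set W"
          if "(d, l) \<in> set W" "l \<noteq> Down" "l \<noteq> Up" for d l
          using that open_close[of d] close_open[of d] by (cases l) auto
      qed
    qed
  qed
  then obtain S where S: "runs (opp M) Open Close W1 [] S" "runs (opp M) Open Close (map (\<lambda>d. (d, Close)) C) S []"
    by (auto simp: W_def runs_append)
  define dep where "dep d = the (depth' (vertex_of M d))" for d
  have "search (opp M) dep 0 cs W1 V" by (rule exploredD(10)[OF ex]) (simp add: dep_def)
  from search_seg[OF this S(1) exploredD(4)[OF ex]]
  obtain Q where Q: "seg (opp M) 0 cs W1 V Q" "S = map snd Q" "\<forall>x \<in> set Q. fst x = dep (opp M (snd x))"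
    by auto
  have C: "map (\<lambda>d. (d, Close)) C = map (\<lambda>x. (opp M (snd x), Close)) Q"
    using S(2) unfolding Q(2) by (intro runs_closings[of _ "length C"]) (simp_all add: comp_def map_replicate_const)
  have "\<forall>x \<in> set Q. fst x < 0"
  proof
    fix x assume x: "x \<in> set Q"
    have n: "(opp M (snd x), Close) \<notin> set W1" using seg_open_not_closed[OF Q(1) exploredD(4)[OF ex]] x by blast
    from opens(2)[OF seg_open_mem[OF Q(1) x] n]
    have "depth (head (snd x)) = Some (-1)" by blast
    then have "depth' (head (snd x)) = Some (-1)"
      using exploredD(2)[OF ex] unfolding map_le_def by (metis domI)
    then show "fst x < 0" using Q(3) x by (simp add: dep_def)
  qed
  moreover have "Q \<noteq> []"
  proof
    assume "Q = []"
    \<comment> \<open>The root edge would be pendant, and its other end a cut vertex.\<close>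
    then have ve: "v = {e}" using C v_set(1) by simp
    show False
    proof (rule cut_vertex[OF nonseparable, of "{e, opp M e}" u])
      show "{e, opp M e} \<noteq> darts M"
      proof
        assume D: "{e, opp M e} = darts M"
        have "edges M \<subseteq> {{e, opp M e}}" unfolding edges_def D[symmetric] by auto
        then have "card (edges M) \<le> 1" using card_mono[of "{{e, opp M e}}"] by simp
        then show False using two_edges by simp
      qed
      show "vertex_of M d \<subseteq> {e, opp M e}" if "d \<in> {e, opp M e}" "vertex_of M d \<noteq> u" for d
        using that ve by (auto simp: u_def v_def)
    qed (use eD in auto)
  qed
  ultimately have "tree_tour (opp M) W (Node (rev cs))"
    using tree_tourI[OF Q(1), of e] unfolding W_def C by blast
  then show ?thesis using t by blast
qed

end

section \<open>Transfer to the inverse of the tree map\<close>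

lemma map_iso_sym:
  assumes M: "dart_map M" and "map_iso M N"
  shows "map_iso N M"
proof -
  interpret dart_map M by fact
  obtain f where f: "bij_betw f (darts M) (darts N)"
    "\<And>d. d \<in> darts M \<Longrightarrow> f (opp M d) = opp N (f d) \<and> f (cw M d) = cw N (f d)"
    "f (root_dart M) = root_dart N"
    using assms(2) unfolding map_iso_def by blast
  define g where "g = inv_into (darts M) f"
  have g: "g (f d) = d" if "d \<in> darts M" for d
    using f(1) that unfolding g_def bij_betw_def by (simp add: inv_into_f_f)
  have fg: "f (g d) = d" "g d \<in> darts M" if "d \<in> darts N" for d
    using f(1) that unfolding g_def bij_betw_def by (auto simp: f_inv_into_f inv_into_into)
  have "bij_betw g (darts N) (darts M)" unfolding g_def by (rule bij_betw_inv_into[OF f(1)])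
  moreover have "g (opp N d) = opp M (g d) \<and> g (cw N d) = cw M (g d)" if d: "d \<in> darts N" for d
    using f(2)[OF fg(2)[OF d]] fg[OF d] g[of "opp M (g d)"] g[of "cw M (g d)"] by simp
  moreover have "g (root_dart N) = root_dart M" using f(3) g[OF root_in] by metis
  ultimately show ?thesis unfolding map_iso_def by blast
qed

theorem theorem4p4:
  fixes M :: "'d rooted_map"
  assumes "nsp_map M"
  shows "tree_of_map (dual M) = h_tree (tree_of_map M) \<and>
         (\<forall>S :: int ltree \<Rightarrow> 'd rooted_map. inverse_of_tree_of_map S \<longrightarrow>
            map_iso (dual M) (S (h_tree (tree_of_map M))))"
proof -
  have planar: "planar_map M" using assms by (simp add: nsp_map_def)
  interpret nonseparable_map M
    using dart_map_if_planar[OF planar] assms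
    by (auto simp: nonseparable_map_def nonseparable_map_axioms_def nsp_map_def)
  obtain W T where t: "tour M W" and T: "tree_tour (opp M) W T"
    using tour_exists planar by (auto simp: planar_map_def)
  note D = nsp_map_dual[OF assms t T]
  have h: "tree_of_map (dual M) = h_tree (tree_of_map M)"
    using D(2) tree_of_map_eq[OF t T] by simp
  moreover have "map_iso (dual M) (S (h_tree (tree_of_map M)))"
    if S: "inverse_of_tree_of_map S" for S :: "int ltree \<Rightarrow> 'd rooted_map"
  proof -
    have "map_iso (S (h_tree (tree_of_map M))) (dual M)"
      using S D(1) unfolding inverse_of_tree_of_map_def h[symmetric] by blast
    \<comment> \<open>Reversing the isomorphism requires its source to be a map. The second half of
      the inverse property grants this, since the reversed tree is decorated.\<close>
    moreover have "nsp_map (S (h_tree (tree_of_map M)))"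
      using S D(2,3) unfolding inverse_of_tree_of_map_def h[symmetric] by simp
    ultimately show ?thesis
      using map_iso_sym dart_map_if_planar by (auto simp: nsp_map_def)
  qed
  ultimately show ?thesis by blast
qed

end
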